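(* For integers $n\geq 2$ and $3\leq k\leq n+1$, $$\vartheta(\mathbb{R}^n,k)=\frac{\vartheta(S^{n-1},k-1,1/2)-m_n}{1-m_n}.$$
   Context: Sphere parameters: $S^{n-1}$ is the unit sphere in $\mathbb{R}^n$ with surface measure $\omega$ normalized to total mass $1$; a continuous $f\colon[-1,1]\to\mathbb{R}$ is of positive type for $S^{n-1}$ if $(f(x\cdot y))_{x,y\in U}$ is positive semidefinite for every finite $U\subseteq S^{n-1}$. For $n\geq2$, $t\in[-1,1)$, $\vartheta(S^{n-1},2,t)$ is the supremum of $\int\int f(x\cdot y)\,d\omega(y)\,d\omega(x)$ over such $f$ with $f(1)=1$, $f(t)=0$; for $n\geq k\geq 3$, $t\in[-1/(k-1),1)$, $\vartheta(S^{n-1},k,t)$ is the supremum of the same integral over such $f$ with $f(1)=1$ and $f(t)\leq\vartheta(S^{n-2},k-1,t/(1+t))$. Euclidean parameter: a continuous $f\colon\mathbb{R}^n\to\mathbb{R}$ is of positive type if $(f(x-y))_{x,y\in U}$ is positive semidefinite for every finite $U\subseteq\mathbb{R}^n$; its mean value is $M(f)=\lim_{T\to\infty}\frac{1}{\operatorname{vol}[-T,T]^n}\int_{[-T,T]^n}f(x)\,dx$; $f$ is radial if $f(x)$ depends only on $\|x\|$, with $f(r)$ its value at norm $r$. $\vartheta(\mathbb{R}^n,k)$ is the supremum of $M(f)$ over continuous radial $f$ of positive type with $f(0)=1$ and $f(1)\leq\vartheta(S^{n-1},k-1,1/2)$. Let $\Omega_n(0)=1$ and $\Omega_n(u)=\Gamma(n/2)(2/u)^{(n-2)/2}J_{(n-2)/2}(u)$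 for $u>0$, where $J_\alpha$ is the Bessel function of the first kind; $m_n$ denotes the global minimum of $\Omega_n$ on $[0,\infty)$ (a negative number). *)

theory Defs
  imports "HOL-Analysis.Analysis"
begin

text \<open>
  The dimension decreases in the recursive definition of the sphere parameter, so it has to be a
  natural number rather than a type. Vectors of real n-space are therefore the extensional functions
  on \<open>{..<n}\<close>, which are the points both of the library's product measure and of its product
  topology over that index set; the norm of \<open>x\<close> is \<open>L2_set x {..<n}\<close>.
  Throughout, \<open>n\<close> is the dimension of the ambient space, so that \<open>usphere n\<close> is the sphere
  usually written with superscript \<open>n - 1\<close>.
\<close>

definition Rn :: "nat \<Rightarrow> (nat \<Rightarrow> real) set" where
  "Rn n = ({..<n} \<rightarrow>\<^sub>E UNIV)"

definition Rn_top :: "nat \<Rightarrow> (nat \<Rightarrow> real) topology" where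
  "Rn_top n = product_topology (\<lambda>_. euclideanreal) {..<n}"

definition Rn_lebesgue :: "nat \<Rightarrow> (nat \<Rightarrow> real) measure" where
  "Rn_lebesgue n = (\<Pi>\<^sub>M i\<in>{..<n}. lborel)"

definition vdot :: "nat \<Rightarrow> (nat \<Rightarrow> real) \<Rightarrow> (nat \<Rightarrow> real) \<Rightarrow> real" where
  "vdot n x y = (\<Sum>i<n. x i * y i)"

definition vdiff :: "nat \<Rightarrow> (nat \<Rightarrow> real) \<Rightarrow> (nat \<Rightarrow> real) \<Rightarrow> nat \<Rightarrow> real" where
  "vdiff n x y = (\<lambda>i\<in>{..<n}. x i - y i)"

definition usphere :: "nat \<Rightarrow> (nat \<Rightarrow> real) set" where
  "usphere n = {x \<in> Rn n. L2_set x {..<n} = 1}"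

text \<open>
  Normalized surface measure in polar coordinates: the measure of a set \<open>A\<close> of unit vectors is
  the proportion of the unit ball occupied by the cone over \<open>A\<close>. (The radial projection sends
  the origin to itself, a null set that is removed by the restriction to the sphere.)
\<close>

definition sphere_measure :: "nat \<Rightarrow> (nat \<Rightarrow> real) measure" where
  "sphere_measure n =
     restrict_space
       (distr (uniform_measure (Rn_lebesgue n) {x \<in> Rn n. L2_set x {..<n} \<le> 1}) (Rn_lebesgue n)
         (\<lambda>x. \<lambda>i\<in>{..<n}. x i / L2_set x {..<n}))
       (usphere n)"

definition psd_matrix_on :: "'a set \<Rightarrow> ('a \<Rightarrow> 'a \<Rightarrow> real) \<Rightarrow> bool" where
  "psd_matrix_on U K \<longleftrightarrow>
     (\<forall>x\<in>U. \<forall>y\<in>U. K x y = K y x) \<and>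
     (\<forall>c :: 'a \<Rightarrow> real. 0 \<le> (\<Sum>x\<in>U. \<Sum>y\<in>U. K x y * c x * c y))"

definition positive_type_sphere :: "nat \<Rightarrow> (real \<Rightarrow> real) \<Rightarrow> bool" where
  "positive_type_sphere n f \<longleftrightarrow>
     continuous_on {-1..1} f \<and>
     (\<forall>U. finite U \<and> U \<subseteq> usphere n \<longrightarrow> psd_matrix_on U (\<lambda>x y. f (vdot n x y)))"

definition sphere_integral :: "nat \<Rightarrow> (real \<Rightarrow> real) \<Rightarrow> real" where
  "sphere_integral n f =
     (LINT x|sphere_measure n. LINT y|sphere_measure n. f (vdot n x y))"

text \<open>
  \<open>theta_sphere n k t\<close> is the parameter of the unit sphere of real n-space. It is only meaningful
  for \<open>n \<ge> k \<ge> 2\<close> and \<open>-1 / (k - 1) \<le> t < 1\<close>; it is left unspecified for \<open>k < 2\<close>.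
\<close>

fun theta_sphere :: "nat \<Rightarrow> nat \<Rightarrow> real \<Rightarrow> real" where
  "theta_sphere n (Suc (Suc 0)) t =
     Sup {sphere_integral n f | f. positive_type_sphere n f \<and> f 1 = 1 \<and> f t = 0}"
| "theta_sphere n (Suc (Suc (Suc k))) t =
     Sup {sphere_integral n f | f. positive_type_sphere n f \<and> f 1 = 1 \<and>
            f t \<le> theta_sphere (n - 1) (Suc (Suc k)) (t / (1 + t))}"
| "theta_sphere n _ t = undefined"

definition positive_type_Rn :: "nat \<Rightarrow> ((nat \<Rightarrow> real) \<Rightarrow> real) \<Rightarrow> bool" where
  "positive_type_Rn n f \<longleftrightarrow>
     continuous_map (Rn_top n) euclideanreal f \<and>
     (\<forall>U. finite U \<and> U \<subseteq> Rn n \<longrightarrow> psd_matrix_on U (\<lambda>x y. f (vdiff n x y)))"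

definition radial :: "nat \<Rightarrow> ((nat \<Rightarrow> real) \<Rightarrow> real) \<Rightarrow> bool" where
  "radial n f \<longleftrightarrow>
     (\<forall>x\<in>Rn n. \<forall>y\<in>Rn n. L2_set x {..<n} = L2_set y {..<n} \<longrightarrow> f x = f y)"

definition cube :: "nat \<Rightarrow> real \<Rightarrow> (nat \<Rightarrow> real) set" where
  "cube n T = ({..<n} \<rightarrow>\<^sub>E {-T..T})"

definition mean_value :: "nat \<Rightarrow> ((nat \<Rightarrow> real) \<Rightarrow> real) \<Rightarrow> real" where
  "mean_value n f =
     Lim at_top (\<lambda>T. 1 / measure (Rn_lebesgue n) (cube n T) * (LINT x:cube n T|Rn_lebesgue n. f x))"

definition theta_Rn :: "nat \<Rightarrow> nat \<Rightarrow> real" where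
  "theta_Rn n k =
     Sup {mean_value n f | f. positive_type_Rn n f \<and> radial n f \<and>
            f (\<lambda>i\<in>{..<n}. 0) = 1 \<and>
            (\<forall>x\<in>usphere n. f x \<le> theta_sphere n (k - 1) (1 / 2))}"

text \<open>The power series of the Bessel function of the first kind, valid for positive arguments.\<close>

definition Bessel_J :: "real \<Rightarrow> real \<Rightarrow> real" where
  "Bessel_J \<alpha> u =
     (\<Sum>j. (-1) ^ j / (fact j * Gamma (real j + \<alpha> + 1)) * (u / 2) powr (2 * real j + \<alpha>))"

definition Omega :: "nat \<Rightarrow> real \<Rightarrow> real" where
  "Omega n u =
     (if u = 0 then 1
      else Gamma (real n / 2) * (2 / u) powr ((real n - 2) / 2) * Bessel_J ((real n - 2) / 2) u)"

definition Omega_min :: "nat \<Rightarrow> real" where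
  "Omega_min n = (LEAST v. v \<in> Omega n ` {0..})"

end

theory Submission
  imports Defs "HOL-Probability.Distributions"
begin

text \<open>
  Write \<open>m\<close> for the minimum of \<open>\<Omega>\<close> and \<open>M\<close> for the mean value of a feasible function \<open>f\<close>. If \<open>f\<close> is of
  positive type, then so is \<open>f - M\<close>, and a radial function \<open>g\<close> of positive type satisfies
  \<open>m * g 0 \<le> g 1\<close>; for \<open>g = f - M\<close> this is the upper bound. It is attained by
  \<open>a + (1 - a) * \<Omega>(u |x|)\<close>, where \<open>\<Omega> u = m\<close> and \<open>a\<close> is the claimed value, which lies between
  0 and 1 because the sphere parameter does.

  The inequality \<open>m * g 0 \<le> g 1\<close> is obtained without Bochner's theorem, by testing \<open>g\<close> against
  \<open>p(z) = \<integral> \<Omega>(|\<xi>| |z|) (\<Omega>(|\<xi>|) - m) exp(- s |\<xi>|^2) d\<xi>\<close>. This is of positive type, so by Schur's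
  product theorem \<open>g p\<close> is of positive type and has nonnegative integral; as \<open>s\<close> tends to 0, Weber's
  formula shows that \<open>p\<close> concentrates on the unit sphere with mass 1 and at the origin with mass \<open>- m\<close>
  (up to a common factor). That \<open>\<Omega>(|x|)\<close> itself is of positive type follows by applying powers of the
  negative Laplacian, which preserve positive type, to Gaussians.
\<close>

section \<open>Positive semidefinite kernels\<close>

text \<open>\<open>Omega\<close> is given by a power series and not as a spherical average of plane
  waves, so its bounds, its positive type and its integrals are all drawn from identities between
  coefficients, such as the fact that the negative Laplacian fixes the series. The test function p
  comes from the spectral picture. If g(z) is the integral of \<Omega>(|\<xi>| |z|) against a
  positive measure \<nu>, then g(1) - m g(0) is the integral of \<Omega>(|\<xi>|) - m against \<nu>,
  visibly nonnegative. The integral of g p over space is this quantity damped by a Gaussian factor,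
  up to a constant, by Parseval's identity; but its sign can be seen without \<nu>. In the same
  picture the mean value is the mass of \<nu> at the origin. Its substitute is the largest a for
  which f - a is of positive type. This one characterization gives both the subtraction of the mean
  in the upper bound and the mean value of the extremal function. The recursion for the sphere
  parameter is never solved: only the bounds 0 and 1 enter, and the lower one again comes from
  \<Omega>, restricted to a sphere.\<close>

definition psd_kernel :: "'a set \<Rightarrow> ('a \<Rightarrow> 'a \<Rightarrow> real) \<Rightarrow> bool" where
  "psd_kernel X K \<longleftrightarrow> (\<forall>U. finite U \<and> U \<subseteq> X \<longrightarrow> psd_matrix_on U K)"

lemma psd_kernelI:
  assumes "\<And>x y. x \<in> X \<Longrightarrow> y \<in> X \<Longrightarrow> K x y = K y x"
    and "\<And>U c. finite U \<Longrightarrow> U \<subseteq> X \<Longrightarrow> 0 \<le> (\<Sum>x\<in>U. \<Sum>y\<in>U. K x y * c x * c y)"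
  shows "psd_kernel X K"
  unfolding psd_kernel_def psd_matrix_on_def
proof (intro allI impI conjI ballI)
  fix U x y assume "finite U \<and> U \<subseteq> X" "x \<in> U" "y \<in> U"
  then show "K x y = K y x" using assms(1) by blast
next
  fix U c assume "finite U \<and> U \<subseteq> X"
  then show "0 \<le> (\<Sum>x\<in>U. \<Sum>y\<in>U. K x y * c x * c y)" using assms(2) by blast
qed

lemma psd_kernel_sym:
  assumes "psd_kernel X K" "x \<in> X" "y \<in> X"
  shows "K x y = K y x"
proof -
  have "psd_matrix_on {x, y} K"
    using assms(1)[unfolded psd_kernel_def, rule_format, of "{x, y}"] assms(2,3) by simp
  then show ?thesis unfolding psd_matrix_on_def by blast
qed

lemma psd_kernel_quad:
  assumes "psd_kernel X K" "finite U" "U \<subseteq> X"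
  shows "0 \<le> (\<Sum>x\<in>U. \<Sum>y\<in>U. K x y * c x * c y)"
  using assms unfolding psd_kernel_def psd_matrix_on_def by blast

text \<open>Points of a family may coincide: weights at equal points are added up, which leaves a
  form over the image set. Needed because the maps applied to points later on need not be injective
  on the points at hand.\<close>

lemma psd_kernel_family:
  fixes K :: "'a \<Rightarrow> 'a \<Rightarrow> real"
  assumes "psd_kernel X K" "finite I" "x ` I \<subseteq> X"
  shows "0 \<le> (\<Sum>i\<in>I. \<Sum>j\<in>I. K (x i) (x j) * c i * c j)"
proof -
  define C where "C p = (\<Sum>i\<in>{i\<in>I. x i = p}. c i)" for p
  have inner: "(\<Sum>j\<in>I. K p (x j) * e * c j) = (\<Sum>q\<in>x ` I. K p q * e * C q)" for p e
  proof -
    have "(\<Sum>j\<in>I. K p (x j) * e * c j)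
        = (\<Sum>q\<in>x ` I. \<Sum>j\<in>{j\<in>I. x j = q}. K p (x j) * e * c j)"
      by (rule sum.image_gen[OF assms(2)])
    also have "\<dots> = (\<Sum>q\<in>x ` I. K p q * e * C q)"
      unfolding C_def sum_distrib_left by (intro sum.cong refl) auto
    finally show ?thesis .
  qed
  have "(\<Sum>i\<in>I. \<Sum>j\<in>I. K (x i) (x j) * c i * c j)
      = (\<Sum>i\<in>I. c i * (\<Sum>q\<in>x ` I. K (x i) q * 1 * C q))"
    unfolding inner[symmetric] sum_distrib_left by (intro sum.cong refl) (simp add: ac_simps)
  also have "\<dots> = (\<Sum>p\<in>x ` I. \<Sum>i\<in>{i\<in>I. x i = p}. c i * (\<Sum>q\<in>x ` I. K (x i) q * 1 * C q))"
    by (rule sum.image_gen[OF assms(2)])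
  also have "\<dots> = (\<Sum>p\<in>x ` I. C p * (\<Sum>q\<in>x ` I. K p q * 1 * C q))"
    unfolding C_def sum_distrib_right by (intro sum.cong refl) auto
  also have "\<dots> = (\<Sum>p\<in>x ` I. \<Sum>q\<in>x ` I. K p q * C p * C q)"
    unfolding sum_distrib_left by (intro sum.cong refl) (simp add: ac_simps)
  finally show ?thesis
    using psd_kernel_quad[OF assms(1) finite_imageI[OF assms(2)] assms(3)] by simp
qed

lemma psd_kernel_pullback:
  assumes "psd_kernel X K" "g ` Y \<subseteq> X"
  shows "psd_kernel Y (\<lambda>x y. K (g x) (g y))"
proof (rule psd_kernelI)
  show "K (g x) (g y) = K (g y) (g x)" if "x \<in> Y" "y \<in> Y" for x y
    using psd_kernel_sym[OF assms(1), of "g x" "g y"] assms(2) that by auto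
  show "0 \<le> (\<Sum>x\<in>U. \<Sum>y\<in>U. K (g x) (g y) * c x * c y)" if "finite U" "U \<subseteq> Y" for U c
    using psd_kernel_family[OF assms(1) that(1), of g c] assms(2) that(2) by blast
qed

lemma psd_kernel_cong:
  assumes "psd_kernel X K" "\<And>x y. x \<in> X \<Longrightarrow> y \<in> X \<Longrightarrow> K x y = K' x y"
  shows "psd_kernel X K'"
proof (rule psd_kernelI)
  show "K' x y = K' y x" if "x \<in> X" "y \<in> X" for x y
    using psd_kernel_sym[OF assms(1), of x y] assms(2) that by auto
  show "0 \<le> (\<Sum>x\<in>U. \<Sum>y\<in>U. K' x y * c x * c y)" if "finite U" "U \<subseteq> X" for U c
  proof -
    have "(\<Sum>x\<in>U. \<Sum>y\<in>U. K' x y * c x * c y) = (\<Sum>x\<in>U. \<Sum>y\<in>U. K x y * c x * c y)"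
      using assms(2) that(2) by (intro sum.cong refl) (metis subsetD)
    then show ?thesis using psd_kernel_quad[OF assms(1) that] by simp
  qed
qed

lemma psd_kernel_add:
  assumes "psd_kernel X K" "psd_kernel X L"
  shows "psd_kernel X (\<lambda>x y. K x y + L x y)"
proof (rule psd_kernelI)
  show "K x y + L x y = K y x + L y x" if "x \<in> X" "y \<in> X" for x y
    using psd_kernel_sym[OF assms(1) that] psd_kernel_sym[OF assms(2) that] by simp
  show "0 \<le> (\<Sum>x\<in>U. \<Sum>y\<in>U. (K x y + L x y) * c x * c y)" if "finite U" "U \<subseteq> X" for U c
    using psd_kernel_quad[OF assms(1) that, of c] psd_kernel_quad[OF assms(2) that, of c]
    by (simp add: distrib_right sum.distrib)
qed

lemma psd_kernel_cmult:
  assumes "psd_kernel X K" "0 \<le> a"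
  shows "psd_kernel X (\<lambda>x y. a * K x y)"
proof (rule psd_kernelI)
  show "a * K x y = a * K y x" if "x \<in> X" "y \<in> X" for x y
    using psd_kernel_sym[OF assms(1) that] by simp
  show "0 \<le> (\<Sum>x\<in>U. \<Sum>y\<in>U. (a * K x y) * c x * c y)" if "finite U" "U \<subseteq> X" for U c
    using mult_nonneg_nonneg[OF assms(2) psd_kernel_quad[OF assms(1) that, of c]]
    by (simp add: sum_distrib_left ac_simps)
qed

lemma psd_kernel_rank_one: "psd_kernel X (\<lambda>x y. g x * g y)"
proof (rule psd_kernelI)
  show "0 \<le> (\<Sum>x\<in>U. \<Sum>y\<in>U. g x * g y * c x * c y)" for U c
  proof -
    have "(\<Sum>x\<in>U. \<Sum>y\<in>U. g x * g y * c x * c y) = (\<Sum>x\<in>U. g x * c x)\<^sup>2"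
      unfolding power2_eq_square sum_product by (intro sum.cong refl) simp
    then show ?thesis by simp
  qed
qed simp

lemma psd_kernel_const:
  assumes "0 \<le> a"
  shows "psd_kernel X (\<lambda>x y. a)"
  using psd_kernel_cmult[OF psd_kernel_rank_one[of X "\<lambda>_. 1"] assms]
  by (simp only: mult_1_right)

lemma psd_kernel_sum:
  assumes "\<And>i. i \<in> I \<Longrightarrow> psd_kernel X (K i)"
  shows "psd_kernel X (\<lambda>x y. \<Sum>i\<in>I. K i x y)"
  using assms
proof (cases "finite I")
  case True
  then show ?thesis using assms
  proof (induction I)
    case empty
    then show ?case by (simp only: sum.empty psd_kernel_const)
  next
    case (insert i I)
    have "psd_kernel X (\<lambda>x y. K i x y + (\<Sum>i\<in>I. K i x y))"
      by (rule psd_kernel_add) (use insert in blast)+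
    then show ?case by (simp only: sum.insert[OF insert.hyps])
  qed
qed (simp only: sum.infinite psd_kernel_const order_refl not_False_eq_True)

lemma psd_kernel_limit:
  assumes "\<And>n. psd_kernel X (K n)"
    and "\<And>x y. x \<in> X \<Longrightarrow> y \<in> X \<Longrightarrow> (\<lambda>n::nat. K n x y) \<longlonglongrightarrow> L x y"
  shows "psd_kernel X L"
proof (rule psd_kernelI)
  show "L x y = L y x" if "x \<in> X" "y \<in> X" for x y
  proof (rule LIMSEQ_unique[OF assms(2)[OF that]])
    show "(\<lambda>n. K n x y) \<longlonglongrightarrow> L y x"
      using assms(2)[OF that(2,1)] psd_kernel_sym[OF assms(1) that] by simp
  qed
  show "0 \<le> (\<Sum>x\<in>U. \<Sum>y\<in>U. L x y * c x * c y)" if "finite U" "U \<subseteq> X" for U c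
  proof (rule LIMSEQ_le_const)
    show "(\<lambda>n. \<Sum>x\<in>U. \<Sum>y\<in>U. K n x y * c x * c y) \<longlonglongrightarrow> (\<Sum>x\<in>U. \<Sum>y\<in>U. L x y * c x * c y)"
      using that assms(2) by (intro tendsto_intros) auto
    show "\<exists>N. \<forall>n\<ge>N. 0 \<le> (\<Sum>x\<in>U. \<Sum>y\<in>U. K n x y * c x * c y)"
      using psd_kernel_quad[OF assms(1) that] by blast
  qed
qed

section \<open>Schur's product theorem and its consequences\<close>

lemma quad_form_insert:
  fixes K :: "'a \<Rightarrow> 'a \<Rightarrow> real"
  assumes "finite U" "a \<notin> U" "\<And>y. y \<in> U \<Longrightarrow> K y a = K a y"
  shows "(\<Sum>x\<in>insert a U. \<Sum>y\<in>insert a U. K x y * c x * c y)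
    = K a a * (c a)\<^sup>2 + 2 * c a * (\<Sum>y\<in>U. K a y * c y) + (\<Sum>x\<in>U. \<Sum>y\<in>U. K x y * c x * c y)"
proof -
  have 1: "(\<Sum>x\<in>U. K x a * c x * c a) = c a * (\<Sum>y\<in>U. K a y * c y)"
    unfolding sum_distrib_left by (intro sum.cong refl) (simp only: assms(3), simp)
  have 2: "(\<Sum>y\<in>U. K a y * c a * c y) = c a * (\<Sum>y\<in>U. K a y * c y)"
    unfolding sum_distrib_left by (intro sum.cong refl) simp
  have "(\<Sum>x\<in>insert a U. \<Sum>y\<in>insert a U. K x y * c x * c y)
    = K a a * c a * c a + (\<Sum>y\<in>U. K a y * c a * c y)
      + ((\<Sum>x\<in>U. K x a * c x * c a) + (\<Sum>x\<in>U. \<Sum>y\<in>U. K x y * c x * c y))"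
    by (simp only: sum.insert[OF assms(1,2)] sum.distrib)
  then show ?thesis unfolding 1 2 by (simp add: power2_eq_square)
qed

lemma linear_nonneg_imp_zero:
  fixes a b :: real
  assumes "\<And>t. 0 \<le> a * t + b"
  shows "a = 0"
proof (rule ccontr)
  assume "a \<noteq> 0"
  then show False using assms[of "- (b + 1) / a"] by simp
qed

text \<open>One step of Gaussian elimination splits off a rank one kernel and leaves a kernel that
  vanishes at the eliminated point.\<close>

lemma schur_product_aux:
  fixes K M :: "'a \<Rightarrow> 'a \<Rightarrow> real"
  assumes "psd_kernel X M" "finite U"
  shows "U \<subseteq> X \<Longrightarrow> \<forall>x\<in>U. \<forall>y\<in>U. K x y = K y x \<Longrightarrow>
    \<forall>c. 0 \<le> (\<Sum>x\<in>U. \<Sum>y\<in>U. K x y * c x * c y) \<Longrightarrow>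
    0 \<le> (\<Sum>x\<in>U. \<Sum>y\<in>U. K x y * M x y * c x * c y)"
  using assms(2)
proof (induction U arbitrary: K c)
  case empty
  then show ?case by simp
next
  case (insert a U)
  have sym: "K x y = K y x" if "x \<in> insert a U" "y \<in> insert a U" for x y
    using insert.prems(2) that by blast
  have quad: "0 \<le> K a a * (c a)\<^sup>2 + 2 * c a * (\<Sum>y\<in>U. K a y * c y)
      + (\<Sum>x\<in>U. \<Sum>y\<in>U. K x y * c x * c y)" for c
  proof -
    have *: "K y a = K a y" if "y \<in> U" for y using sym that by blast
    have "(\<Sum>x\<in>insert a U. \<Sum>y\<in>insert a U. K x y * c x * c y)
      = K a a * (c a)\<^sup>2 + 2 * c a * (\<Sum>y\<in>U. K a y * c y)
        + (\<Sum>x\<in>U. \<Sum>y\<in>U. K x y * c x * c y)"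
      by (rule quad_form_insert) (use insert.hyps * in auto)
    then show ?thesis using insert.prems(3)[rule_format, of c] by linarith
  qed
  define d where "d = K a a"
  have d0: "0 \<le> d"
  proof -
    let ?c = "\<lambda>x. of_bool (x = a)"
    have "(\<Sum>y\<in>U. K a y * ?c y) = 0" "(\<Sum>x\<in>U. \<Sum>y\<in>U. K x y * ?c x * ?c y) = 0"
      using insert.hyps by (auto intro!: sum.neutral)
    then show ?thesis using quad[of ?c] by (simp add: d_def)
  qed
  \<comment> \<open>A vanishing pivot forces a vanishing row: with weight t at \<open>a\<close> and
    1 at \<open>y\<close> the form is affine in t, so its slope must be 0.\<close>
  have zero: "K a y = 0" if "d = 0" "y \<in> U" for y
  proof -
    have ya: "y \<noteq> a" using that insert.hyps by auto
    have "0 \<le> (2 * K a y) * t + K y y" for t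
    proof -
      let ?c = "\<lambda>x. if x = a then t else of_bool (x = y)"
      have single: "(\<Sum>y\<in>U. K z y * ?c y) = K z y" for z
        using insert.hyps that ya by (subst sum.remove[of _ y]) (auto intro!: sum.neutral split: if_splits)
      moreover have "(\<Sum>x\<in>U. \<Sum>y\<in>U. K x y * ?c x * ?c y) = K y y"
      proof -
        have "(\<Sum>x\<in>U. \<Sum>y\<in>U. K x y * ?c x * ?c y) = (\<Sum>x\<in>U. ?c x * (\<Sum>y\<in>U. K x y * ?c y))"
          by (simp add: sum_distrib_left ac_simps)
        also have "\<dots> = (\<Sum>x\<in>U. ?c x * K x y)"
          by (simp only: single)
        also have "\<dots> = K y y"
          using insert.hyps that ya by (subst sum.remove[of _ y]) (auto intro!: sum.neutral split: if_splits)
        finally show ?thesis .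
      qed
      ultimately show ?thesis using quad[of ?c] that(1) single[of a] by (simp add: d_def ac_simps)
    qed
    from linear_nonneg_imp_zero[OF this] show ?thesis by simp
  qed
  \<comment> \<open>The Schur complement. For \<open>d = 0\<close> division by zero makes it
    \<open>K\<close> itself, whose row at \<open>a\<close> is then already zero.\<close>
  define L where "L x y = K x y - K x a * K a y / d" for x y
  have La: "L a y = 0" "L y a = 0" if "y \<in> insert a U" for y
    using that zero sym[of y a] by (auto simp: L_def d_def)
  have IH: "0 \<le> (\<Sum>x\<in>U. \<Sum>y\<in>U. L x y * M x y * c x * c y)"
  proof (rule insert.IH)
    show "U \<subseteq> X" using insert.prems(1) by simp
    show "\<forall>x\<in>U. \<forall>y\<in>U. L x y = L y x"
      using sym by (simp add: L_def)
    show "\<forall>c. 0 \<le> (\<Sum>x\<in>U. \<Sum>y\<in>U. L x y * c x * c y)"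
    proof
      fix c
      define S where "S = (\<Sum>y\<in>U. K a y * c y)"
      have "(\<Sum>x\<in>U. \<Sum>y\<in>U. L x y * c x * c y)
          = (\<Sum>x\<in>U. \<Sum>y\<in>U. K x y * c x * c y) - (\<Sum>x\<in>U. \<Sum>y\<in>U. (K a x * c x) * (K a y * c y) / d)"
        unfolding sum_subtractf[symmetric] using sym
        by (intro sum.cong refl) (simp add: L_def field_simps)
      also have "(\<Sum>x\<in>U. \<Sum>y\<in>U. (K a x * c x) * (K a y * c y) / d) = S\<^sup>2 / d"
        unfolding S_def power2_eq_square sum_product by (simp add: sum_divide_distrib)
      finally have *: "(\<Sum>x\<in>U. \<Sum>y\<in>U. L x y * c x * c y)
          = (\<Sum>x\<in>U. \<Sum>y\<in>U. K x y * c x * c y) - S\<^sup>2 / d" .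
      \<comment> \<open>The weight at \<open>a\<close> that minimizes the form of \<open>K\<close>
        for given weights on \<open>U\<close>; completing the square turns that minimum into the
        form of \<open>L\<close>.\<close>
      define e where "e = (\<lambda>x. if x = a then - S / d else c x)"
      have e: "(\<Sum>y\<in>U. K a y * e y) = S" "e a = - S / d"
        "(\<Sum>x\<in>U. \<Sum>y\<in>U. K x y * e x * e y) = (\<Sum>x\<in>U. \<Sum>y\<in>U. K x y * c x * c y)"
        unfolding S_def e_def using insert.hyps by (auto intro!: sum.cong)
      show "0 \<le> (\<Sum>x\<in>U. \<Sum>y\<in>U. L x y * c x * c y)"
        using quad[of e] unfolding e * d_def[symmetric]
        by (cases "d = 0") (auto simp: power2_eq_square field_simps)
    qed
  qed
  \<comment> \<open>The eliminated rank one part, multiplied by \<open>M\<close>, is the form of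
    \<open>M\<close> itself with the weights \<open>c x * K a x\<close>.\<close>
  have "(\<Sum>x\<in>insert a U. \<Sum>y\<in>insert a U. K x y * M x y * c x * c y)
      = (\<Sum>x\<in>insert a U. \<Sum>y\<in>insert a U. L x y * M x y * c x * c y)
        + (\<Sum>x\<in>insert a U. \<Sum>y\<in>insert a U. M x y * (c x * K a x) * (c y * K a y)) / d"
    unfolding sum_divide_distrib sum.distrib[symmetric]
    using sym by (intro sum.cong refl) (simp add: L_def field_simps)
  also have "(\<Sum>x\<in>insert a U. \<Sum>y\<in>insert a U. L x y * M x y * c x * c y)
      = (\<Sum>x\<in>U. \<Sum>y\<in>U. L x y * M x y * c x * c y)"
    using insert.hyps La by (simp add: sum.insert)
  finally show ?case
    using IH psd_kernel_quad[OF assms(1) _ insert.prems(1), of "\<lambda>x. c x * K a x"] d0 insert.hyps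
    by (simp del: sum.insert)
qed

lemma psd_kernel_mult:
  assumes "psd_kernel X K" "psd_kernel X M"
  shows "psd_kernel X (\<lambda>x y. K x y * M x y)"
proof (rule psd_kernelI)
  show "K x y * M x y = K y x * M y x" if "x \<in> X" "y \<in> X" for x y
    using psd_kernel_sym[OF assms(1) that] psd_kernel_sym[OF assms(2) that] by simp
  show "0 \<le> (\<Sum>x\<in>U. \<Sum>y\<in>U. K x y * M x y * c x * c y)" if "finite U" "U \<subseteq> X" for U c
  proof (rule schur_product_aux[OF assms(2) that(1,2)])
    show "\<forall>x\<in>U. \<forall>y\<in>U. K x y = K y x" using psd_kernel_sym[OF assms(1)] that(2) by blast
    show "\<forall>c. 0 \<le> (\<Sum>x\<in>U. \<Sum>y\<in>U. K x y * c x * c y)"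
      using psd_kernel_quad[OF assms(1) that] by blast
  qed
qed

lemma psd_kernel_power:
  assumes "psd_kernel X K"
  shows "psd_kernel X (\<lambda>x y. K x y ^ k)"
  by (induction k) (simp_all only: power.simps psd_kernel_const psd_kernel_mult[OF assms] zero_le_one)

lemma psd_kernel_exp:
  assumes "psd_kernel X K"
  shows "psd_kernel X (\<lambda>x y. exp (K x y))"
proof (rule psd_kernel_limit)
  show "psd_kernel X (\<lambda>x y. \<Sum>i<n. inverse (fact i) * K x y ^ i)" for n
    by (intro psd_kernel_sum psd_kernel_cmult psd_kernel_power assms) simp
  show "(\<lambda>n. \<Sum>i<n. inverse (fact i) * K x y ^ i) \<longlonglongrightarrow> exp (K x y)" for x y
    using exp_converges[of "K x y"] by (simp add: sums_def)
qed

text \<open>The weights (1, 1) and (1, -1) on two points give the two inequalities.\<close>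

lemma psd_kernel_bound:
  assumes "psd_kernel X K" "x \<in> X" "y \<in> X" "\<And>z. z \<in> X \<Longrightarrow> K z z = d"
  shows "\<bar>K x y\<bar> \<le> d"
proof (cases "x = y")
  case True
  then show ?thesis
    using psd_kernel_quad[OF assms(1), of "{x}" "\<lambda>_. 1"] assms by auto
next
  case False
  then show ?thesis
    using psd_kernel_quad[OF assms(1), of "{x, y}" "\<lambda>_. 1"]
      psd_kernel_quad[OF assms(1), of "{x, y}" "\<lambda>z. if z = x then 1 else -1"]
      psd_kernel_sym[OF assms(1,2,3)] assms(2-4) by (auto simp: abs_if)
qed

definition sqdist :: "nat \<Rightarrow> (nat \<Rightarrow> real) \<Rightarrow> (nat \<Rightarrow> real) \<Rightarrow> real" where
  "sqdist n x y = (\<Sum>i<n. (x i - y i)\<^sup>2)"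

text \<open>Expanding the squared distance splits the Gaussian into a rank one kernel and the
  exponential of a multiple of the inner product.\<close>

lemma psd_kernel_gaussian:
  assumes "0 \<le> s"
  shows "psd_kernel UNIV (\<lambda>x y. exp (- s * sqdist n x y))"
proof -
  have dot: "psd_kernel UNIV (\<lambda>x y. \<Sum>i<n. x i * y i)"
    by (intro psd_kernel_sum psd_kernel_rank_one)
  have "psd_kernel UNIV (\<lambda>x y. (exp (- s * (\<Sum>i<n. (x i)\<^sup>2)) * exp (- s * (\<Sum>i<n. (y i)\<^sup>2)))
      * exp (2 * s * (\<Sum>i<n. x i * y i)))"
    by (intro psd_kernel_mult psd_kernel_rank_one psd_kernel_exp psd_kernel_cmult dot)
      (use assms in simp)
  then show ?thesis
  proof (rule psd_kernel_cong)
    fix x y :: "nat \<Rightarrow> real"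
    have "- s * sqdist n x y = - s * (\<Sum>i<n. (x i)\<^sup>2) + - s * (\<Sum>i<n. (y i)\<^sup>2) + 2 * s * (\<Sum>i<n. x i * y i)"
      unfolding sqdist_def sum_distrib_left sum.distrib[symmetric]
      by (intro sum.cong refl) (simp add: power2_diff algebra_simps)
    then show "exp (- s * (\<Sum>i<n. (x i)\<^sup>2)) * exp (- s * (\<Sum>i<n. (y i)\<^sup>2)) * exp (2 * s * (\<Sum>i<n. x i * y i))
      = exp (- s * sqdist n x y)"
      by (simp only: exp_add)
  qed
qed

section \<open>Positive type of the function \<open>\<Omega>\<close>\<close>

text \<open>The old form, evaluated with weight \<open>c x\<close> at \<open>x\<close> and
  \<open>- c x\<close> at \<open>s x\<close>. For a translation \<open>s\<close> along an axis this
  is a discrete negative second derivative of a kernel that depends on differences only.\<close>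

lemma psd_kernel_shift_difference:
  assumes "psd_kernel UNIV K"
  shows "psd_kernel UNIV (\<lambda>x y. K x y + K (s x) (s y) - K x (s y) - K (s x) y)"
proof (rule psd_kernelI)
  note sym = psd_kernel_sym[OF assms UNIV_I UNIV_I]
  show "K x y + K (s x) (s y) - K x (s y) - K (s x) y
      = K y x + K (s y) (s x) - K y (s x) - K (s y) x" for x y
    using sym[of x y] sym[of "s x" "s y"] sym[of x "s y"] sym[of "s x" y] by simp
  show "0 \<le> (\<Sum>x\<in>U. \<Sum>y\<in>U. (K x y + K (s x) (s y) - K x (s y) - K (s x) y) * c x * c y)"
    if "finite U" for U c
  proof -
    define p where "p = (\<lambda>(u, b). if b then s u else u)"
    define e where "e = (\<lambda>(u, b). if b then - c u else c u)"
    have "0 \<le> (\<Sum>i\<in>U \<times> UNIV. \<Sum>j\<in>U \<times> UNIV. K (p i) (p j) * e i * e j)"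
      by (rule psd_kernel_family[OF assms]) (use that in auto)
    also have "\<dots> = (\<Sum>x\<in>U. \<Sum>b\<in>UNIV. \<Sum>y\<in>U. \<Sum>b'\<in>UNIV. K (p (x, b)) (p (y, b')) * e (x, b) * e (y, b'))"
      by (simp only: sum.cartesian_product')
    also have "\<dots> = (\<Sum>x\<in>U. \<Sum>y\<in>U. (K x y + K (s x) (s y) - K x (s y) - K (s x) y) * c x * c y)"
      unfolding UNIV_bool
      by (simp add: sum.distrib[symmetric] p_def e_def) (intro sum.cong refl, simp add: algebra_simps)
    finally show ?thesis .
  qed
qed

text \<open>One use of l'Hospital's rule leaves the mean of two difference quotients of
  \<open>g'\<close> at 0.\<close>

lemma second_difference_limit:
  fixes g g' :: "real \<Rightarrow> real"
  assumes "\<And>t. (g has_real_derivative g' t) (at t)" "(g' has_real_derivative D) (at 0)"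
  shows "((\<lambda>h. (g h + g (-h) - 2 * g 0) / h\<^sup>2) \<longlongrightarrow> D) (at 0)"
proof (rule lhopital)
  have "isCont g t" for t using assms(1) DERIV_isCont by blast
  then have "continuous_on UNIV g" by (simp add: continuous_at_imp_continuous_on)
  then have "continuous_on UNIV (\<lambda>h. g h + g (-h) - 2 * g 0)"
    by (intro continuous_intros continuous_on_compose2[of UNIV g UNIV uminus]) auto
  then have "isCont (\<lambda>h. g h + g (-h) - 2 * g 0) 0"
    by (simp add: continuous_on_eq_continuous_at)
  then show "((\<lambda>h. g h + g (-h) - 2 * g 0) \<longlongrightarrow> 0) (at 0)"
    by (simp add: isCont_def)
  show "((\<lambda>h::real. h\<^sup>2) \<longlongrightarrow> 0) (at 0)" by (auto intro!: tendsto_eq_intros)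
  show "\<forall>\<^sub>F h::real in at 0. h\<^sup>2 \<noteq> 0" by (simp add: eventually_at_filter)
  show "\<forall>\<^sub>F h::real in at 0. 2 * h \<noteq> 0" by (simp add: eventually_at_filter)
  show "\<forall>\<^sub>F h in at 0. ((\<lambda>h. g h + g (-h) - 2 * g 0) has_real_derivative (g' h - g' (-h))) (at h)"
    by (intro always_eventually allI) (auto intro!: derivative_eq_intros DERIV_chain2[OF assms(1)] assms(1))
  show "\<forall>\<^sub>F h in at 0. ((\<lambda>h::real. h\<^sup>2) has_real_derivative 2 * h) (at h)"
    by (intro always_eventually allI) (auto intro!: derivative_eq_intros)
  have "((\<lambda>h. g' (-h)) has_real_derivative D * (-1)) (at 0)"
    by (rule DERIV_chain2[of g']) (auto intro!: derivative_eq_intros assms(2))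
  from DERIV_diff[OF assms(2) this]
  have "((\<lambda>h. (g' h - g' (-h)) / h) \<longlongrightarrow> 2 * D) (at 0)"
    by (simp add: has_field_derivative_iff)
  then have "((\<lambda>h. ((g' h - g' (-h)) / h) / 2) \<longlongrightarrow> 2 * D / 2) (at 0)"
    by (intro tendsto_intros) auto
  then show "((\<lambda>h. (g' h - g' (-h)) / (2 * h)) \<longlongrightarrow> D) (at 0)"
    by (simp add: field_simps)
qed

section \<open>Power series in the squared norm and the Laplacian\<close>

abbreviation powser :: "(nat \<Rightarrow> real) \<Rightarrow> real \<Rightarrow> real" where
  "powser a q \<equiv> (\<Sum>j. a j * q ^ j)"

definition entire :: "(nat \<Rightarrow> real) \<Rightarrow> bool" where
  "entire a \<longleftrightarrow> (\<forall>q. summable (\<lambda>j. a j * q ^ j))"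

lemma entire_diffs: "entire a \<Longrightarrow> entire (diffs a)"
  unfolding entire_def using termdiff_converges_all[of a] by blast

lemma powser_deriv:
  "entire a \<Longrightarrow> (powser a has_real_derivative powser (diffs a) q) (at q)"
  unfolding entire_def by (rule termdiffs_strong_converges_everywhere) blast

text \<open>On functions of the squared norm in \<open>n\<close> variables, \<open>neg_lap n\<close> is the action of the negative
  Laplacian on the coefficients of a power series.\<close>

definition neg_lap :: "nat \<Rightarrow> (nat \<Rightarrow> real) \<Rightarrow> nat \<Rightarrow> real" where
  "neg_lap n a j = - (4 * real j + 2 * real n) * diffs a j"

text \<open>The Laplacian of \<phi>(|x|^2) is 2 n \<phi>'(q) + 4 q \<phi>''(q) at q = |x|^2, and q
  \<phi>'' has the coefficients \<open>real j * diffs a j\<close>.\<close>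

lemma neg_lap_sums:
  assumes "entire a"
  shows "(\<lambda>j. neg_lap n a j * q ^ j) sums
    (- (2 * real n * powser (diffs a) q + 4 * q * powser (diffs (diffs a)) q))"
proof -
  have "summable (\<lambda>j. diffs (diffs a) j * q ^ j)" "summable (\<lambda>j. diffs a j * q ^ j)"
    using entire_diffs[OF assms] entire_diffs[OF entire_diffs[OF assms]] by (auto simp: entire_def)
  then have "(\<lambda>j. real j * diffs a j * q ^ (j - Suc 0)) sums powser (diffs (diffs a)) q"
    "(\<lambda>j. diffs a j * q ^ j) sums powser (diffs a) q"
    using diffs_equiv[of "diffs a" q] by (auto intro: summable_sums)
  then have "(\<lambda>j. - (2 * real n * (diffs a j * q ^ j) + 4 * q * (real j * diffs a j * q ^ (j - Suc 0))))
      sums (- (2 * real n * powser (diffs a) q + 4 * q * powser (diffs (diffs a)) q))"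
    by (intro sums_minus sums_add sums_mult)
  \<comment> \<open>At \<open>j = 0\<close> the truncated exponent is harmless, since it comes with
    the factor \<open>real j\<close>.\<close>
  moreover have "- (2 * real n * (diffs a j * q ^ j) + 4 * q * (real j * diffs a j * q ^ (j - Suc 0)))
      = neg_lap n a j * q ^ j" for j
    by (cases j) (simp_all add: neg_lap_def algebra_simps)
  ultimately show ?thesis by simp
qed

lemma entire_neg_lap: "entire a \<Longrightarrow> entire (neg_lap n a)"
  unfolding entire_def[of "neg_lap n a"] using neg_lap_sums sums_summable by blast

lemma sqdist_shift:
  assumes "i < n"
  shows "sqdist n (x(i := x i + h)) (y(i := y i + h)) = sqdist n x y"
    "sqdist n x (y(i := y i + h)) = sqdist n x y + 2 * (- h) * (x i - y i) + h\<^sup>2"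
    "sqdist n (x(i := x i + h)) y = sqdist n x y + 2 * h * (x i - y i) + h\<^sup>2"
proof -
  have *: "sqdist n u v = (u i - v i)\<^sup>2 + (\<Sum>j\<in>{..<n} - {i}. (u j - v j)\<^sup>2)" for u v
    unfolding sqdist_def using assms by (subst sum.remove[of _ i]) auto
  have **: "(\<Sum>j\<in>{..<n} - {i}. ((u(i := a)) j - (v(i := b)) j)\<^sup>2) = (\<Sum>j\<in>{..<n} - {i}. (u j - v j)\<^sup>2)"
    for u v :: "nat \<Rightarrow> real" and a b
    by (intro sum.cong refl) auto
  show "sqdist n (x(i := x i + h)) (y(i := y i + h)) = sqdist n x y"
    unfolding * ** by simp
  show "sqdist n x (y(i := y i + h)) = sqdist n x y + 2 * (- h) * (x i - y i) + h\<^sup>2"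
    unfolding * using **[of x "x i" y] by (simp add: power2_eq_square algebra_simps)
  show "sqdist n (x(i := x i + h)) y = sqdist n x y + 2 * h * (x i - y i) + h\<^sup>2"
    unfolding * using **[of x _ y "y i"] by (simp add: power2_eq_square algebra_simps)
qed

text \<open>For the shift by h along axis i the shift difference is 2 g(0) - g(h) - g(-h), where
  g(t) = \<phi>(q + 2 t d + t^2) and d is the i-th coordinate of x - y. Divided by h^2 it tends to
  minus the second derivative; the sum over i is the negative Laplacian.\<close>

lemma psd_kernel_neg_lap:
  assumes "entire a" "psd_kernel UNIV (\<lambda>x y. powser a (sqdist n x y))"
  shows "psd_kernel UNIV (\<lambda>x y. powser (neg_lap n a) (sqdist n x y))"
proof -
  define \<phi> where "\<phi> = powser a"
  define \<phi>1 where "\<phi>1 = powser (diffs a)"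
  define \<phi>2 where "\<phi>2 = powser (diffs (diffs a))"
  have d1: "(\<phi> has_real_derivative \<phi>1 q) (at q)" for q
    unfolding \<phi>_def \<phi>1_def by (rule powser_deriv[OF assms(1)])
  have d2: "(\<phi>1 has_real_derivative \<phi>2 q) (at q)" for q
    unfolding \<phi>2_def \<phi>1_def by (rule powser_deriv[OF entire_diffs[OF assms(1)]])
  have psd: "psd_kernel UNIV (\<lambda>x y. \<phi> (sqdist n x y))" using assms(2) by (simp add: \<phi>_def)
  have coord: "psd_kernel UNIV (\<lambda>x y. - (2 * \<phi>1 (sqdist n x y) + 4 * (x i - y i)\<^sup>2 * \<phi>2 (sqdist n x y)))"
    if i: "i < n" for i
  proof (rule psd_kernel_limit)
    define h where "h m = inverse (real (Suc m))" for m
    define s where "s m x = x(i := x i + h m)" for m :: nat and x :: "nat \<Rightarrow> real"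
    let ?K = "\<lambda>x y. \<phi> (sqdist n x y)"
    show "psd_kernel UNIV (\<lambda>x y. (1 / (h m)\<^sup>2) * (?K x y + ?K (s m x) (s m y) - ?K x (s m y) - ?K (s m x) y))" for m
      by (rule psd_kernel_cmult[OF psd_kernel_shift_difference[OF psd]]) simp
    fix x y :: "nat \<Rightarrow> real"
    define d where "d = x i - y i"
    define q where "q = sqdist n x y"
    define g where "g t = \<phi> (q + 2 * t * d + t\<^sup>2)" for t
    define g' where "g' t = \<phi>1 (q + 2 * t * d + t\<^sup>2) * (2 * d + 2 * t)" for t
    have "(g has_real_derivative g' t) (at t)" for t
      unfolding g_def g'_def by (rule DERIV_chain2[OF d1]) (auto intro!: derivative_eq_intros)
    moreover have "((\<lambda>t. \<phi>1 (q + 2 * t * d + t\<^sup>2)) has_real_derivative \<phi>2 q * (2 * d)) (at 0)"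
    proof -
      have "((\<lambda>t. q + 2 * t * d + t\<^sup>2) has_real_derivative 2 * d) (at 0)"
        by (auto intro!: derivative_eq_intros)
      from DERIV_chain2[OF d2 this] show ?thesis by simp
    qed
    then have "(g' has_real_derivative (2 * \<phi>1 q + 4 * d\<^sup>2 * \<phi>2 q)) (at 0)"
      unfolding g'_def by (auto intro!: derivative_eq_intros simp: power2_eq_square algebra_simps)
    ultimately have lim: "((\<lambda>h. (g h + g (-h) - 2 * g 0) / h\<^sup>2) \<longlongrightarrow> 2 * \<phi>1 q + 4 * d\<^sup>2 * \<phi>2 q) (at 0)"
      by (rule second_difference_limit)
    have "h \<longlonglongrightarrow> 0" unfolding h_def by (rule LIMSEQ_inverse_real_of_nat)
    then have "filterlim h (at 0) sequentially"
      by (intro filterlim_atI) (auto simp: h_def)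
    from tendsto_minus[OF filterlim_compose[OF lim this]]
    have "(\<lambda>m. - ((g (h m) + g (- h m) - 2 * g 0) / (h m)\<^sup>2)) \<longlonglongrightarrow> - (2 * \<phi>1 q + 4 * d\<^sup>2 * \<phi>2 q)" .
    moreover have "- ((g (h m) + g (- h m) - 2 * g 0) / (h m)\<^sup>2)
        = (1 / (h m)\<^sup>2) * (?K x y + ?K (s m x) (s m y) - ?K x (s m y) - ?K (s m x) y)" for m
    proof -
      have e: "sqdist n (s m x) (s m y) = q" "sqdist n x (s m y) = q + 2 * (- h m) * d + (h m)\<^sup>2"
        "sqdist n (s m x) y = q + 2 * h m * d + (h m)\<^sup>2"
        unfolding s_def q_def d_def by (rule sqdist_shift[OF i])+
      show ?thesis unfolding e g_def q_def[symmetric] by (simp add: diff_divide_distrib add_divide_distrib)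
    qed
    ultimately show "(\<lambda>m. (1 / (h m)\<^sup>2) * (?K x y + ?K (s m x) (s m y) - ?K x (s m y) - ?K (s m x) y))
        \<longlonglongrightarrow> - (2 * \<phi>1 (sqdist n x y) + 4 * (x i - y i)\<^sup>2 * \<phi>2 (sqdist n x y))"
      by (simp add: q_def d_def)
  qed
  have "psd_kernel UNIV (\<lambda>x y. \<Sum>i<n. - (2 * \<phi>1 (sqdist n x y) + 4 * (x i - y i)\<^sup>2 * \<phi>2 (sqdist n x y)))"
    by (rule psd_kernel_sum, rule coord) simp
  then show ?thesis
  proof (rule psd_kernel_cong)
    fix x y :: "nat \<Rightarrow> real"
    have "(\<Sum>i<n. 4 * (x i - y i)\<^sup>2 * \<phi>2 (sqdist n x y)) = 4 * sqdist n x y * \<phi>2 (sqdist n x y)"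
      by (simp add: sqdist_def sum_distrib_left sum_distrib_right)
    then have "(\<Sum>i<n. - (2 * \<phi>1 (sqdist n x y) + 4 * (x i - y i)\<^sup>2 * \<phi>2 (sqdist n x y)))
      = - (2 * real n * \<phi>1 (sqdist n x y) + 4 * sqdist n x y * \<phi>2 (sqdist n x y))"
      by (simp add: sum_negf sum.distrib sum_subtractf)
    also have "\<dots> = powser (neg_lap n a) (sqdist n x y)"
      unfolding \<phi>1_def \<phi>2_def by (rule sums_unique[OF neg_lap_sums[OF assms(1)]])
    finally show "(\<Sum>i<n. - (2 * \<phi>1 (sqdist n x y) + 4 * (x i - y i)\<^sup>2 * \<phi>2 (sqdist n x y)))
      = powser (neg_lap n a) (sqdist n x y)" .
  qed
qed

text \<open>Up to a constant, these are the coefficients of the \<open>N\<close>-th iterate of the negative Laplacian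
  applied to a Gaussian, i.e. of the Fourier transform of an even power of the norm times a
  Gaussian. With the parameter \<open>1 / (4 * N)\<close> that density concentrates on the unit sphere.\<close>

definition shell_coeff :: "nat \<Rightarrow> real \<Rightarrow> nat \<Rightarrow> nat \<Rightarrow> real" where
  "shell_coeff n s N j = (- s) ^ j / fact j * pochhammer (real N + real n / 2) j / pochhammer (real n / 2) j"

text \<open>The coefficients of \<Omega> as a series in the square of its argument, with the Gamma
  values of the Bessel series combined into a Pochhammer symbol.\<close>

definition Omega_coeff :: "nat \<Rightarrow> nat \<Rightarrow> real" where
  "Omega_coeff n j = (- 1 / 4) ^ j / (fact j * pochhammer (real n / 2) j)"

lemma pochhammer_half_pos: "0 < n \<Longrightarrow> 0 < pochhammer (real n / 2) j"
  by (simp add: pochhammer_pos)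

lemma shell_coeff_0: "0 < n \<Longrightarrow> shell_coeff n s 0 j = (- s) ^ j / fact j"
  using pochhammer_half_pos[of n j] by (simp add: shell_coeff_def)

text \<open>The factor that each Laplacian produces is divided out in \<open>shell_coeff\<close>, so
  that the value at the origin stays 1. It is positive for positive \<open>s\<close>, hence harmless
  for positive type.\<close>

lemma shell_coeff_Suc:
  assumes "0 < n"
  shows "neg_lap n (shell_coeff n s N) j = (4 * s * (real N + real n / 2)) * shell_coeff n s (Suc N) j"
proof -
  have 1: "pochhammer (real N + real n / 2) (Suc j) = (real N + real n / 2) * pochhammer (real (Suc N) + real n / 2) j"
    by (subst pochhammer_rec) (simp add: algebra_simps)
  have 2: "pochhammer (real n / 2) (Suc j) = pochhammer (real n / 2) j * (real n / 2 + real j)"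
    by (rule pochhammer_Suc)
  have 3: "- (4 * real j + 2 * real n) = - (4 * (real n / 2 + real j))" by simp
  have w: "real n / 2 + real j \<noteq> 0" using assms by (simp add: add_nonneg_eq_0_iff)
  have gen: "- (4 * w) * (j1 * (- s * p / (j1 * F) * (c * A) / (B * w))) = (4 * s * c) * (p / F * A / B)"
    if "j1 \<noteq> 0" "F \<noteq> 0" "B \<noteq> 0" "w \<noteq> 0" for w j1 p F c A B :: real
    using that by simp
  show ?thesis
    unfolding neg_lap_def diffs_def shell_coeff_def fact_Suc power_Suc 1 2 3
    by (rule gen) (use w pochhammer_half_pos[OF assms, of j] in auto)
qed

lemma entire_shell_coeff:
  assumes "0 < n" "s \<noteq> 0"
  shows "entire (shell_coeff n s N)"
proof (induction N)
  case 0
  show ?case unfolding entire_def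
  proof
    fix q
    have "summable (\<lambda>j. inverse (fact j) * (- s * q) ^ j)" by (rule summable_exp)
    then show "summable (\<lambda>j. shell_coeff n s 0 j * q ^ j)"
      by (simp only: shell_coeff_0[OF assms(1)] power_mult_distrib) (simp add: field_simps)
  qed
next
  case (Suc N)
  have C: "4 * s * (real N + real n / 2) \<noteq> 0" using assms by (simp add: add_nonneg_eq_0_iff)
  show ?case unfolding entire_def
  proof
    fix q
    have "summable (\<lambda>j. neg_lap n (shell_coeff n s N) j * q ^ j)"
      using entire_neg_lap[OF Suc, of n] unfolding entire_def by blast
    then have "summable (\<lambda>j. (4 * s * (real N + real n / 2)) * (shell_coeff n s (Suc N) j * q ^ j))"
      by (simp only: shell_coeff_Suc[OF assms(1)] mult.assoc)
    from summable_mult_D[OF this C] show "summable (\<lambda>j. shell_coeff n s (Suc N) j * q ^ j)" .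
  qed
qed

lemma psd_kernel_shell:
  assumes "0 < n" "0 < s"
  shows "psd_kernel UNIV (\<lambda>x y. powser (shell_coeff n s N) (sqdist n x y))"
proof (induction N)
  case 0
  have "powser (shell_coeff n s 0) q = exp (- s * q)" for q
  proof -
    have "(\<lambda>j. inverse (fact j) * (- s * q) ^ j) sums exp (- s * q)" using exp_converges[of "- s * q"] by (simp only: real_scaleR_def)
    then have "(\<lambda>j. shell_coeff n s 0 j * q ^ j) sums exp (- s * q)"
      by (simp only: shell_coeff_0[OF assms(1)] power_mult_distrib) (simp add: field_simps)
    then show ?thesis by (rule sums_unique[symmetric])
  qed
  then show ?case using psd_kernel_gaussian[of s n] assms(2) by simp
next
  case (Suc N)
  have s: "s \<noteq> 0" using assms(2) by simp
  define C where "C = 4 * s * (real N + real n / 2)"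
  have C: "0 < C" unfolding C_def using assms by (simp add: add_nonneg_pos)
  have "psd_kernel UNIV (\<lambda>x y. (1 / C) * powser (neg_lap n (shell_coeff n s N)) (sqdist n x y))"
    by (intro psd_kernel_cmult psd_kernel_neg_lap entire_shell_coeff[OF assms(1) s] Suc) (use C in simp)
  then show ?case
  proof (rule psd_kernel_cong)
    fix x y :: "nat \<Rightarrow> real"
    have "powser (neg_lap n (shell_coeff n s N)) q = C * powser (shell_coeff n s (Suc N)) q" for q
    proof -
      have "powser (neg_lap n (shell_coeff n s N)) q = (\<Sum>j. C * (shell_coeff n s (Suc N) j * q ^ j))"
        by (simp only: shell_coeff_Suc[OF assms(1)] C_def mult.assoc)
      also have "\<dots> = C * powser (shell_coeff n s (Suc N)) q"
        using entire_shell_coeff[OF assms(1) s, of "Suc N"] by (intro suminf_mult) (simp add: entire_def)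
      finally show ?thesis .
    qed
    then show "(1 / C) * powser (neg_lap n (shell_coeff n s N)) (sqdist n x y)
      = powser (shell_coeff n s (Suc N)) (sqdist n x y)"
      using C by simp
  qed
qed

text \<open>\<Omega> as an entire function of the squared argument. At negative arguments it is a
  normalized modified Bessel function, which the shell weight below needs.\<close>

definition Omega_sq :: "nat \<Rightarrow> real \<Rightarrow> real" where
  "Omega_sq n q = powser (Omega_coeff n) q"

text \<open>Each coefficient converges, since the Pochhammer symbol of N + n / 2 of length j grows
  like N^j. Tannery's theorem passes this on to the sums.\<close>

lemma shell_to_Omega:
  assumes n: "0 < n"
  shows "(\<lambda>N. powser (shell_coeff n (1 / (4 * real (Suc N))) (Suc N)) q) \<longlonglongrightarrow> Omega_sq n q"
    and "summable (\<lambda>j. norm (Omega_coeff n j * q ^ j))"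
proof -
  \<comment> \<open>The ratio of a coefficient to its limit: a product of factors that decrease to 1
    in \<open>N\<close>, hence largest at \<open>N = 0\<close>.\<close>
  define r where "r N j = pochhammer (real (Suc N) + real n / 2) j / real (Suc N) ^ j" for N j
  have r_prod: "r N j = (\<Prod>i<j. 1 + (real n / 2 + real i) * inverse (real (Suc N)))" for N j
  proof -
    have "r N j = (\<Prod>i<j. (real (Suc N) + real n / 2 + real i) / real (Suc N))"
      by (simp add: r_def pochhammer_prod prod_dividef atLeast0LessThan del: of_nat_Suc)
    also have "\<dots> = (\<Prod>i<j. 1 + (real n / 2 + real i) * inverse (real (Suc N)))"
      by (intro prod.cong refl) (simp add: field_simps)
    finally show ?thesis .
  qed
  have term_eq: "shell_coeff n (1 / (4 * real (Suc N))) (Suc N) j * q ^ j = (Omega_coeff n j * q ^ j) * r N j" for N j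
  proof -
    have "(- (1 / (4 * real (Suc N)))) ^ j = (- 1 / 4) ^ j / real (Suc N) ^ j"
      unfolding power_divide[symmetric] by simp
    then show ?thesis unfolding shell_coeff_def Omega_coeff_def r_def by (simp add: mult_ac del: of_nat_Suc)
  qed
  have "r N j \<ge> 0" for N j unfolding r_prod by (intro prod_nonneg) auto
  moreover have "r N j \<le> pochhammer (1 + real n / 2) j" for N j
  proof -
    have "inverse (real (Suc N)) \<le> 1" by (simp add: field_simps)
    then have "1 + (real n / 2 + real i) * inverse (real (Suc N)) \<le> 1 + real n / 2 + real i" for i
      using mult_left_mono[of "inverse (real (Suc N))" 1 "real n / 2 + real i"] by simp
    then show ?thesis unfolding r_prod pochhammer_prod atLeast0LessThan by (intro prod_mono) auto
  qed
  ultimately have r_bound: "\<bar>r N j\<bar> \<le> pochhammer (1 + real n / 2) j" for N j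
    by simp
  \<comment> \<open>The terms for \<open>N = 0\<close> in absolute value; the negative parameter
    removes the signs.\<close>
  define M where "M j = shell_coeff n (- 1 / 4) 1 j * \<bar>q\<bar> ^ j" for j
  have bound: "norm (shell_coeff n (1 / (4 * real (Suc N))) (Suc N) j * q ^ j) \<le> M j" for N j
  proof -
    have "norm (shell_coeff n (1 / (4 * real (Suc N))) (Suc N) j * q ^ j) = (\<bar>Omega_coeff n j\<bar> * \<bar>q\<bar> ^ j) * \<bar>r N j\<bar>"
      unfolding term_eq by (simp add: abs_mult power_abs)
    also have "\<dots> \<le> (\<bar>Omega_coeff n j\<bar> * \<bar>q\<bar> ^ j) * pochhammer (1 + real n / 2) j"
      by (intro mult_left_mono r_bound) simp
    also have "\<dots> = M j"
      using pochhammer_half_pos[OF n, of j]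
      by (simp add: M_def shell_coeff_def Omega_coeff_def power_abs abs_mult power_divide mult_ac)
    finally show ?thesis .
  qed
  have "entire (shell_coeff n (- 1 / 4) 1)" by (rule entire_shell_coeff[OF n]) simp
  then have "summable M" unfolding M_def entire_def by blast
  moreover have "(\<lambda>N. shell_coeff n (1 / (4 * real (Suc N))) (Suc N) j * q ^ j) \<longlonglongrightarrow> Omega_coeff n j * q ^ j" for j
  proof -
    have "(\<lambda>N. r N j) \<longlonglongrightarrow> (\<Prod>i<j. 1 + (real n / 2 + real i) * 0)"
      unfolding r_prod by (intro tendsto_intros LIMSEQ_inverse_real_of_nat)
    then have "(\<lambda>N. (Omega_coeff n j * q ^ j) * r N j) \<longlonglongrightarrow> (Omega_coeff n j * q ^ j) * 1"
      by (intro tendsto_intros) simp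
    then show ?thesis by (simp only: term_eq mult_1_right)
  qed
  ultimately have "summable (\<lambda>j. norm (Omega_coeff n j * q ^ j)) \<and>
    (\<lambda>N. powser (shell_coeff n (1 / (4 * real (Suc N))) (Suc N)) q) \<longlonglongrightarrow> powser (Omega_coeff n) q"
    using tannerys_theorem[of "\<lambda>j N. shell_coeff n (1 / (4 * real (Suc N))) (Suc N) j * q ^ j"
      "\<lambda>j. Omega_coeff n j * q ^ j" sequentially M] bound
    by (auto simp: always_eventually)
  then show "summable (\<lambda>j. norm (Omega_coeff n j * q ^ j))"
    "(\<lambda>N. powser (shell_coeff n (1 / (4 * real (Suc N))) (Suc N)) q) \<longlonglongrightarrow> Omega_sq n q"
    by (auto simp: Omega_sq_def)
qed

lemma psd_kernel_Omega_sq: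
  assumes "0 < n"
  shows "psd_kernel UNIV (\<lambda>x y. Omega_sq n (sqdist n x y))"
  by (rule psd_kernel_limit[OF psd_kernel_shell shell_to_Omega(1)]) (use assms in auto)

lemma psd_kernel_Omega_sq_scaled:
  assumes "0 < n" "0 \<le> t"
  shows "psd_kernel UNIV (\<lambda>x y. Omega_sq n (t * sqdist n x y))"
proof -
  have "sqdist n (\<lambda>i. sqrt t * x i) (\<lambda>i. sqrt t * y i) = t * sqdist n x y" for x y
    using assms(2) unfolding sqdist_def sum_distrib_left
    by (intro sum.cong refl) (simp add: power_mult_distrib flip: right_diff_distrib)
  then show ?thesis
    using psd_kernel_pullback[OF psd_kernel_Omega_sq[OF assms(1)], of "\<lambda>x i. sqrt t * x i" UNIV] by simp
qed

lemma entire_Omega_coeff: "0 < n \<Longrightarrow> entire (Omega_coeff n)"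
  using summable_norm_cancel[OF shell_to_Omega(2)] by (auto simp: entire_def)

lemma Omega_sq_0: "Omega_sq n 0 = 1"
  unfolding Omega_sq_def using powser_zero[of "Omega_coeff n"] by (simp add: Omega_coeff_def)

text \<open>A kernel of positive type with diagonal 1 is bounded by 1, and every nonnegative number
  is a squared distance.\<close>

lemma Omega_sq_bound:
  assumes "0 < n" "0 \<le> q"
  shows "\<bar>Omega_sq n q\<bar> \<le> 1"
proof -
  have "sqdist n (\<lambda>i. if i = 0 then sqrt q else 0) (\<lambda>_. 0) = q"
    using assms unfolding sqdist_def
    by (subst sum.remove[of _ 0]) (auto intro!: sum.neutral)
  moreover have "\<bar>Omega_sq n (sqdist n x y)\<bar> \<le> 1" for x y
    by (rule psd_kernel_bound[OF psd_kernel_Omega_sq[OF assms(1)]]) (auto simp: Omega_sq_0 sqdist_def)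
  ultimately show ?thesis by metis
qed

section \<open>Decay and minimum of \<open>\<Omega>\<close>\<close>

text \<open>\<Omega>(|x|) is an eigenfunction of the Laplacian, like the plane waves of unit
  frequency. This supplies the differential equation for the decay estimate.\<close>

lemma neg_lap_Omega_coeff:
  assumes "0 < n"
  shows "neg_lap n (Omega_coeff n) = Omega_coeff n"
proof
  fix j
  have 1: "pochhammer (real n / 2) (Suc j) = pochhammer (real n / 2) j * (real n / 2 + real j)"
    by (rule pochhammer_Suc)
  have 2: "- (4 * real j + 2 * real n) = - (4 * (real n / 2 + real j))" by simp
  have w: "real n / 2 + real j \<noteq> 0" using assms by (simp add: add_nonneg_eq_0_iff)
  have gen: "- (4 * w) * (j1 * (- 1 / 4 * p / (j1 * F * (B * w)))) = p / (F * B)"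
    if "j1 \<noteq> 0" "F \<noteq> 0" "B \<noteq> 0" "w \<noteq> 0" for w j1 p F B :: real
    using that by simp
  show "neg_lap n (Omega_coeff n) j = Omega_coeff n j"
    unfolding neg_lap_def diffs_def Omega_coeff_def fact_Suc power_Suc 1 2
    by (rule gen) (use w pochhammer_half_pos[OF assms, of j] in auto)
qed

lemma isCont_Omega_sq: "0 < n \<Longrightarrow> isCont (Omega_sq n) q"
  using DERIV_isCont[OF powser_deriv[OF entire_Omega_coeff]] by (simp add: Omega_sq_def[abs_def])

lemma continuous_on_Omega_sq: "0 < n \<Longrightarrow> continuous_on A (Omega_sq n)"
  by (simp add: continuous_at_imp_continuous_on isCont_Omega_sq)

text \<open>The function of the norm solves the radial Helmholtz equation; the quantity \<open>E\<close> below is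
  an energy for it that is nonincreasing and, for large \<open>u\<close>, comparable to \<open>u\<close> times the sum of
  the squares of the solution and its derivative.\<close>

lemma Omega_sq_decay:
  assumes n: "2 \<le> n"
  shows "((\<lambda>u. Omega_sq n (u\<^sup>2)) \<longlongrightarrow> 0) at_top"
proof -
  have n0: "0 < n" using n by simp
  define \<phi>1 where "\<phi>1 = powser (diffs (Omega_coeff n))"
  define \<phi>2 where "\<phi>2 = powser (diffs (diffs (Omega_coeff n)))"
  have ent: "entire (Omega_coeff n)" using entire_Omega_coeff[OF n0] .
  have d1: "(Omega_sq n has_real_derivative \<phi>1 q) (at q)" for q
    unfolding Omega_sq_def[abs_def] \<phi>1_def by (rule powser_deriv[OF ent])
  have d2: "(\<phi>1 has_real_derivative \<phi>2 q) (at q)" for q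
    unfolding \<phi>2_def \<phi>1_def by (rule powser_deriv[OF entire_diffs[OF ent]])
  have ode: "4 * q * \<phi>2 q = - Omega_sq n q - 2 * real n * \<phi>1 q" for q
    using sums_unique[OF neg_lap_sums[OF ent, of n q]]
    unfolding neg_lap_Omega_coeff[OF n0] Omega_sq_def[symmetric] by (simp add: \<phi>1_def \<phi>2_def)
  define W where "W u = Omega_sq n (u\<^sup>2)" for u
  define W' where "W' u = 2 * u * \<phi>1 (u\<^sup>2)" for u
  have dW: "(W has_real_derivative W' u) (at u)" for u
  proof -
    have "((\<lambda>u. u\<^sup>2) has_real_derivative 2 * u) (at u)" by (auto intro!: derivative_eq_intros)
    from DERIV_chain2[OF d1 this] show ?thesis by (simp add: W_def[abs_def] W'_def mult_ac)
  qed
  have dW': "(W' has_real_derivative (- W u - (real n - 1) / u * W' u)) (at u)" if "u > 0" for u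
  proof -
    have "(W' has_real_derivative (2 * \<phi>1 (u\<^sup>2) + 2 * u * (\<phi>2 (u\<^sup>2) * (2 * u)))) (at u)"
    proof -
      have "((\<lambda>u. u\<^sup>2) has_real_derivative 2 * u) (at u)" "((\<lambda>u. 2 * u) has_real_derivative 2) (at u)"
        by (auto intro!: derivative_eq_intros)
      from DERIV_mult[OF this(2) DERIV_chain2[OF d2 this(1)]] show ?thesis
        by (simp add: W'_def[abs_def] algebra_simps)
    qed
    moreover have "2 * \<phi>1 (u\<^sup>2) + 2 * u * (\<phi>2 (u\<^sup>2) * (2 * u)) = - W u - (real n - 1) / u * W' u"
    proof -
      have "(real n - 1) / u * W' u = 2 * (real n - 1) * \<phi>1 (u\<^sup>2)" using that by (simp add: W'_def)
      then show ?thesis using ode[of "u\<^sup>2"] by (simp add: W_def power2_eq_square algebra_simps)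
    qed
    ultimately show ?thesis by simp
  qed
  \<comment> \<open>In the derivative, \<open>W u * W' u\<close> cancels the square of
    \<open>W\<close> coming from the first term, and the last summand cancels the mixed term of
    order 1 / u. The squares that remain have nonpositive coefficients for
    \<open>2 \<le> n\<close>.\<close>
  define E where "E u = u * ((W u)\<^sup>2 + (W' u)\<^sup>2) + W u * W' u + (real n - 1) / 2 * ((W u)\<^sup>2 / u)" for u
  have dE: "(E has_real_derivative (- (2 * real n - 4) * (W' u)\<^sup>2 - (real n - 1) / 2 * (W u)\<^sup>2 / u\<^sup>2)) (at u)"
    if u: "u > 0" for u
  proof -
    define c where "c = real n - 1"
    define S where "S = W u"
    define S' where "S' = W' u"
    define S'' where "S'' = - S - c / u * S'"
    have D1: "(E has_real_derivative
        ((S\<^sup>2 + S'\<^sup>2) + u * (2 * S * S' + 2 * S' * S'') + (S' * S' + S * S'')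
          + c / 2 * ((2 * S * S' * u - S\<^sup>2) / u\<^sup>2))) (at u)"
      unfolding E_def[abs_def] S_def S'_def S''_def c_def
      using u dW[of u] dW'[OF u]
      by (auto intro!: derivative_eq_intros simp: power2_eq_square algebra_simps) (simp add: field_simps)
    have D2: "(S\<^sup>2 + S'\<^sup>2) + u * (2 * S * S' + 2 * S' * S'') + (S' * S' + S * S'')
          + c / 2 * ((2 * S * S' * u - S\<^sup>2) / u\<^sup>2) = - (2 * c - 2) * S'\<^sup>2 - c / 2 * S\<^sup>2 / u\<^sup>2"
      unfolding S''_def using u by (simp add: field_simps power2_eq_square)
    have "2 * c - 2 = 2 * real n - 4" by (simp add: c_def)
    then show ?thesis using D1 unfolding D2 by (simp only: c_def S_def S'_def)
  qed
  have E_mono: "E u \<le> E 1" if "1 \<le> u" for u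
  proof (rule DERIV_nonpos_imp_nonincreasing[OF that])
    fix x :: real assume "1 \<le> x"
    then have "- (2 * real n - 4) * (W' x)\<^sup>2 - (real n - 1) / 2 * (W x)\<^sup>2 / x\<^sup>2 \<le> 0"
    proof -
      have "0 \<le> (2 * real n - 4) * (W' x)\<^sup>2" using n by (intro mult_nonneg_nonneg) auto
      moreover have "0 \<le> (real n - 1) / 2 * (W x)\<^sup>2 / x\<^sup>2"
        using n by (intro divide_nonneg_nonneg mult_nonneg_nonneg) auto
      moreover have "- (2 * real n - 4) * (W' x)\<^sup>2 = - ((2 * real n - 4) * (W' x)\<^sup>2)" by (rule mult_minus_left)
      ultimately show ?thesis by linarith
    qed
    then show "\<exists>y. (E has_real_derivative y) (at x) \<and> y \<le> 0"
      using dE[of x] \<open>1 \<le> x\<close> by (intro exI conjI) auto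
  qed
  \<comment> \<open>The mixed term costs at most half of each square; what is lost of the square of
    \<open>W'\<close> is covered by the factor \<open>u \<ge> 1\<close>, and half of the square of
    \<open>W\<close> gives the shift by 1 / 2.\<close>
  have bound: "\<bar>W u\<bar> \<le> sqrt (E 1 / (u - 1 / 2))" if "1 \<le> u" for u
  proof -
    have "0 \<le> (real n - 1) / 2 * ((W u)\<^sup>2 / u)" using n that by simp
    moreover have "(W' u)\<^sup>2 \<le> u * (W' u)\<^sup>2" using mult_right_mono[OF that, of "(W' u)\<^sup>2"] by simp
    moreover have "0 \<le> (W u + W' u)\<^sup>2" by simp
    moreover have "0 \<le> (W' u)\<^sup>2" by simp
    ultimately have "(u - 1 / 2) * (W u)\<^sup>2 \<le> E u"
    proof -
      assume a: "0 \<le> (real n - 1) / 2 * ((W u)\<^sup>2 / u)" "(W' u)\<^sup>2 \<le> u * (W' u)\<^sup>2"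
        "0 \<le> (W u + W' u)\<^sup>2" "0 \<le> (W' u)\<^sup>2"
      have "(u - 1 / 2) * (W u)\<^sup>2 = u * (W u)\<^sup>2 - (W u)\<^sup>2 / 2" by (simp add: algebra_simps)
      moreover have "(W u + W' u)\<^sup>2 = (W u)\<^sup>2 + (W' u)\<^sup>2 + 2 * (W u * W' u)" by (simp add: power2_sum)
      moreover have "u * ((W u)\<^sup>2 + (W' u)\<^sup>2) = u * (W u)\<^sup>2 + u * (W' u)\<^sup>2" by (rule distrib_left)
      ultimately show ?thesis using a unfolding E_def by linarith
    qed
    then have "(W u)\<^sup>2 \<le> E 1 / (u - 1 / 2)"
      using E_mono[OF that] that by (simp add: field_simps)
    then show ?thesis by (intro real_le_rsqrt) simp
  qed
  have "filterlim (\<lambda>u::real. u - 1 / 2) at_infinity at_top"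
    using filterlim_tendsto_add_at_top[OF tendsto_const[of "-1/2"] filterlim_ident]
    by (intro filterlim_at_top_imp_at_infinity) (simp add: add.commute)
  then have "((\<lambda>u. sqrt (E 1 / (u - 1 / 2))) \<longlongrightarrow> sqrt 0) at_top"
    by (intro tendsto_real_sqrt tendsto_divide_0[OF tendsto_const])
  then have "((\<lambda>u. sqrt (E 1 / (u - 1 / 2))) \<longlongrightarrow> 0) at_top" by simp
  then have "(W \<longlongrightarrow> 0) at_top"
    by (rule Lim_null_comparison[rotated]) (use bound in \<open>auto simp: eventually_at_top_linorder\<close>)
  then show ?thesis by (simp add: W_def[abs_def])
qed

text \<open>Gamma at j + n / 2 is a Pochhammer symbol times Gamma at n / 2; the latter and the power
  of u / 2 cancel the normalizing factor of \<open>Omega\<close>.\<close>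

lemma Omega_eq_Omega_sq:
  assumes n: "0 < n" and u: "0 \<le> u"
  shows "Omega n u = Omega_sq n (u\<^sup>2)"
proof (cases "u = 0")
  case True
  then show ?thesis by (simp add: Omega_def Omega_sq_0)
next
  case False
  with u have u: "u > 0" by simp
  define \<alpha> where "\<alpha> = (real n - 2) / 2"
  have \<alpha>: "\<alpha> + 1 = real n / 2" by (simp add: \<alpha>_def field_simps)
  have G: "Gamma (real n / 2) > 0" using n by (intro Gamma_real_pos) simp
  have "(-1) ^ j / (fact j * Gamma (real j + \<alpha> + 1)) * (u / 2) powr (2 * real j + \<alpha>)
      = ((u / 2) powr \<alpha> / Gamma (real n / 2)) * (Omega_coeff n j * (u\<^sup>2) ^ j)" for j
  proof -
    have "real n / 2 \<notin> \<int>\<^sub>\<le>\<^sub>0" using n by (auto elim!: nonpos_Ints_cases)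
    from pochhammer_Gamma[OF this, of j]
    have 1: "Gamma (real j + \<alpha> + 1) = pochhammer (real n / 2) j * Gamma (real n / 2)"
    proof -
      have eq: "real j + \<alpha> + 1 = real n / 2 + real j" using \<alpha> by simp
      show ?thesis unfolding eq using \<open>pochhammer _ _ = _\<close> G by simp
    qed
    have "(u / 2) powr (2 * real j + \<alpha>) = (u / 2) powr real (2 * j) * (u / 2) powr \<alpha>"
      by (simp add: powr_add)
    also have "(u / 2) powr real (2 * j) = (u / 2) ^ (2 * j)"
      using u by (intro powr_realpow) simp
    also have "\<dots> = (1 / 4) ^ j * (u\<^sup>2) ^ j"
      by (simp add: power_mult power_divide)
    finally have 2: "(u / 2) powr (2 * real j + \<alpha>) = (1 / 4) ^ j * (u\<^sup>2) ^ j * (u / 2) powr \<alpha>" .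
    have 3: "(- 1 / 4) ^ j = (-1 :: real) ^ j * (1 / 4) ^ j"
      unfolding power_mult_distrib[symmetric] by simp
    show ?thesis unfolding 1 2 Omega_coeff_def 3 by (simp add: mult_ac)
  qed
  then have "Bessel_J \<alpha> u = (\<Sum>j. ((u / 2) powr \<alpha> / Gamma (real n / 2)) * (Omega_coeff n j * (u\<^sup>2) ^ j))"
    unfolding Bessel_J_def by presburger
  also have "\<dots> = ((u / 2) powr \<alpha> / Gamma (real n / 2)) * Omega_sq n (u\<^sup>2)"
    unfolding Omega_sq_def using entire_Omega_coeff[OF n] by (intro suminf_mult) (simp add: entire_def)
  finally have "Omega n u = Gamma (real n / 2) * (2 / u) powr \<alpha> * ((u / 2) powr \<alpha> / Gamma (real n / 2) * Omega_sq n (u\<^sup>2))"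
    using u by (simp add: Omega_def \<alpha>_def)
  also have "\<dots> = ((2 / u) powr \<alpha> * (u / 2) powr \<alpha>) * Omega_sq n (u\<^sup>2)"
    using G by simp
  also have "(2 / u) powr \<alpha> * (u / 2) powr \<alpha> = 1"
    using u by (simp flip: powr_mult)
  finally show ?thesis by simp
qed

text \<open>Once one negative value is known, the decay confines the search to a compact interval.
  Attainment is what gives the \<open>LEAST\<close> in \<open>Omega_min\<close> its meaning.\<close>

lemma Omega_min_attained:
  assumes n: "2 \<le> n" and neg: "0 \<le> q\<^sub>1" "Omega_sq n q\<^sub>1 < 0"
  obtains q\<^sub>0 where "0 \<le> q\<^sub>0" "Omega_sq n q\<^sub>0 = Omega_min n" "Omega_min n < 0"
    "\<And>q. 0 \<le> q \<Longrightarrow> Omega_min n \<le> Omega_sq n q"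
proof -
  have n0: "0 < n" using n by simp
  have "\<forall>\<^sub>F u in at_top. Omega_sq n (u\<^sup>2) > Omega_sq n q\<^sub>1"
    using Omega_sq_decay[OF n] neg(2) by (rule order_tendstoD)
  then obtain B where B: "\<And>u. B \<le> u \<Longrightarrow> Omega_sq n (u\<^sup>2) > Omega_sq n q\<^sub>1"
    by (auto simp: eventually_at_top_linorder)
  define R where "R = max q\<^sub>1 (B\<^sup>2)"
  have "\<exists>q\<in>{0..R}. \<forall>y\<in>{0..R}. Omega_sq n q \<le> Omega_sq n y"
    using neg(1) by (intro continuous_attains_inf continuous_on_Omega_sq n0) (auto simp: R_def)
  then obtain q\<^sub>0 where q\<^sub>0: "0 \<le> q\<^sub>0" "\<And>y. 0 \<le> y \<Longrightarrow> y \<le> R \<Longrightarrow> Omega_sq n q\<^sub>0 \<le> Omega_sq n y"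
    by auto
  have le1: "Omega_sq n q\<^sub>0 \<le> Omega_sq n q\<^sub>1" using q\<^sub>0(2)[OF neg(1)] by (simp add: R_def)
  have min: "Omega_sq n q\<^sub>0 \<le> Omega_sq n q" if "0 \<le> q" for q
  proof (cases "q \<le> R")
    case False
    then have "B\<^sup>2 \<le> q" by (simp add: R_def)
    then have "B \<le> sqrt q" by (rule real_le_rsqrt)
    from B[OF this] have "Omega_sq n q\<^sub>1 < Omega_sq n q" using that by simp
    with le1 show ?thesis by simp
  qed (use q\<^sub>0(2) that in blast)
  have "Omega_min n = Omega_sq n q\<^sub>0"
    unfolding Omega_min_def
  proof (rule Least_equality)
    have "Omega_sq n q\<^sub>0 = Omega n (sqrt q\<^sub>0)"
      using Omega_eq_Omega_sq[OF n0, of "sqrt q\<^sub>0"] q\<^sub>0(1) by simp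
    then show "Omega_sq n q\<^sub>0 \<in> Omega n ` {0..}" using q\<^sub>0(1) by simp
    show "Omega_sq n q\<^sub>0 \<le> v" if "v \<in> Omega n ` {0..}" for v
      using that min Omega_eq_Omega_sq[OF n0] by auto
  qed
  then show thesis using that[of q\<^sub>0] q\<^sub>0(1) min le1 neg(2) by auto
qed

section \<open>Gaussian integrals\<close>

interpretation lborel_prod: product_sigma_finite "\<lambda>_::nat. lborel :: real measure"
  by standard

lemma pochhammer_half_nonneg: "0 \<le> pochhammer (real n / 2) j"
  by (simp add: pochhammer_prod prod_nonneg)

definition nsq :: "nat \<Rightarrow> (nat \<Rightarrow> real) \<Rightarrow> real" where
  "nsq n x = (\<Sum>i<n. (x i)\<^sup>2)"

lemma nsq_nonneg [simp]: "0 \<le> nsq n x"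
  by (simp add: nsq_def sum_nonneg)

lemma space_Rn_lebesgue [simp]: "space (Rn_lebesgue n) = Rn n"
  by (simp add: Rn_lebesgue_def Rn_def space_PiM)

lemma measurable_Rn_component: "i < n \<Longrightarrow> (\<lambda>x. x i) \<in> borel_measurable (Rn_lebesgue n)"
  unfolding Rn_lebesgue_def using measurable_component_singleton[of i "{..<n}" "\<lambda>_. lborel"] by simp

lemma measurable_nsq [measurable]: "nsq n \<in> borel_measurable (Rn_lebesgue n)"
  unfolding nsq_def[abs_def] by (intro borel_measurable_sum borel_measurable_power measurable_Rn_component) simp

lemma emeasure_Rn_box:
  assumes "\<And>i. i < n \<Longrightarrow> A i \<in> sets borel"
  shows "emeasure (Rn_lebesgue n) (\<Pi>\<^sub>E i\<in>{..<n}. A i) = (\<Prod>i<n. emeasure lborel (A i))"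
  unfolding Rn_lebesgue_def using assms by (intro lborel_prod.emeasure_PiM) auto

lemma sets_Rn_box:
  assumes "\<And>i. i < n \<Longrightarrow> A i \<in> sets borel"
  shows "(\<Pi>\<^sub>E i\<in>{..<n}. A i) \<in> sets (Rn_lebesgue n)"
  unfolding Rn_lebesgue_def using assms by (intro sets_PiM_I_finite) auto

lemma sets_cube [measurable]: "cube n T \<in> sets (Rn_lebesgue n)"
  unfolding cube_def by (rule sets_Rn_box) simp

lemma emeasure_cube:
  assumes "0 \<le> T"
  shows "emeasure (Rn_lebesgue n) (cube n T) = ennreal ((2 * T) ^ n)"
proof -
  have "emeasure (Rn_lebesgue n) (cube n T) = (\<Prod>i<n. emeasure lborel {-T..T})"
    unfolding cube_def by (rule emeasure_Rn_box) simp
  also have "\<dots> = ennreal ((2 * T) ^ n)"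
    using assms by (simp add: ennreal_power)
  finally show ?thesis .
qed

lemma measure_cube: "0 \<le> T \<Longrightarrow> measure (Rn_lebesgue n) (cube n T) = (2 * T) ^ n"
  by (simp add: measure_def emeasure_cube)

text \<open>Translations for \<open>c = 1\<close> and point reflections for \<open>c = -1\<close>;
  with \<open>c = 0\<close> it restricts an arbitrary function to an element of
  \<open>Rn n\<close>.\<close>

definition vaff :: "nat \<Rightarrow> (nat \<Rightarrow> real) \<Rightarrow> real \<Rightarrow> (nat \<Rightarrow> real) \<Rightarrow> nat \<Rightarrow> real" where
  "vaff n t c x = (\<lambda>i\<in>{..<n}. t i + c * x i)"

lemma vaff_in_Rn [simp]: "vaff n t c x \<in> Rn n"
  by (simp add: vaff_def Rn_def)

lemma measurable_vaff [measurable]: "vaff n t c \<in> Rn_lebesgue n \<rightarrow>\<^sub>M Rn_lebesgue n"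
  unfolding vaff_def[abs_def] Rn_lebesgue_def
proof (rule measurable_restrict)
  fix i assume "i \<in> {..<n}"
  then have "(\<lambda>x. x i) \<in> borel_measurable (\<Pi>\<^sub>M i\<in>{..<n}. lborel)"
    using measurable_component_singleton[of i "{..<n}" "\<lambda>_. lborel :: real measure"] by simp
  then show "(\<lambda>x. t i + c * x i) \<in> (\<Pi>\<^sub>M i\<in>{..<n}. lborel) \<rightarrow>\<^sub>M lborel"
    by (simp only: measurable_lborel1 measurable_lborel2) (intro borel_measurable_add borel_measurable_const borel_measurable_times)
qed

lemma emeasure_lborel_affine_vimage:
  fixes t c :: real
  assumes "\<bar>c\<bar> = 1" "A \<in> sets borel"
  shows "emeasure lborel {u. t + c * u \<in> A} = emeasure lborel A"
proof -
  have "c \<noteq> 0" using assms by auto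
  then have "lborel = density (distr lborel borel (\<lambda>u. t + c * u)) (\<lambda>_. 1)"
    using lborel_real_affine[of c t] assms(1) by simp
  then have "lborel = distr lborel borel (\<lambda>u. t + c * u)"
    by (simp only: density_1)
  then have "emeasure lborel A = emeasure (distr lborel borel (\<lambda>u. t + c * u)) A" by simp
  also have "\<dots> = emeasure lborel ((\<lambda>u. t + c * u) -` A \<inter> space lborel)"
    using assms(2) by (intro emeasure_distr) auto
  finally show ?thesis by (simp add: vimage_def)
qed

lemma distr_vaff:
  assumes "\<bar>c\<bar> = 1"
  shows "distr (Rn_lebesgue n) (Rn_lebesgue n) (vaff n t c) = Rn_lebesgue n"
proof -
  have "distr (Rn_lebesgue n) (Rn_lebesgue n) (vaff n t c) = PiM {..<n} (\<lambda>_. lborel)"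
  proof (rule lborel_prod.PiM_eqI)
    fix A assume "\<And>i. i \<in> {..<n} \<Longrightarrow> A i \<in> sets (lborel :: real measure)"
    then have A: "A i \<in> sets borel" if "i < n" for i using that by simp
    have meas: "(\<lambda>u. t i + c * u) \<in> borel_measurable borel" for i by simp
    have A': "{u. t i + c * u \<in> A i} \<in> sets borel" if "i < n" for i
      using measurable_sets[OF meas A[OF that]] by (simp add: vimage_def)
    have "emeasure (distr (Rn_lebesgue n) (Rn_lebesgue n) (vaff n t c)) (\<Pi>\<^sub>E i\<in>{..<n}. A i)
        = emeasure (Rn_lebesgue n) (vaff n t c -` (\<Pi>\<^sub>E i\<in>{..<n}. A i) \<inter> space (Rn_lebesgue n))"
      by (intro emeasure_distr measurable_vaff sets_Rn_box A)
    also have "vaff n t c -` (\<Pi>\<^sub>E i\<in>{..<n}. A i) \<inter> space (Rn_lebesgue n) = (\<Pi>\<^sub>E i\<in>{..<n}. {u. t i + c * u \<in> A i})"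
      by (auto simp: vaff_def Rn_def PiE_def Pi_def)
    also have "emeasure (Rn_lebesgue n) \<dots> = (\<Prod>i<n. emeasure lborel {u. t i + c * u \<in> A i})"
      by (intro emeasure_Rn_box A')
    also have "\<dots> = (\<Prod>i<n. emeasure lborel (A i))"
      using A by (intro prod.cong refl emeasure_lborel_affine_vimage assms) simp
    finally show "emeasure (distr (Rn_lebesgue n) (Rn_lebesgue n) (vaff n t c)) (\<Pi>\<^sub>E i\<in>{..<n}. A i)
        = (\<Prod>i<n. emeasure lborel (A i))" .
  qed (simp_all add: Rn_lebesgue_def)
  then show ?thesis by (simp add: Rn_lebesgue_def)
qed

lemma integral_vaff:
  fixes f :: "(nat \<Rightarrow> real) \<Rightarrow> real"
  assumes "\<bar>c\<bar> = 1" "f \<in> borel_measurable (Rn_lebesgue n)"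
  shows "(\<integral>x. f (vaff n t c x) \<partial>Rn_lebesgue n) = (\<integral>x. f x \<partial>Rn_lebesgue n)"
    and "integrable (Rn_lebesgue n) (\<lambda>x. f (vaff n t c x)) \<longleftrightarrow> integrable (Rn_lebesgue n) f"
  using integral_distr[OF measurable_vaff assms(2), of t c] integrable_distr_eq[OF measurable_vaff assms(2), of t c]
  unfolding distr_vaff[OF assms(1)] by simp_all

lemma gaussian_moment_real_line:
  fixes s :: real
  assumes "0 < s"
  shows "(\<integral>\<^sup>+ y. ennreal ((y\<^sup>2) ^ k * exp (- s * y\<^sup>2)) \<partial>lborel)
    = ennreal (sqrt (pi / s) * (pochhammer (1 / 2) k / s ^ k))"
proof -
  \<comment> \<open>The standard deviation whose normal density is proportional to
    \<open>exp (- s * x\<^sup>2)\<close>.\<close>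
  define \<sigma> where "\<sigma> = sqrt (1 / (2 * s))"
  have \<sigma>: "\<sigma> > 0" "\<sigma>\<^sup>2 = 1 / (2 * s)" using assms by (simp_all add: \<sigma>_def)
  have "normal_density 0 \<sigma> x * (x - 0) ^ (2 * k) = (1 / sqrt (pi / s)) * ((x\<^sup>2) ^ k * exp (- s * x\<^sup>2))" for x
  proof -
    have p: "x ^ (2 * k) = (x\<^sup>2) ^ k" by (rule power_mult)
    have "2 * pi * (1 / (2 * s)) = pi / s" "- (x\<^sup>2) / (2 * (1 / (2 * s))) = - s * x\<^sup>2"
      using assms by simp_all
    then show ?thesis unfolding normal_density_def \<sigma>(2) diff_0_right p by (simp only: mult_ac)
  qed
  moreover have "fact (2 * k) / ((2 / \<sigma>\<^sup>2) ^ k * fact k) = pochhammer (1 / 2) k / s ^ k"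
    unfolding fact_double \<sigma>(2) using assms by (simp add: power_mult power_mult_distrib)
  ultimately have "has_bochner_integral lborel (\<lambda>x. (1 / sqrt (pi / s)) * ((x\<^sup>2) ^ k * exp (- s * x\<^sup>2)))
      (pochhammer (1 / 2) k / s ^ k)"
    using normal_moment_even[OF \<sigma>(1), of 0 k] by simp
  then have "has_bochner_integral lborel (\<lambda>x. sqrt (pi / s) * ((1 / sqrt (pi / s)) * ((x\<^sup>2) ^ k * exp (- s * x\<^sup>2))))
      (sqrt (pi / s) * (pochhammer (1 / 2) k / s ^ k))"
    by (intro has_bochner_integral_mult_right) auto
  then have "has_bochner_integral lborel (\<lambda>x. (x\<^sup>2) ^ k * exp (- s * x\<^sup>2))
      (sqrt (pi / s) * (pochhammer (1 / 2) k / s ^ k))"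
    using assms by simp
  then show ?thesis
    by (subst nn_integral_eq_integral) (auto simp: has_bochner_integral_iff)
qed

text \<open>Induction on the dimension, for all orders at once. Splitting off the last coordinate
  and expanding by the binomial theorem yields products of lower moments; the binomial identity for
  Pochhammer symbols at n / 2 and 1 / 2 puts them together again.\<close>

lemma nn_gaussian_moment:
  assumes s: "0 < s"
  shows "(\<integral>\<^sup>+ x. ennreal (nsq n x ^ j * exp (- s * nsq n x)) \<partial>Rn_lebesgue n)
    = ennreal (sqrt (pi / s) ^ n * (pochhammer (real n / 2) j / s ^ j))"
proof (induction n arbitrary: j)
  case 0
  show ?case
    by (cases j) (simp_all add: Rn_lebesgue_def PiM_empty nn_integral_count_space_finite nsq_def pochhammer_0_left)
next
  case (Suc n)
  define S where "S = sqrt (pi / s)"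
  have S: "0 \<le> S" using s by (simp add: S_def)
  define m where "m k = S * (pochhammer (1 / 2) k / s ^ k)" for k
  have m: "0 \<le> m k" for k using S s pochhammer_half_nonneg[of 1 k] by (simp add: m_def)
  define c where "c i = sqrt (pi / s) ^ n * (pochhammer (real n / 2) i / s ^ i)" for i
  have c: "0 \<le> c i" for i using s by (simp add: c_def pochhammer_half_nonneg)
  have expand: "nsq (Suc n) (x(n := y)) ^ j * exp (- s * nsq (Suc n) (x(n := y)))
      = (\<Sum>i\<le>j. (real (j choose i) * (nsq n x ^ i * exp (- s * nsq n x))) * ((y\<^sup>2) ^ (j - i) * exp (- s * y\<^sup>2)))"
    for x y
  proof -
    have "nsq (Suc n) (x(n := y)) = nsq n x + y\<^sup>2"
      by (simp add: nsq_def)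
    then have "nsq (Suc n) (x(n := y)) ^ j * exp (- s * nsq (Suc n) (x(n := y)))
        = (nsq n x + y\<^sup>2) ^ j * (exp (- s * nsq n x) * exp (- s * y\<^sup>2))"
      by (simp only: distrib_left exp_add)
    also have "\<dots> = (\<Sum>i\<le>j. (real (j choose i) * (nsq n x ^ i * exp (- s * nsq n x))) * ((y\<^sup>2) ^ (j - i) * exp (- s * y\<^sup>2)))"
      unfolding binomial_ring sum_distrib_right by (intro sum.cong refl) (simp only: mult_ac)
    finally show ?thesis .
  qed
  have inner: "(\<integral>\<^sup>+ y. ennreal (nsq (Suc n) (x(n := y)) ^ j * exp (- s * nsq (Suc n) (x(n := y)))) \<partial>lborel)
      = (\<Sum>i\<le>j. ennreal (real (j choose i) * m (j - i)) * ennreal (nsq n x ^ i * exp (- s * nsq n x)))" for x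
  proof -
    have "(\<integral>\<^sup>+ y. ennreal (nsq (Suc n) (x(n := y)) ^ j * exp (- s * nsq (Suc n) (x(n := y)))) \<partial>lborel)
      = (\<integral>\<^sup>+ y. (\<Sum>i\<le>j. ennreal (real (j choose i) * (nsq n x ^ i * exp (- s * nsq n x)))
          * ennreal ((y\<^sup>2) ^ (j - i) * exp (- s * y\<^sup>2))) \<partial>lborel)"
      unfolding expand by (subst sum_ennreal[symmetric]) (auto simp: ennreal_mult intro!: nn_integral_cong sum.cong)
    also have "\<dots> = (\<Sum>i\<le>j. ennreal (real (j choose i) * (nsq n x ^ i * exp (- s * nsq n x))) * ennreal (m (j - i)))"
    proof (subst nn_integral_sum)
      show "(\<Sum>i\<le>j. \<integral>\<^sup>+ y. ennreal (real (j choose i) * (nsq n x ^ i * exp (- s * nsq n x)))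
          * ennreal ((y\<^sup>2) ^ (j - i) * exp (- s * y\<^sup>2)) \<partial>lborel)
        = (\<Sum>i\<le>j. ennreal (real (j choose i) * (nsq n x ^ i * exp (- s * nsq n x))) * ennreal (m (j - i)))"
        unfolding m_def S_def gaussian_moment_real_line[OF s, symmetric]
        by (intro sum.cong refl nn_integral_cmult) simp
    qed measurable
    also have "\<dots> = (\<Sum>i\<le>j. ennreal (real (j choose i) * m (j - i)) * ennreal (nsq n x ^ i * exp (- s * nsq n x)))"
      using m by (intro sum.cong refl) (simp add: ennreal_mult[symmetric] mult_ac)
    finally show ?thesis .
  qed
  have [measurable]: "nsq (Suc n) \<in> borel_measurable (\<Pi>\<^sub>M i\<in>insert n {..<n}. lborel)"
    using measurable_nsq[of "Suc n"] by (simp add: Rn_lebesgue_def lessThan_Suc)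
  have "(\<integral>\<^sup>+ x. ennreal (nsq (Suc n) x ^ j * exp (- s * nsq (Suc n) x)) \<partial>Rn_lebesgue (Suc n))
      = (\<integral>\<^sup>+ x. \<integral>\<^sup>+ y. ennreal (nsq (Suc n) (x(n := y)) ^ j * exp (- s * nsq (Suc n) (x(n := y)))) \<partial>lborel \<partial>Rn_lebesgue n)"
    unfolding Rn_lebesgue_def lessThan_Suc by (intro lborel_prod.product_nn_integral_insert) auto
  also have "\<dots> = (\<Sum>i\<le>j. ennreal (real (j choose i) * m (j - i)) * ennreal (c i))"
    unfolding inner
  proof (subst nn_integral_sum)
    show "(\<Sum>i\<le>j. \<integral>\<^sup>+ x. ennreal (real (j choose i) * m (j - i))
        * ennreal (nsq n x ^ i * exp (- s * nsq n x)) \<partial>Rn_lebesgue n)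
      = (\<Sum>i\<le>j. ennreal (real (j choose i) * m (j - i)) * ennreal (c i))"
      unfolding c_def Suc.IH[symmetric] by (intro sum.cong refl nn_integral_cmult) simp
  qed measurable
  also have "\<dots> = ennreal (\<Sum>i\<le>j. (real (j choose i) * m (j - i)) * c i)"
    using m c by (subst sum_ennreal[symmetric]) (auto simp: ennreal_mult)
  also have "(\<Sum>i\<le>j. (real (j choose i) * m (j - i)) * c i)
      = S ^ Suc n * ((\<Sum>i\<le>j. real (j choose i) * pochhammer (real n / 2) i * pochhammer (1 / 2) (j - i)) / s ^ j)"
    unfolding sum_divide_distrib sum_distrib_left
  proof (intro sum.cong refl)
    fix i assume "i \<in> {..j}"
    then have "s ^ j = s ^ i * s ^ (j - i)" by (simp flip: power_add)
    then show "(real (j choose i) * m (j - i)) * c i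
      = S ^ Suc n * (real (j choose i) * pochhammer (real n / 2) i * pochhammer (1 / 2) (j - i) / s ^ j)"
      by (simp add: m_def c_def S_def mult_ac)
  qed
  also have "(\<Sum>i\<le>j. real (j choose i) * pochhammer (real n / 2) i * pochhammer (1 / 2) (j - i))
      = pochhammer (real (Suc n) / 2) j"
    by (simp add: pochhammer_binomial_sum[symmetric] add_divide_distrib add.commute)
  finally show ?case by (simp add: S_def)
qed

definition gauss_const :: "nat \<Rightarrow> real \<Rightarrow> real" where
  "gauss_const n s = sqrt (pi / s) ^ n"

lemma gauss_const_pos: "0 < s \<Longrightarrow> 0 < gauss_const n s"
  by (simp add: gauss_const_def)

lemma gaussian_moment:
  assumes s: "0 < s"
  shows "integrable (Rn_lebesgue n) (\<lambda>x. nsq n x ^ j * exp (- s * nsq n x))"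
    and "(\<integral>x. nsq n x ^ j * exp (- s * nsq n x) \<partial>Rn_lebesgue n) = gauss_const n s * (pochhammer (real n / 2) j / s ^ j)"
proof -
  have 0: "0 \<le> gauss_const n s * (pochhammer (real n / 2) j / s ^ j)"
    using s by (simp add: gauss_const_def pochhammer_half_nonneg)
  have "integrable (Rn_lebesgue n) (\<lambda>x. nsq n x ^ j * exp (- s * nsq n x)) \<and>
    (\<integral>x. nsq n x ^ j * exp (- s * nsq n x) \<partial>Rn_lebesgue n) = gauss_const n s * (pochhammer (real n / 2) j / s ^ j)"
    using nn_gaussian_moment[OF s, of n j]
    by (subst nn_integral_eq_integrable[symmetric]) (use 0 in \<open>auto simp: gauss_const_def\<close>)
  then show "integrable (Rn_lebesgue n) (\<lambda>x. nsq n x ^ j * exp (- s * nsq n x))"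
    "(\<integral>x. nsq n x ^ j * exp (- s * nsq n x) \<partial>Rn_lebesgue n) = gauss_const n s * (pochhammer (real n / 2) j / s ^ j)"
    by auto
qed

text \<open>Termwise integration, justified by absolute summability against the moments. The power
  \<open>i\<close> serves the moments of \<Omega>, the bounded factor \<open>g\<close> the second
  \<Omega> in Weber's integral.\<close>

lemma gaussian_series:
  fixes b :: "nat \<Rightarrow> real"
  assumes s: "0 < s"
    and g: "g \<in> borel_measurable (Rn_lebesgue n)" "\<And>x. \<bar>g x\<bar> \<le> 1"
    and b: "\<And>q. 0 \<le> q \<Longrightarrow> summable (\<lambda>j. \<bar>b j\<bar> * q ^ j)"
    and sum: "summable (\<lambda>j. \<bar>b j\<bar> * (pochhammer (real n / 2) (j + i) / s ^ (j + i)))"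
  shows "integrable (Rn_lebesgue n) (\<lambda>x. g x * nsq n x ^ i * exp (- s * nsq n x) * powser b (nsq n x))"
    and "(\<lambda>j. b j * (\<integral>x. g x * (nsq n x ^ (j + i) * exp (- s * nsq n x)) \<partial>Rn_lebesgue n)) sums
      (\<integral>x. g x * nsq n x ^ i * exp (- s * nsq n x) * powser b (nsq n x) \<partial>Rn_lebesgue n)"
proof -
  note [measurable] = g(1)
  define w where "w j x = nsq n x ^ (j + i) * exp (- s * nsq n x)" for j x
  have w: "0 \<le> w j x" for j x by (simp add: w_def)
  have wint: "integrable (Rn_lebesgue n) (w j)" for j
    unfolding w_def by (rule gaussian_moment[OF s])
  define f where "f j x = b j * (g x * w j x)" for j x
  have gw: "integrable (Rn_lebesgue n) (\<lambda>x. g x * w j x)" for j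
  proof (rule Bochner_Integration.integrable_bound[OF wint[of j]])
    show "(\<lambda>x. g x * w j x) \<in> borel_measurable (Rn_lebesgue n)" unfolding w_def by measurable
    show "AE x in Rn_lebesgue n. norm (g x * w j x) \<le> norm (w j x)"
      using g(2) w by (auto simp: abs_mult mult_left_le_one_le intro!: always_eventually)
  qed
  then have fint: "integrable (Rn_lebesgue n) (f j)" for j unfolding f_def by simp
  have fbound: "norm (f j x) \<le> \<bar>b j\<bar> * w j x" for j x
    using g(2)[of x] w[of j x] by (simp add: f_def abs_mult mult_left_mono mult_left_le_one_le)
  have series: "(\<lambda>j. f j x) sums (g x * nsq n x ^ i * exp (- s * nsq n x) * powser b (nsq n x))" for x
  proof -
    have "summable (\<lambda>j. b j * nsq n x ^ j)"
      using b[of "nsq n x"] by (intro summable_norm_cancel[of "\<lambda>j. b j * nsq n x ^ j"]) (simp add: abs_mult)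
    then have "(\<lambda>j. (g x * nsq n x ^ i * exp (- s * nsq n x)) * (b j * nsq n x ^ j)) sums
        ((g x * nsq n x ^ i * exp (- s * nsq n x)) * powser b (nsq n x))"
      by (intro sums_mult summable_sums)
    then show ?thesis by (simp add: f_def w_def power_add mult_ac)
  qed
  have norm_sum: "AE x in Rn_lebesgue n. summable (\<lambda>j. norm (f j x))"
  proof (intro always_eventually allI)
    fix x
    have "summable (\<lambda>j. (nsq n x ^ i * exp (- s * nsq n x)) * (\<bar>b j\<bar> * nsq n x ^ j))"
      by (intro summable_mult b) simp
    then have "summable (\<lambda>j. \<bar>b j\<bar> * w j x)" by (simp add: w_def power_add mult_ac)
    then show "summable (\<lambda>j. norm (f j x))"
      by (rule summable_comparison_test'[of _ 0]) (use fbound in auto)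
  qed
  have int_sum: "summable (\<lambda>j. \<integral>x. norm (f j x) \<partial>Rn_lebesgue n)"
  proof (rule summable_comparison_test'[of _ 0])
    show "summable (\<lambda>j. gauss_const n s * (\<bar>b j\<bar> * (pochhammer (real n / 2) (j + i) / s ^ (j + i))))"
      by (intro summable_mult sum)
    fix j
    have "(\<integral>x. norm (f j x) \<partial>Rn_lebesgue n) \<le> (\<integral>x. \<bar>b j\<bar> * w j x \<partial>Rn_lebesgue n)"
      using fint wint fbound by (intro integral_mono) auto
    also have "\<dots> = gauss_const n s * (\<bar>b j\<bar> * (pochhammer (real n / 2) (j + i) / s ^ (j + i)))"
      using gaussian_moment(2)[OF s, of n "j + i"] by (simp add: w_def)
    finally show "norm (\<integral>x. norm (f j x) \<partial>Rn_lebesgue n)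
        \<le> gauss_const n s * (\<bar>b j\<bar> * (pochhammer (real n / 2) (j + i) / s ^ (j + i)))"
      by (simp add: integral_nonneg_AE)
  qed
  have eq: "(\<lambda>x. \<Sum>j. f j x) = (\<lambda>x. g x * nsq n x ^ i * exp (- s * nsq n x) * powser b (nsq n x))"
    using sums_unique[OF series] by auto
  show "integrable (Rn_lebesgue n) (\<lambda>x. g x * nsq n x ^ i * exp (- s * nsq n x) * powser b (nsq n x))"
    using integrable_suminf[OF fint norm_sum int_sum] unfolding eq .
  show "(\<lambda>j. b j * (\<integral>x. g x * (nsq n x ^ (j + i) * exp (- s * nsq n x)) \<partial>Rn_lebesgue n)) sums
      (\<integral>x. g x * nsq n x ^ i * exp (- s * nsq n x) * powser b (nsq n x) \<partial>Rn_lebesgue n)"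
    using sums_integral[OF fint norm_sum int_sum] unfolding eq
    by (simp add: f_def w_def)
qed

section \<open>Weber's integral\<close>

text \<open>Vandermonde's convolution for generalized binomial coefficients with upper entries j and
  \<nu> + k - 1, multiplied by k!.\<close>

lemma pochhammer_vandermonde:
  fixes \<nu> :: real
  shows "pochhammer (\<nu> + real j) k = (\<Sum>l\<le>k. real (k choose l) * real (j choose l) * fact l * pochhammer (\<nu> + real l) (k - l))"
proof -
  have "(\<Sum>l\<in>{0..k}. (real j gchoose l) * ((\<nu> + real k - 1) gchoose (k - l))) = (real j + (\<nu> + real k - 1)) gchoose k"
    by (rule gbinomial_Vandermonde)
  also have "\<dots> = pochhammer (\<nu> + real j) k / fact k"
    by (simp add: gbinomial_pochhammer' algebra_simps)
  finally have "pochhammer (\<nu> + real j) k = (\<Sum>l\<in>{0..k}. fact k * ((real j gchoose l) * ((\<nu> + real k - 1) gchoose (k - l))))"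
    by (simp add: sum_distrib_left[symmetric])
  also have "\<dots> = (\<Sum>l\<le>k. real (k choose l) * real (j choose l) * fact l * pochhammer (\<nu> + real l) (k - l))"
    unfolding atLeast0AtMost
  proof (intro sum.cong refl)
    fix l assume "l \<in> {..k}"
    then have l: "l \<le> k" by simp
    have 1: "\<nu> + real k - 1 - real (k - l) + 1 = \<nu> + real l" using l by (simp add: of_nat_diff)
    have 2: "(fact k :: real) = real (k choose l) * (fact l * fact (k - l))"
      using binomial_fact[OF l, where 'a = real] by simp
    show "fact k * ((real j gchoose l) * ((\<nu> + real k - 1) gchoose (k - l)))
      = real (k choose l) * real (j choose l) * fact l * pochhammer (\<nu> + real l) (k - l)"
      unfolding gbinomial_pochhammer'[of "\<nu> + real k - 1"] 1 binomial_gbinomial[symmetric] 2 by simp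
  qed
  finally show ?thesis .
qed

text \<open>An expansion in falling factorials of \<open>k\<close>, over a range that does not
  depend on \<open>k\<close>. It reduces the series over \<open>k\<close> below to finitely many
  exponential series.\<close>

lemma pochhammer_ratio:
  fixes \<nu> :: real
  assumes "0 < \<nu>"
  shows "pochhammer (\<nu> + real j) k / pochhammer \<nu> k
    = (\<Sum>l\<le>j. real (j choose l) / pochhammer \<nu> l * (real (k choose l) * fact l))"
proof -
  define g where "g l = real (j choose l) / pochhammer \<nu> l * (real (k choose l) * fact l)" for l
  have "pochhammer (\<nu> + real j) k / pochhammer \<nu> k = (\<Sum>l\<le>k. g l)"
    unfolding pochhammer_vandermonde[of \<nu> j k] sum_divide_distrib
  proof (intro sum.cong refl)
    fix l assume "l \<in> {..k}"
    then have "pochhammer \<nu> k = pochhammer \<nu> l * pochhammer (\<nu> + real l) (k - l)"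
      by (intro pochhammer_product) simp
    moreover have "pochhammer (\<nu> + real l) (k - l) > 0" using assms by (intro pochhammer_pos) simp
    ultimately show "real (k choose l) * real (j choose l) * fact l * pochhammer (\<nu> + real l) (k - l) / pochhammer \<nu> k = g l"
      by (simp add: g_def)
  qed
  \<comment> \<open>Terms with l above \<open>j\<close> or above \<open>k\<close> vanish, so the
    range can be changed by way of the maximum.\<close>
  also have "\<dots> = (\<Sum>l\<le>max j k. g l)"
    by (rule sum.mono_neutral_left) (auto simp: g_def)
  also have "\<dots> = (\<Sum>l\<le>j. g l)"
    by (rule sum.mono_neutral_right) (auto simp: g_def)
  finally show ?thesis by (simp add: g_def)
qed

lemma exp_falling_sums:
  fixes t :: real
  shows "(\<lambda>k. t ^ k / fact k * (real (k choose l) * fact l)) sums (t ^ l * exp t)"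
proof -
  define h where "h k = t ^ k / fact k * (real (k choose l) * fact l)" for k
  have "h (i + l) = t ^ l * (inverse (fact i) * t ^ i)" for i
  proof -
    have "(fact (i + l) :: real) = real ((i + l) choose l) * (fact l * fact i)"
      using binomial_fact[of l "i + l", where 'a = real] by simp
    moreover have "real ((i + l) choose l) \<noteq> 0" by simp
    ultimately show ?thesis by (simp add: h_def power_add field_simps)
  qed
  moreover have "(\<lambda>i. t ^ l * (inverse (fact i) * t ^ i)) sums (t ^ l * exp t)"
    using exp_converges[of t] by (intro sums_mult) (simp only: real_scaleR_def)
  ultimately have "(\<lambda>i. h (i + l)) sums (t ^ l * exp t)" by simp
  moreover have "(\<Sum>i<l. h i) = 0" by (auto simp: h_def intro!: sum.neutral)
  ultimately have "h sums (t ^ l * exp t)" using sums_iff_shift[of h l "t ^ l * exp t"] by simp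
  then show ?thesis unfolding h_def .
qed

text \<open>The confluent hypergeometric polynomial 1F1(-j; n/2; -t), up to a factor a Laguerre
  polynomial at -t. \<open>kummer_sums\<close> is then Kummer's transformation 1F1(n/2 + j; n/2; t)
  = exp(t) 1F1(-j; n/2; -t).\<close>

definition kummer_poly :: "nat \<Rightarrow> nat \<Rightarrow> real \<Rightarrow> real" where
  "kummer_poly n j t = (\<Sum>l\<le>j. real (j choose l) / pochhammer (real n / 2) l * t ^ l)"

lemma kummer_sums:
  assumes "0 < n"
  shows "(\<lambda>k. t ^ k / fact k * (pochhammer (real n / 2 + real j) k / pochhammer (real n / 2) k))
    sums (exp t * kummer_poly n j t)"
proof -
  have "(\<lambda>k. \<Sum>l\<le>j. real (j choose l) / pochhammer (real n / 2) l * (t ^ k / fact k * (real (k choose l) * fact l)))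
      sums (\<Sum>l\<le>j. real (j choose l) / pochhammer (real n / 2) l * (t ^ l * exp t))"
    by (intro sums_sum sums_mult exp_falling_sums)
  moreover have "(\<Sum>l\<le>j. real (j choose l) / pochhammer (real n / 2) l * (t ^ k / fact k * (real (k choose l) * fact l)))
      = t ^ k / fact k * (pochhammer (real n / 2 + real j) k / pochhammer (real n / 2) k)" for k
  proof -
    have "0 < real n / 2" using assms by simp
    from pochhammer_ratio[OF this] show ?thesis by (simp add: sum_distrib_left mult_ac)
  qed
  moreover have "(\<Sum>l\<le>j. real (j choose l) / pochhammer (real n / 2) l * (t ^ l * exp t)) = exp t * kummer_poly n j t"
    by (simp add: kummer_poly_def sum_distrib_left mult_ac)
  ultimately show ?thesis by simp
qed

section \<open>Integrals of \<Omega> against Gaussians\<close>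

lemma summable_abs_Omega_coeff:
  assumes "0 < n"
  shows "summable (\<lambda>j. \<bar>Omega_coeff n j * q ^ j\<bar>)"
  using shell_to_Omega(2)[OF assms] by simp

lemma Omega_sq_scaled_powser: "Omega_sq n (c * q) = powser (\<lambda>j. Omega_coeff n j * c ^ j) q"
  by (simp add: Omega_sq_def power_mult_distrib mult.assoc)

text \<open>Integrating term by term produces the Kummer series in \<open>t\<close>. Negative
  \<open>t\<close> gives the oscillating \<Omega>, positive \<open>t\<close> the modified Bessel
  function, so both weights used later are covered.\<close>

lemma bessel_moment:
  assumes n: "0 < n" and s: "0 < s"
  shows "integrable (Rn_lebesgue n) (\<lambda>x. nsq n x ^ i * exp (- s * nsq n x) * Omega_sq n (- (4 * s * t) * nsq n x))"
    and "(\<integral>x. nsq n x ^ i * exp (- s * nsq n x) * Omega_sq n (- (4 * s * t) * nsq n x) \<partial>Rn_lebesgue n)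
      = gauss_const n s * (pochhammer (real n / 2) i / s ^ i) * (exp t * kummer_poly n i t)"
proof -
  define b where "b j = Omega_coeff n j * (- (4 * s * t)) ^ j" for j
  define D where "D = pochhammer (real n / 2) i / s ^ i"
  have b: "summable (\<lambda>j. \<bar>b j\<bar> * q ^ j)" if "0 \<le> q" for q
    using summable_abs_Omega_coeff[OF n, of "- (4 * s * t) * q"] that
    by (simp only: b_def power_mult_distrib abs_mult power_abs abs_of_nonneg mult.assoc)
  have term_eq: "b j * (pochhammer (real n / 2) (j + i) / s ^ (j + i))
      = D * (t ^ j / fact j * (pochhammer (real n / 2 + real i) j / pochhammer (real n / 2) j))" for j
  proof -
    have 1: "pochhammer (real n / 2) (j + i) = pochhammer (real n / 2) i * pochhammer (real n / 2 + real i) j"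
      using pochhammer_product'[of "real n / 2" i j] by (simp add: add.commute)
    have 2: "b j = (s * t) ^ j / (fact j * pochhammer (real n / 2) j)"
    proof -
      have "(- 1 / 4) ^ j * (- (4 * s * t)) ^ j = (s * t) ^ j"
        unfolding power_mult_distrib[symmetric] by simp
      then show ?thesis by (simp add: b_def Omega_coeff_def)
    qed
    show ?thesis unfolding 1 2 D_def using s by (simp add: power_mult_distrib power_add mult_ac)
  qed
  have abs_eq: "\<bar>b j\<bar> * (pochhammer (real n / 2) (j + i) / s ^ (j + i))
      = D * (\<bar>t\<bar> ^ j / fact j * (pochhammer (real n / 2 + real i) j / pochhammer (real n / 2) j))" for j
  proof -
    have "\<bar>b j\<bar> * (pochhammer (real n / 2) (j + i) / s ^ (j + i)) = \<bar>b j * (pochhammer (real n / 2) (j + i) / s ^ (j + i))\<bar>"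
      using s by (simp add: abs_mult pochhammer_half_nonneg)
    moreover have "0 \<le> D" using s by (simp add: D_def pochhammer_half_nonneg)
    moreover have "0 \<le> pochhammer (real n / 2 + real i) j" by (simp add: pochhammer_prod prod_nonneg)
    ultimately show ?thesis unfolding term_eq by (simp add: abs_mult power_abs pochhammer_half_nonneg)
  qed
  have sum: "summable (\<lambda>j. \<bar>b j\<bar> * (pochhammer (real n / 2) (j + i) / s ^ (j + i)))"
    unfolding abs_eq by (intro summable_mult sums_summable[OF kummer_sums[OF n]])
  note series = gaussian_series[OF s _ _ b sum, of "\<lambda>_. 1", simplified mult_1_left]
  show "integrable (Rn_lebesgue n) (\<lambda>x. nsq n x ^ i * exp (- s * nsq n x) * Omega_sq n (- (4 * s * t) * nsq n x))"
    unfolding Omega_sq_scaled_powser b_def[symmetric] by (rule series(1)) auto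
  have "(\<lambda>j. gauss_const n s * (D * (t ^ j / fact j * (pochhammer (real n / 2 + real i) j / pochhammer (real n / 2) j))))
      sums (\<integral>x. nsq n x ^ i * exp (- s * nsq n x) * Omega_sq n (- (4 * s * t) * nsq n x) \<partial>Rn_lebesgue n)"
  proof -
    have "(\<lambda>j. b j * (\<integral>x. nsq n x ^ (j + i) * exp (- s * nsq n x) \<partial>Rn_lebesgue n))
      sums (\<integral>x. nsq n x ^ i * exp (- s * nsq n x) * powser b (nsq n x) \<partial>Rn_lebesgue n)"
      by (rule series(2)) auto
    then show ?thesis
      unfolding gaussian_moment(2)[OF s] term_eq[symmetric] Omega_sq_scaled_powser b_def[symmetric]
      by (simp only: mult.left_commute)
  qed
  moreover have "(\<lambda>j. gauss_const n s * (D * (t ^ j / fact j * (pochhammer (real n / 2 + real i) j / pochhammer (real n / 2) j))))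
      sums (gauss_const n s * (D * (exp t * kummer_poly n i t)))"
    by (intro sums_mult kummer_sums n)
  ultimately show "(\<integral>x. nsq n x ^ i * exp (- s * nsq n x) * Omega_sq n (- (4 * s * t) * nsq n x) \<partial>Rn_lebesgue n)
      = gauss_const n s * (pochhammer (real n / 2) i / s ^ i) * (exp t * kummer_poly n i t)"
    unfolding D_def by (simp only: sums_unique2 mult.assoc)
qed

lemma kummer_poly_0 [simp]: "kummer_poly n 0 t = 1"
  by (simp add: kummer_poly_def)

text \<open>If \<Omega> were nonnegative, its integral against exp(- s |x|^2) would not decrease as
  s decreases to 0. But that integral is the transform of a Gaussian at frequency one, which carries
  the factor exp(- 1 / (4 s)) and tends to 0.\<close>

lemma Omega_sq_negative_somewhere:
  assumes n: "0 < n"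
  shows "\<exists>q\<ge>0. Omega_sq n q < 0"
proof (rule ccontr)
  assume "\<not> ?thesis"
  then have nonneg: "0 \<le> Omega_sq n q" if "0 \<le> q" for q using that by force
  define S where "S s = (\<integral>x. exp (- s * nsq n x) * Omega_sq n (nsq n x) \<partial>Rn_lebesgue n)" for s
  have int: "integrable (Rn_lebesgue n) (\<lambda>x. exp (- s * nsq n x) * Omega_sq n (nsq n x))"
    and S: "S s = gauss_const n s * exp (- (1 / (4 * s)))" if "0 < s" for s
    using bessel_moment[OF n that, of 0 "- (1 / (4 * s))"] that by (simp_all add: S_def)
  have mono: "S 1 \<le> S s" if "0 < s" "s \<le> 1" for s
    unfolding S_def
  proof (rule integral_mono[OF int int])
    show "exp (- 1 * nsq n x) * Omega_sq n (nsq n x) \<le> exp (- s * nsq n x) * Omega_sq n (nsq n x)" for x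
      using that by (intro mult_right_mono nonneg) (auto simp: mult_left_le_one_le)
  qed (use that in auto)
  have "S 1 > 0" using S[of 1] gauss_const_pos[of 1 n] by simp
  define h where "h N = S (1 / (4 * real (Suc N)))" for N
  have h_eq: "h N = gauss_const n (1 / 4) * (sqrt (real (Suc N)) ^ n * exp (- real (Suc N)))" for N
  proof -
    have "sqrt (pi / (1 / (4 * real (Suc N)))) = sqrt (pi / (1 / 4)) * sqrt (real (Suc N))"
      unfolding real_sqrt_mult[symmetric] by simp
    moreover have "h N = gauss_const n (1 / (4 * real (Suc N))) * exp (- real (Suc N))"
      using S[of "1 / (4 * real (Suc N))"] by (simp add: h_def del: of_nat_Suc)
    ultimately show ?thesis
      by (simp only: gauss_const_def power_mult_distrib mult.assoc)
  qed
  have "(\<lambda>N. sqrt (real (Suc N)) ^ n * exp (- real (Suc N))) \<longlonglongrightarrow> 0"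
  proof (rule tendsto_sandwich[of "\<lambda>_. 0"])
    have "((\<lambda>x::real. x ^ n / exp x) \<longlongrightarrow> 0) at_top" by (rule tendsto_power_div_exp_0)
    from filterlim_compose[OF this filterlim_real_sequentially]
    have "(\<lambda>N. real N ^ n / exp (real N)) \<longlonglongrightarrow> 0" .
    then show "(\<lambda>N. real (Suc N) ^ n / exp (real (Suc N))) \<longlonglongrightarrow> 0" by (rule LIMSEQ_Suc)
    have "sqrt (real (Suc N)) \<le> real (Suc N)" for N
      by (rule real_le_lsqrt) (auto simp: power2_eq_square)
    then show "\<forall>\<^sub>F N in sequentially. sqrt (real (Suc N)) ^ n * exp (- real (Suc N)) \<le> real (Suc N) ^ n / exp (real (Suc N))"
      by (intro always_eventually allI) (simp add: exp_minus divide_inverse power_mono del: of_nat_Suc)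
  qed (auto intro!: always_eventually)
  then have "h \<longlonglongrightarrow> 0" unfolding h_eq[abs_def] by (rule tendsto_mult_right_zero)
  moreover have "S 1 \<le> h N" for N unfolding h_def by (rule mono) auto
  ultimately have "S 1 \<le> 0" by (intro LIMSEQ_le_const) auto
  with \<open>S 1 > 0\<close> show False by simp
qed

text \<open>Weber's second exponential integral, with the modified Bessel function written as
  \<open>Omega_sq\<close> at a negative argument.\<close>

lemma weber_integral:
  assumes n: "0 < n" and \<mu>: "0 < \<mu>" and q: "0 \<le> q"
  defines "s \<equiv> 1 / (4 * \<mu>)"
  shows "integrable (Rn_lebesgue n) (\<lambda>x. Omega_sq n (q * nsq n x) * Omega_sq n (nsq n x) * exp (- s * nsq n x))"
    and "(\<integral>x. Omega_sq n (q * nsq n x) * Omega_sq n (nsq n x) * exp (- s * nsq n x) \<partial>Rn_lebesgue n)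
      = gauss_const n s * (exp (- \<mu>) * (exp (- \<mu> * q) * Omega_sq n (- (4 * \<mu>\<^sup>2) * q)))"
proof -
  have s: "0 < s" using \<mu> by (simp add: s_def)
  have s': "1 / s = 4 * \<mu>" "- (4 * s * (- \<mu>)) = 1" using \<mu> by (simp_all add: s_def)
  define b where "b j = Omega_coeff n j * q ^ j" for j
  define g where "g x = Omega_sq n (nsq n x)" for x
  have [measurable]: "Omega_sq n \<in> borel_measurable borel"
    by (intro borel_measurable_continuous_onI continuous_on_Omega_sq n)
  have gm: "g \<in> borel_measurable (Rn_lebesgue n)" unfolding g_def by measurable
  have gb: "\<bar>g x\<bar> \<le> 1" for x unfolding g_def by (rule Omega_sq_bound[OF n]) simp
  have b: "summable (\<lambda>j. \<bar>b j\<bar> * r ^ j)" if "0 \<le> r" for r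
    using summable_abs_Omega_coeff[OF n, of "q * r"] that q
    by (simp only: b_def power_mult_distrib abs_mult power_abs abs_of_nonneg mult.assoc)
  have poch_s: "pochhammer (real n / 2) j / s ^ j = pochhammer (real n / 2) j * (4 * \<mu>) ^ j" for j
    using \<mu> by (simp add: s_def power_one_over)
  have sum: "summable (\<lambda>j. \<bar>b j\<bar> * (pochhammer (real n / 2) (j + 0) / s ^ (j + 0)))"
  proof -
    have "\<bar>b j\<bar> * (pochhammer (real n / 2) (j + 0) / s ^ (j + 0)) = inverse (fact j) * (\<mu> * q) ^ j" for j
    proof -
      have "\<bar>b j\<bar> = q ^ j / (4 ^ j * (fact j * pochhammer (real n / 2) j))"
        using q pochhammer_half_pos[OF n, of j]
        by (simp add: b_def Omega_coeff_def abs_mult power_abs power_divide)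
      then show ?thesis
        using pochhammer_half_pos[OF n, of j] unfolding add_0_right poch_s
        by (simp add: power_mult_distrib field_simps)
    qed
    then show ?thesis using summable_exp[of "\<mu> * q"] by simp
  qed
  note series = gaussian_series[OF s gm gb b sum]
  have inner: "(\<integral>x. g x * (nsq n x ^ j * exp (- s * nsq n x)) \<partial>Rn_lebesgue n)
      = gauss_const n s * (pochhammer (real n / 2) j * (4 * \<mu>) ^ j) * (exp (- \<mu>) * kummer_poly n j (- \<mu>))" for j
    using bessel_moment(2)[OF n s, of j "- \<mu>"] unfolding s'(2) poch_s mult_1_left g_def
    by (simp only: mult_ac)
  \<comment> \<open>The terms of the two series whose product is claimed. Splitting binomial over
    factorial into two reciprocal factorials turns the j-th integrated term into the j-th term of
    their Cauchy product.\<close>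
  define a where "a l = Omega_coeff n l * (- (4 * \<mu>\<^sup>2) * q) ^ l" for l
  define e where "e l = inverse (fact l) * (- \<mu> * q) ^ l" for l
  have term_eq: "b j * (\<integral>x. g x * (nsq n x ^ j * exp (- s * nsq n x)) \<partial>Rn_lebesgue n)
      = (gauss_const n s * exp (- \<mu>)) * (\<Sum>l\<le>j. a l * e (j - l))" for j
  proof -
    have c: "Omega_coeff n j * q ^ j * (pochhammer (real n / 2) j * (4 * \<mu>) ^ j) = (- \<mu> * q) ^ j / fact j"
    proof -
      have "(- 1 / 4) ^ j * q ^ j * (4 * \<mu>) ^ j = (- \<mu> * q) ^ j"
        unfolding power_mult_distrib[symmetric] by (simp add: mult.commute)
      then show ?thesis using pochhammer_half_pos[OF n, of j]
        by (simp add: Omega_coeff_def)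
    qed
    have gen: "(inverse u * inverse v) * (m * x) * y / p = (m / (u * p) * x) * (inverse v * y)"
      for u v m x y p :: real
      by (simp add: divide_inverse)
    have d: "(- \<mu> * q) ^ j / fact j * kummer_poly n j (- \<mu>) = (\<Sum>l\<le>j. a l * e (j - l))"
      unfolding kummer_poly_def sum_distrib_left
    proof (intro sum.cong refl)
      fix l assume "l \<in> {..j}"
      then have l: "l \<le> j" by simp
      have 1: "real (j choose l) / fact j = inverse (fact l) * inverse (fact (j - l))"
        using binomial_fact[OF l, where 'a = real] by (simp add: field_simps)
      have 2: "(- \<mu> * q) ^ j = (- \<mu> * q) ^ l * (- \<mu> * q) ^ (j - l)"
        using l by (simp flip: power_add)
      have 3: "(- \<mu> * q) ^ l * (- \<mu>) ^ l = (- 1 / 4) ^ l * (- (4 * \<mu>\<^sup>2) * q) ^ l"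
        unfolding power_mult_distrib[symmetric] by (simp add: power2_eq_square mult_ac)
      have "(- \<mu> * q) ^ j / fact j * (real (j choose l) / pochhammer (real n / 2) l * (- \<mu>) ^ l)
        = (real (j choose l) / fact j) * ((- \<mu> * q) ^ l * (- \<mu>) ^ l) * (- \<mu> * q) ^ (j - l) / pochhammer (real n / 2) l"
        unfolding 2 by simp
      also have "\<dots> = a l * e (j - l)"
        unfolding 1 3 a_def e_def Omega_coeff_def by (rule gen)
      finally show "(- \<mu> * q) ^ j / fact j * (real (j choose l) / pochhammer (real n / 2) l * (- \<mu>) ^ l) = a l * e (j - l)" .
    qed
    have "b j * (gauss_const n s * (pochhammer (real n / 2) j * (4 * \<mu>) ^ j) * (exp (- \<mu>) * kummer_poly n j (- \<mu>)))
        = (gauss_const n s * exp (- \<mu>))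
          * ((Omega_coeff n j * q ^ j * (pochhammer (real n / 2) j * (4 * \<mu>) ^ j)) * kummer_poly n j (- \<mu>))"
      unfolding b_def by (simp only: mult_ac)
    then show ?thesis unfolding inner c d .
  qed
  have eq: "(\<lambda>x. g x * nsq n x ^ 0 * exp (- s * nsq n x) * powser b (nsq n x))
      = (\<lambda>x. Omega_sq n (q * nsq n x) * Omega_sq n (nsq n x) * exp (- s * nsq n x))"
    unfolding g_def b_def Omega_sq_scaled_powser by (simp add: fun_eq_iff mult_ac)
  show "integrable (Rn_lebesgue n) (\<lambda>x. Omega_sq n (q * nsq n x) * Omega_sq n (nsq n x) * exp (- s * nsq n x))"
    using series(1) unfolding eq .
  have "(\<lambda>j. \<Sum>l\<le>j. a l * e (j - l)) sums ((\<Sum>l. a l) * (\<Sum>l. e l))"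
  proof (rule Cauchy_product_sums)
    show "summable (\<lambda>l. norm (a l))"
      unfolding a_def using summable_abs_Omega_coeff[OF n, of "- (4 * \<mu>\<^sup>2) * q"] by simp
    show "summable (\<lambda>l. norm (e l))"
      unfolding e_def using summable_norm_exp[of "- \<mu> * q"] by simp
  qed
  moreover have "(\<Sum>l. e l) = exp (- \<mu> * q)"
    unfolding e_def using exp_converges[of "- \<mu> * q"]
    by (intro sums_unique[symmetric]) (simp only: real_scaleR_def)
  moreover have "(\<Sum>l. a l) = Omega_sq n (- (4 * \<mu>\<^sup>2) * q)"
    by (simp only: a_def Omega_sq_def)
  ultimately have L: "(\<lambda>j. (gauss_const n s * exp (- \<mu>)) * (\<Sum>l\<le>j. a l * e (j - l))) sums
      ((gauss_const n s * exp (- \<mu>)) * (Omega_sq n (- (4 * \<mu>\<^sup>2) * q) * exp (- \<mu> * q)))"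
    by (intro sums_mult) simp
  have R: "(\<lambda>j. (gauss_const n s * exp (- \<mu>)) * (\<Sum>l\<le>j. a l * e (j - l))) sums
      (\<integral>x. Omega_sq n (q * nsq n x) * Omega_sq n (nsq n x) * exp (- s * nsq n x) \<partial>Rn_lebesgue n)"
    using series(2) unfolding eq add_0_right term_eq .
  show "(\<integral>x. Omega_sq n (q * nsq n x) * Omega_sq n (nsq n x) * exp (- s * nsq n x) \<partial>Rn_lebesgue n)
      = gauss_const n s * (exp (- \<mu>) * (exp (- \<mu> * q) * Omega_sq n (- (4 * \<mu>\<^sup>2) * q)))"
    unfolding sums_unique2[OF R L] by (simp only: mult_ac)
qed

section \<open>Integrals of functions of positive type\<close>

text \<open>Integrating the quadratic form of \<open>m + k\<close> points with unit weights over the last \<open>k\<close> points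
  gives the inequality in the induction; without free points it bounds the double integral below
  by a quantity of order \<open>1 / k\<close>.\<close>

lemma (in prob_space) psd_kernel_double_integral_nonneg:
  fixes K :: "'a \<Rightarrow> 'a \<Rightarrow> real"
  assumes psd: "psd_kernel (space M) K"
    and diag: "\<And>x. x \<in> space M \<Longrightarrow> K x x = d"
    and int: "\<And>x. x \<in> space M \<Longrightarrow> integrable M (K x)"
    and intV: "integrable M (\<lambda>x. \<integral>y. K x y \<partial>M)"
  shows "0 \<le> (\<integral>x. \<integral>y. K x y \<partial>M \<partial>M)"
proof -
  define V where "V x = (\<integral>y. K x y \<partial>M)" for x
  define I where "I = (\<integral>x. V x \<partial>M)"
  have step: "0 \<le> (\<Sum>i<m. \<Sum>j<m. K (x i) (x j)) + 2 * real k * (\<Sum>i<m. V (x i)) + real k * d + real k * (real k - 1) * I"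
    if "\<And>i. i < m \<Longrightarrow> x i \<in> space M" for m k and x :: "nat \<Rightarrow> 'a"
    using that
  proof (induction k arbitrary: m x)
    case 0
    then show ?case using psd_kernel_family[OF psd, of "{..<m}" x "\<lambda>_. 1"] by auto
  next
    case (Suc k)
    define A where "A = (\<Sum>i<m. \<Sum>j<m. K (x i) (x j)) + 2 * real k * (\<Sum>i<m. V (x i)) + d + real k * d + real k * (real k - 1) * I"
    define G where "G y = A + 2 * (\<Sum>i<m. K (x i) y) + 2 * real k * V y" for y
    have "0 \<le> G y" if y: "y \<in> space M" for y
    proof -
      define z where "z = x(m := y)"
      have z: "z i = x i" if "i < m" for i using that by (simp add: z_def)
      have zm: "z m = y" by (simp add: z_def)
      have IH: "0 \<le> (\<Sum>i<Suc m. \<Sum>j<Suc m. K (z i) (z j)) + 2 * real k * (\<Sum>i<Suc m. V (z i)) + real k * d + real k * (real k - 1) * I"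
        by (rule Suc.IH) (use Suc.prems y in \<open>auto simp: z_def less_Suc_eq\<close>)
      have e1: "(\<Sum>i<Suc m. V (z i)) = (\<Sum>i<m. V (x i)) + V y"
        using z zm by simp
      have e2: "(\<Sum>i<Suc m. \<Sum>j<Suc m. K (z i) (z j)) = (\<Sum>i<m. \<Sum>j<m. K (x i) (x j)) + 2 * (\<Sum>i<m. K (x i) y) + d"
      proof -
        have "K y (x j) = K (x j) y" if "j < m" for j
          using psd_kernel_sym[OF psd y Suc.prems[OF that]] .
        then show ?thesis using z zm diag[OF y] by (simp add: sum.distrib)
      qed
      show ?thesis using IH unfolding e1 e2 by (simp add: G_def A_def algebra_simps)
    qed
    then have "0 \<le> (\<integral>y. G y \<partial>M)" by (rule Bochner_Integration.integral_nonneg)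
    also have "(\<integral>y. G y \<partial>M) = A + 2 * (\<Sum>i<m. V (x i)) + 2 * real k * I"
    proof -
      have i1: "integrable M (\<lambda>y. K (x i) y)" if "i < m" for i
        using int Suc.prems that by blast
      have i2: "integrable M (\<lambda>y. 2 * (\<Sum>i<m. K (x i) y))"
        using i1 by (intro integrable_mult_right Bochner_Integration.integrable_sum) auto
      have i3: "integrable M V" using intV by (simp add: V_def[abs_def])
      have "(\<integral>y. G y \<partial>M) = (\<integral>y. A \<partial>M) + (\<integral>y. 2 * (\<Sum>i<m. K (x i) y) \<partial>M) + (\<integral>y. 2 * real k * V y \<partial>M)"
        unfolding G_def using i2 i3 by (subst Bochner_Integration.integral_add, simp, simp)+ simp
      also have "(\<integral>y. 2 * (\<Sum>i<m. K (x i) y) \<partial>M) = 2 * (\<Sum>i<m. V (x i))"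
        unfolding integral_mult_right_zero V_def using i1 by (subst Bochner_Integration.integral_sum) auto
      also have "(\<integral>y. 2 * real k * V y \<partial>M) = 2 * real k * I"
        by (simp add: I_def)
      finally show ?thesis by (simp add: prob_space)
    qed
    also have "\<dots> = (\<Sum>i<m. \<Sum>j<m. K (x i) (x j)) + 2 * real (Suc k) * (\<Sum>i<m. V (x i)) + real (Suc k) * d + real (Suc k) * (real (Suc k) - 1) * I"
      by (simp add: A_def algebra_simps)
    finally show ?case .
  qed
  \<comment> \<open>No free points and \<open>k + 2\<close> integrated ones: \<open>k + 2\<close>
    diagonal terms, and \<open>(k + 2) * (k + 1)\<close> others that integrate to
    \<open>I\<close>.\<close>
  have "- (d / real (Suc k)) \<le> I" for k
  proof -
    have "0 \<le> real (Suc (Suc k)) * (d + real (Suc k) * I)"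
      using step[of 0 "\<lambda>_. undefined" "Suc (Suc k)"] by (simp add: algebra_simps)
    then have "0 \<le> d + real (Suc k) * I" by (simp add: zero_le_mult_iff del: of_nat_Suc)
    then show ?thesis by (simp add: field_simps del: of_nat_Suc)
  qed
  moreover have "(\<lambda>k. - (d / real (Suc k))) \<longlonglongrightarrow> - 0"
    by (intro tendsto_minus LIMSEQ_Suc[OF lim_const_over_n])
  ultimately have "- 0 \<le> I" by (intro LIMSEQ_le_const2) auto
  then show ?thesis by (simp add: I_def V_def)
qed

section \<open>Differences of points and growing cubes\<close>

interpretation Rn_lebesgue: sigma_finite_measure "Rn_lebesgue n"
  unfolding Rn_lebesgue_def by (rule lborel_prod.sigma_finite) simp

lemma vdiff_in_Rn [simp]: "vdiff n x y \<in> Rn n"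
  by (simp add: vdiff_def Rn_def)

lemma vdiff_vaff: "z \<in> Rn n \<Longrightarrow> vdiff n x (vaff n x (-1) z) = z"
  by (auto simp: vdiff_def vaff_def Rn_def PiE_def extensional_def fun_eq_iff)

lemma vdiff_eq_vaff: "vdiff n x y = vaff n x (-1) y"
  by (simp add: vdiff_def vaff_def)

lemma vdiff_eq_vaff': "vdiff n x y = vaff n (\<lambda>i. - y i) 1 x"
  by (auto simp: vdiff_def vaff_def)

lemma sqdist_eq_nsq_vdiff: "sqdist n x y = nsq n (vdiff n x y)"
  unfolding sqdist_def nsq_def vdiff_def by (intro sum.cong) auto

lemma measurable_vdiff_left [measurable]: "(\<lambda>x. vdiff n x y) \<in> Rn_lebesgue n \<rightarrow>\<^sub>M Rn_lebesgue n"
  unfolding vdiff_eq_vaff' by simp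

lemma measurable_vdiff_right [measurable]: "(\<lambda>y. vdiff n x y) \<in> Rn_lebesgue n \<rightarrow>\<^sub>M Rn_lebesgue n"
  unfolding vdiff_eq_vaff by simp

lemma measurable_vdiff_pair [measurable]:
  "(\<lambda>p. vdiff n (fst p) (snd p)) \<in> Rn_lebesgue n \<Otimes>\<^sub>M Rn_lebesgue n \<rightarrow>\<^sub>M Rn_lebesgue n"
proof -
  have "(\<lambda>p. \<lambda>i\<in>{..<n}. fst p i - snd p i) \<in> Rn_lebesgue n \<Otimes>\<^sub>M Rn_lebesgue n \<rightarrow>\<^sub>M (\<Pi>\<^sub>M i\<in>{..<n}. lborel)"
  proof (rule measurable_restrict)
    fix i assume i: "i \<in> {..<n}"
    have "(\<lambda>p. fst p i) \<in> borel_measurable (Rn_lebesgue n \<Otimes>\<^sub>M Rn_lebesgue n)"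
      "(\<lambda>p. snd p i) \<in> borel_measurable (Rn_lebesgue n \<Otimes>\<^sub>M Rn_lebesgue n)"
      using i by (auto intro!: measurable_compose[OF measurable_fst measurable_Rn_component]
          measurable_compose[OF measurable_snd measurable_Rn_component])
    then show "(\<lambda>p. fst p i - snd p i) \<in> Rn_lebesgue n \<Otimes>\<^sub>M Rn_lebesgue n \<rightarrow>\<^sub>M lborel"
      by simp
  qed
  then show ?thesis by (simp add: vdiff_def[abs_def] Rn_lebesgue_def)
qed

lemma cube_mono: "S \<le> T \<Longrightarrow> cube n S \<subseteq> cube n T"
  unfolding cube_def by (rule PiE_mono) auto

lemma cube_subset_Rn: "cube n T \<subseteq> Rn n"
  unfolding cube_def Rn_def by (rule PiE_mono) simp

lemma vdiff_in_cube:
  assumes "x \<in> cube n S" "y \<in> cube n T"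
  shows "vdiff n x y \<in> cube n (S + T)"
proof -
  have "x i - y i \<in> {- (S + T)..S + T}" if "i < n" for i
  proof -
    have "x i \<in> {-S..S}" "y i \<in> {-T..T}"
      using that PiE_mem[OF assms(1)[unfolded cube_def]] PiE_mem[OF assms(2)[unfolded cube_def]] by blast+
    then show ?thesis by simp
  qed
  then show ?thesis by (auto simp: cube_def vdiff_def)
qed

lemma Rn_in_some_cube:
  assumes "x \<in> Rn n"
  shows "\<exists>R\<ge>0. x \<in> cube n R"
proof (intro exI conjI)
  show "0 \<le> (\<Sum>i<n. \<bar>x i\<bar>)" by (simp add: sum_nonneg)
  have "\<bar>x i\<bar> \<le> (\<Sum>i<n. \<bar>x i\<bar>)" if "i < n" for i
    using that by (intro member_le_sum) auto
  then have "x i \<in> {- (\<Sum>i<n. \<bar>x i\<bar>)..(\<Sum>i<n. \<bar>x i\<bar>)}" if "i < n" for i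
    using that abs_le_iff[of "x i"] by fastforce
  then show "x \<in> cube n (\<Sum>i<n. \<bar>x i\<bar>)"
    using assms by (auto simp: cube_def Rn_def PiE_iff)
qed

lemma cube_shell_tendsto: "((\<lambda>T::real. 1 - (2 * (T - R)) ^ n / (2 * T) ^ n) \<longlongrightarrow> 0) at_top"
proof -
  have inv: "((\<lambda>T::real. inverse T) \<longlongrightarrow> 0) at_top" by (rule tendsto_inverse_0_at_top[OF filterlim_ident])
  have "((\<lambda>T. 1 - (1 - R * inverse T) ^ n) \<longlongrightarrow> 1 - (1 - R * 0) ^ n) at_top"
    by (intro tendsto_diff tendsto_power tendsto_mult tendsto_const inv)
  then have "((\<lambda>T. 1 - (1 - R * inverse T) ^ n) \<longlongrightarrow> 0) at_top" by simp
  moreover have "\<forall>\<^sub>F T in at_top. 1 - (1 - R * inverse T) ^ n = 1 - (2 * (T - R)) ^ n / (2 * T) ^ n"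
    using eventually_gt_at_top[of 0]
  proof eventually_elim
    case (elim T)
    have "(2 * (T - R)) / (2 * T) = 1 - R * inverse T" using elim by (simp add: field_simps)
    then show ?case by (simp only: power_divide[symmetric])
  qed
  ultimately show ?thesis by (rule Lim_transform_eventually)
qed

lemma integrable_indicator_cube: "integrable (Rn_lebesgue n) (indicator (cube n T) :: _ \<Rightarrow> real)"
proof (cases "0 \<le> T")
  case True
  then show ?thesis by (intro integrable_real_indicator) (simp_all add: emeasure_cube)
next
  case False
  then have "cube n T \<subseteq> cube n 0" by (intro cube_mono) simp
  then have "emeasure (Rn_lebesgue n) (cube n T) \<le> emeasure (Rn_lebesgue n) (cube n 0)"
    by (intro emeasure_mono) simp_all
  also have "\<dots> < \<infinity>" by (simp add: emeasure_cube)
  finally show ?thesis by (intro integrable_real_indicator) simp_all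
qed

lemma integral_indicator_cube: "0 \<le> T \<Longrightarrow> (\<integral>x. indicator (cube n T) x \<partial>Rn_lebesgue n) = (2 * T) ^ n"
  using measure_cube[of T n] cube_subset_Rn[of n T] by (simp add: Int_absorb2)

text \<open>The double integral of H(x - y) over a cube is nonnegative. Divided by the volume it
  approaches the integral of H, because for x away from the boundary the inner integral differs from
  it only by a tail, and the boundary shell has a vanishing share of the volume.\<close>

lemma integral_psd_nonneg:
  assumes [measurable]: "H \<in> borel_measurable (Rn_lebesgue n)"
    and int: "integrable (Rn_lebesgue n) H"
    and psd: "psd_kernel (Rn n) (\<lambda>x y. H (vdiff n x y))"
  shows "0 \<le> (\<integral>x. H x \<partial>Rn_lebesgue n)"
proof -
  let ?M = "Rn_lebesgue n"
  define u where "u T x = (\<integral>y. indicator (cube n T) y * H (vdiff n x y) \<partial>?M)" for T x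
  have [measurable]: "u T \<in> borel_measurable ?M" for T
    unfolding u_def by (intro Rn_lebesgue.borel_measurable_lebesgue_integral) measurable
  define N where "N = (\<integral>z. \<bar>H z\<bar> \<partial>?M)"
  define tail where "tail R = (\<integral>z. (1 - indicator (cube n R) z) * \<bar>H z\<bar> \<partial>?M)" for R
  have tail_int: "integrable ?M (\<lambda>z. (1 - indicator (cube n R) z) * \<bar>H z\<bar>)" for R
    by (rule Bochner_Integration.integrable_bound[OF int]) (auto simp: indicator_def)
  have absint: "integrable ?M (\<lambda>z. \<bar>H z\<bar>)" using int by simp
  have u_eq: "u T x = (\<integral>z. indicator (cube n T) (vaff n x (-1) z) * H z \<partial>?M)"
    and u_int: "integrable ?M (\<lambda>z. indicator (cube n T) (vaff n x (-1) z) * H z)"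
    and u_int': "integrable ?M (\<lambda>y. indicator (cube n T) y * H (vdiff n x y))" for T x
  proof -
    let ?g = "\<lambda>y. indicator (cube n T) y * H (vdiff n x y)"
    have g: "?g \<in> borel_measurable ?M" by measurable
    have eq: "?g (vaff n x (-1) z) = indicator (cube n T) (vaff n x (-1) z) * H z" if "z \<in> Rn n" for z
      using vdiff_vaff[OF that] by simp
    show *: "integrable ?M (\<lambda>z. indicator (cube n T) (vaff n x (-1) z) * H z)"
      by (rule Bochner_Integration.integrable_bound[OF int]) (auto simp: indicator_def)
    have "u T x = (\<integral>z. ?g (vaff n x (-1) z) \<partial>?M)"
      unfolding u_def using integral_vaff(1)[OF _ g, of "-1" x] by simp
    also have "\<dots> = (\<integral>z. indicator (cube n T) (vaff n x (-1) z) * H z \<partial>?M)"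
      by (intro Bochner_Integration.integral_cong refl) (simp add: eq)
    finally show "u T x = (\<integral>z. indicator (cube n T) (vaff n x (-1) z) * H z \<partial>?M)" .
    have "integrable ?M (\<lambda>z. ?g (vaff n x (-1) z))"
      using * by (rule Bochner_Integration.integrable_cong[THEN iffD1, rotated 2]) (simp_all add: eq)
    then show "integrable ?M ?g" using integral_vaff(2)[OF _ g, of "-1" x] by simp
  qed
  have u_abs: "\<bar>u T x\<bar> \<le> N" for T x
  proof -
    have "\<bar>u T x\<bar> \<le> (\<integral>z. \<bar>indicator (cube n T) (vaff n x (-1) z) * H z\<bar> \<partial>?M)"
      unfolding u_eq by (rule integral_abs_bound)
    also have "\<dots> \<le> N"
      unfolding N_def using u_int absint by (intro integral_mono) (auto simp: indicator_def)
    finally show ?thesis .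
  qed
  \<comment> \<open>For a point at depth \<open>R\<close> the reflected and translated cube still
    contains the cube of size \<open>R\<close>, so at most the tail is missing.\<close>
  have u_inner: "u T x \<le> (\<integral>z. H z \<partial>?M) + tail R" if x: "x \<in> cube n (T - R)" for T R x
  proof -
    have "u T x \<le> (\<integral>z. H z + (1 - indicator (cube n R) z) * \<bar>H z\<bar> \<partial>?M)"
      unfolding u_eq
    proof (rule integral_mono[OF u_int])
      show "integrable ?M (\<lambda>z. H z + (1 - indicator (cube n R) z) * \<bar>H z\<bar>)"
        using int tail_int by simp
      fix z
      have "vaff n x (-1) z \<in> cube n T" if "z \<in> cube n R"
        using vdiff_in_cube[OF x that] by (simp add: vdiff_eq_vaff)
      then show "indicator (cube n T) (vaff n x (-1) z) * H z \<le> H z + (1 - indicator (cube n R) z) * \<bar>H z\<bar>"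
        by (auto simp: indicator_def)
    qed
    then show ?thesis using int tail_int by (simp add: tail_def)
  qed
  \<comment> \<open>The uniform distribution on the cube makes the inequality for probability spaces
    applicable; the factor \<open>v\<^sup>2\<close> only rescales.\<close>
  have pos: "0 \<le> (\<integral>x. indicator (cube n T) x * u T x \<partial>?M)" if T: "0 < T" for T
  proof -
    define v where "v = (2 * T) ^ n"
    have v: "0 < v" using T by (simp add: v_def)
    define \<mu> where "\<mu> = uniform_measure ?M (cube n T)"
    have em: "emeasure ?M (cube n T) = ennreal v" using T by (simp add: emeasure_cube v_def)
    then have em': "emeasure ?M (cube n T) \<noteq> 0" "emeasure ?M (cube n T) \<noteq> \<infinity>" using v by auto
    interpret \<mu>: prob_space \<mu> unfolding \<mu>_def using em' by (rule prob_space_uniform_measure)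
    have \<mu>_density: "\<mu> = density ?M (\<lambda>x. ennreal (indicator (cube n T) x / v))"
      unfolding \<mu>_def uniform_measure_def em using v
      by (intro density_cong) (auto simp: indicator_def divide_ennreal ennreal_1[symmetric] simp del: ennreal_1)
    have \<mu>_int: "integrable \<mu> h \<longleftrightarrow> integrable ?M (\<lambda>x. (indicator (cube n T) x / v) * h x)"
      and \<mu>_eq: "(\<integral>x. h x \<partial>\<mu>) = (\<integral>x. (indicator (cube n T) x / v) * h x \<partial>?M)"
      if "h \<in> borel_measurable ?M" for h :: "_ \<Rightarrow> real"
      unfolding \<mu>_density using that v
      by (auto simp: integrable_density integral_density)
    have [simp]: "space \<mu> = Rn n" by (simp add: \<mu>_def)
    have V_eq: "(\<integral>y. H (vdiff n x y) \<partial>\<mu>) = u T x / v" for x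
      unfolding u_def by (subst \<mu>_eq) auto
    have "0 \<le> (\<integral>x. \<integral>y. H (vdiff n x y) \<partial>\<mu> \<partial>\<mu>)"
    proof (rule \<mu>.psd_kernel_double_integral_nonneg)
      show "psd_kernel (space \<mu>) (\<lambda>x y. H (vdiff n x y))" using psd by simp
      show "H (vdiff n x x) = H (\<lambda>i\<in>{..<n}. 0)" for x by (simp add: vdiff_def)
      show "integrable \<mu> (\<lambda>y. H (vdiff n x y))" for x
        using u_int'[of T x] by (subst \<mu>_int) (auto simp: field_simps)
      show "integrable \<mu> (\<lambda>x. \<integral>y. H (vdiff n x y) \<partial>\<mu>)"
        unfolding V_eq
      proof (rule \<mu>.integrable_const_bound[of _ "N / v"])
        show "AE x in \<mu>. norm (u T x / v) \<le> N / v"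
          using u_abs v by (auto intro!: divide_right_mono)
        show "(\<lambda>x. u T x / v) \<in> borel_measurable \<mu>" unfolding \<mu>_def by simp
      qed
    qed
    also have "\<dots> = (\<integral>x. (indicator (cube n T) x / v) * (u T x / v) \<partial>?M)"
      unfolding V_eq by (rule \<mu>_eq) simp
    also have "\<dots> = (\<integral>x. indicator (cube n T) x * u T x \<partial>?M) / v\<^sup>2"
      by (simp add: power2_eq_square)
    finally show ?thesis using v by (simp add: zero_le_divide_iff)
  qed
  have bound: "0 \<le> (\<integral>z. H z \<partial>?M) + tail R" if R: "0 \<le> R" for R
  proof -
    define J where "J = (\<integral>z. H z \<partial>?M) + tail R"
    \<comment> \<open>\<open>J\<close> bounds \<open>u T\<close> on the inner cube;
      \<open>J + B\<close> is at least \<open>N\<close> and so bounds it on the shell as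
      well.\<close>
    define B where "B = N + \<bar>J\<bar>"
    have est: "0 \<le> J + B * (1 - (2 * (T - R)) ^ n / (2 * T) ^ n)" if T: "0 < T" "R \<le> T" for T
    proof -
      have "0 \<le> (\<integral>x. indicator (cube n T) x * u T x \<partial>?M)" by (rule pos[OF T(1)])
      also have "\<dots> \<le> (\<integral>x. (J + B) * indicator (cube n T) x - B * indicator (cube n (T - R)) x \<partial>?M)"
      proof (rule integral_mono)
        show "integrable ?M (\<lambda>x. indicator (cube n T) x * u T x)"
        proof (rule Bochner_Integration.integrable_bound)
          show "integrable ?M (\<lambda>x. N * indicator (cube n T) x)" using integrable_indicator_cube by simp
          show "AE x in ?M. norm (indicator (cube n T) x * u T x) \<le> norm (N * indicator (cube n T) x)"
            using order_trans[OF u_abs abs_ge_self] by (intro always_eventually allI) (simp add: indicator_def)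
        qed measurable
        show "integrable ?M (\<lambda>x. (J + B) * indicator (cube n T) x - B * indicator (cube n (T - R)) x)"
          by (intro Bochner_Integration.integrable_diff integrable_mult_right integrable_indicator_cube)
        fix x
        have "cube n (T - R) \<subseteq> cube n T" using R by (intro cube_mono) simp
        moreover have "u T x \<le> J" if "x \<in> cube n (T - R)" using u_inner[OF that] by (simp add: J_def)
        moreover have "u T x \<le> J + B" using u_abs[of T x] by (simp add: B_def abs_if split: if_splits)
        ultimately show "indicator (cube n T) x * u T x \<le> (J + B) * indicator (cube n T) x - B * indicator (cube n (T - R)) x"
          by (auto simp: indicator_def)
      qed
      also have "\<dots> = (J + B) * (2 * T) ^ n - B * (2 * (T - R)) ^ n"
        using T R by (subst Bochner_Integration.integral_diff)
          (auto simp only: integral_mult_right_zero integral_indicator_cube integrable_mult_right integrable_indicator_cube)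
      also have "\<dots> = (2 * T) ^ n * (J + B * (1 - (2 * (T - R)) ^ n / (2 * T) ^ n))"
        using T by (simp add: field_simps)
      finally have "0 \<le> (2 * T) ^ n * (J + B * (1 - (2 * (T - R)) ^ n / (2 * T) ^ n))" .
      moreover have "0 < (2 * T) ^ n" using T by simp
      ultimately show ?thesis by (meson not_le zero_le_mult_iff)
    qed
    have "((\<lambda>T. J + B * (1 - (2 * (T - R)) ^ n / (2 * T) ^ n)) \<longlongrightarrow> J + B * 0) at_top"
      by (intro tendsto_intros cube_shell_tendsto)
    then have "0 \<le> J + B * 0"
    proof (rule tendsto_lowerbound)
      show "\<forall>\<^sub>F T in at_top. 0 \<le> J + B * (1 - (2 * (T - R)) ^ n / (2 * T) ^ n)"
        using eventually_gt_at_top[of "max 0 R"] by eventually_elim (rule est, auto)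
    qed simp
    then show ?thesis by (simp add: J_def)
  qed
  \<comment> \<open>Only now, with \<open>T\<close> already gone to infinity, is the depth
    increased.\<close>
  have "(\<lambda>k. tail (real k)) \<longlonglongrightarrow> (\<integral>z. 0 \<partial>?M)"
    unfolding tail_def
  proof (rule integral_dominated_convergence[where w = "\<lambda>z. \<bar>H z\<bar>"])
    show "AE z in ?M. (\<lambda>k. (1 - indicator (cube n (real k)) z) * \<bar>H z\<bar>) \<longlonglongrightarrow> 0"
    proof (rule AE_I2)
      fix z assume "z \<in> space ?M"
      then obtain R where R: "z \<in> cube n R" using Rn_in_some_cube[of z n] by auto
      have "\<forall>\<^sub>F k in sequentially. R \<le> real k"
        using filterlim_real_sequentially by (simp add: filterlim_at_top)
      then have "\<forall>\<^sub>F k in sequentially. (1 - indicator (cube n (real k)) z) * \<bar>H z\<bar> = 0"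
      proof eventually_elim
        case (elim k)
        then show ?case using cube_mono[OF elim, of n] R by (auto simp: indicator_def)
      qed
      then show "(\<lambda>k. (1 - indicator (cube n (real k)) z) * \<bar>H z\<bar>) \<longlonglongrightarrow> 0"
        by (rule tendsto_eventually)
    qed
  qed (use absint in \<open>auto simp: indicator_def\<close>)
  then have "(\<lambda>k. (\<integral>z. H z \<partial>?M) + tail (real k)) \<longlonglongrightarrow> (\<integral>z. H z \<partial>?M) + 0"
    by (intro tendsto_intros) simp
  then have "0 \<le> (\<integral>z. H z \<partial>?M) + 0"
    by (rule LIMSEQ_le_const) (use bound in auto)
  then show ?thesis by simp
qed

section \<open>The lower bound at distance one\<close>

lemma psd_kernel_integral:
  fixes K :: "'b \<Rightarrow> 'a \<Rightarrow> 'a \<Rightarrow> real"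
  assumes "\<And>\<xi>. \<xi> \<in> space M \<Longrightarrow> psd_kernel X (K \<xi>)"
    and int: "\<And>x y. x \<in> X \<Longrightarrow> y \<in> X \<Longrightarrow> integrable M (\<lambda>\<xi>. K \<xi> x y)"
  shows "psd_kernel X (\<lambda>x y. \<integral>\<xi>. K \<xi> x y \<partial>M)"
proof (rule psd_kernelI)
  show "(\<integral>\<xi>. K \<xi> x y \<partial>M) = (\<integral>\<xi>. K \<xi> y x \<partial>M)" if "x \<in> X" "y \<in> X" for x y
    using psd_kernel_sym[OF assms(1) that] by (intro Bochner_Integration.integral_cong) auto
  show "0 \<le> (\<Sum>x\<in>U. \<Sum>y\<in>U. (\<integral>\<xi>. K \<xi> x y \<partial>M) * c x * c y)" if U: "finite U" "U \<subseteq> X" for U c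
  proof -
    have i: "integrable M (\<lambda>\<xi>. K \<xi> x y * c x * c y)" if "x \<in> U" "y \<in> U" for x y
      using int[of x y] that U(2) by auto
    have "(\<Sum>x\<in>U. \<Sum>y\<in>U. (\<integral>\<xi>. K \<xi> x y \<partial>M) * c x * c y)
        = (\<Sum>x\<in>U. \<integral>\<xi>. (\<Sum>y\<in>U. K \<xi> x y * c x * c y) \<partial>M)"
      using i by (intro sum.cong refl) (subst Bochner_Integration.integral_sum, auto)
    also have "\<dots> = (\<integral>\<xi>. (\<Sum>x\<in>U. \<Sum>y\<in>U. K \<xi> x y * c x * c y) \<partial>M)"
      using i by (intro Bochner_Integration.integral_sum[symmetric] Bochner_Integration.integrable_sum) auto
    also have "0 \<le> \<dots>"
      using psd_kernel_quad[OF assms(1) U] by (intro Bochner_Integration.integral_nonneg) auto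
    finally show ?thesis .
  qed
qed

text \<open>Chebyshev's argument: within distance d of \<open>a\<close> continuity controls
  \<open>F\<close>; beyond it the deviation is at most 2 B, hence at most 2 B / d^2 times the
  squared distance, whose weighted integral tends to 0.\<close>

lemma concentration:
  fixes F :: "real \<Rightarrow> real" and w :: "nat \<Rightarrow> (nat \<Rightarrow> real) \<Rightarrow> real"
  assumes w: "\<And>k x. 0 \<le> w k x" "\<And>k. integrable (Rn_lebesgue n) (w k)"
      "\<And>k. (\<integral>x. w k x \<partial>Rn_lebesgue n) = 1"
    and var: "\<And>k. integrable (Rn_lebesgue n) (\<lambda>x. (nsq n x - a)\<^sup>2 * w k x)"
      "(\<lambda>k. \<integral>x. (nsq n x - a)\<^sup>2 * w k x \<partial>Rn_lebesgue n) \<longlonglongrightarrow> 0"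
    and F: "continuous_on UNIV F" "\<And>q. 0 \<le> q \<Longrightarrow> \<bar>F q\<bar> \<le> B" and a: "0 \<le> a"
  shows "integrable (Rn_lebesgue n) (\<lambda>x. F (nsq n x) * w k x)"
    and "(\<lambda>k. \<integral>x. F (nsq n x) * w k x \<partial>Rn_lebesgue n) \<longlonglongrightarrow> F a"
proof -
  let ?M = "Rn_lebesgue n"
  have [measurable]: "F \<in> borel_measurable borel" by (rule borel_measurable_continuous_onI[OF F(1)])
  have [measurable]: "w k \<in> borel_measurable ?M" for k using w(2) by blast
  show int: "integrable ?M (\<lambda>x. F (nsq n x) * w k x)" for k
  proof (rule Bochner_Integration.integrable_bound[OF integrable_mult_right[of B, OF w(2)]])
    show "AE x in ?M. norm (F (nsq n x) * w k x) \<le> norm (B * w k x)"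
    proof (intro always_eventually allI)
      fix x
      have "\<bar>F (nsq n x)\<bar> \<le> \<bar>B\<bar>" using F(2)[of "nsq n x"] by simp
      then show "norm (F (nsq n x) * w k x) \<le> norm (B * w k x)"
        by (simp add: abs_mult mult_right_mono)
    qed
  qed measurable
  have "0 \<le> B" using F(2)[OF a] by simp
  define s where "s k = (\<integral>x. (nsq n x - a)\<^sup>2 * w k x \<partial>?M)" for k
  show "(\<lambda>k. \<integral>x. F (nsq n x) * w k x \<partial>?M) \<longlonglongrightarrow> F a"
  proof (rule LIMSEQ_I)
    fix \<epsilon> :: real assume \<epsilon>: "0 < \<epsilon>"
    have "isCont F a" using F(1) by (simp add: continuous_on_eq_continuous_at)
    then have "\<exists>d>0. \<forall>q. dist q a < d \<longrightarrow> dist (F q) (F a) < \<epsilon> / 2"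
      unfolding continuous_at_eps_delta using half_gt_zero[OF \<epsilon>] by blast
    then obtain d where d: "0 < d" "\<And>q. \<bar>q - a\<bar> < d \<Longrightarrow> \<bar>F q - F a\<bar> < \<epsilon> / 2"
      unfolding dist_real_def by blast
    define \<kappa> where "\<kappa> = 2 * B / d\<^sup>2"
    have \<kappa>: "0 \<le> \<kappa>" using \<open>0 \<le> B\<close> by (simp add: \<kappa>_def)
    have est: "\<bar>F q - F a\<bar> \<le> \<epsilon> / 2 + \<kappa> * (q - a)\<^sup>2" if q: "0 \<le> q" for q
    proof (cases "\<bar>q - a\<bar> < d")
      case True
      have "0 \<le> \<kappa> * (q - a)\<^sup>2" using \<kappa> by simp
      then show ?thesis using d(2)[OF True] by linarith
    next
      case False
      then have "d\<^sup>2 \<le> (q - a)\<^sup>2" using d(1) by (simp add: abs_le_square_iff[symmetric])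
      then have "\<kappa> * d\<^sup>2 \<le> \<kappa> * (q - a)\<^sup>2" by (rule mult_left_mono[OF _ \<kappa>])
      moreover have "\<kappa> * d\<^sup>2 = 2 * B" using d(1) by (simp add: \<kappa>_def)
      moreover have "\<bar>F q - F a\<bar> \<le> 2 * B" using F(2)[OF q] F(2)[OF a] by linarith
      ultimately show ?thesis using \<epsilon> by linarith
    qed
    have dist: "\<bar>(\<integral>x. F (nsq n x) * w k x \<partial>?M) - F a\<bar> \<le> \<epsilon> / 2 + \<kappa> * s k" for k
    proof -
      have "(\<integral>x. F (nsq n x) * w k x \<partial>?M) - F a = (\<integral>x. F (nsq n x) * w k x - F a * w k x \<partial>?M)"
        using int w(2,3) by simp
      also have "\<bar>\<dots>\<bar> \<le> (\<integral>x. \<bar>F (nsq n x) * w k x - F a * w k x\<bar> \<partial>?M)"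
        by (rule integral_abs_bound)
      also have "\<dots> \<le> (\<integral>x. \<epsilon> / 2 * w k x + \<kappa> * ((nsq n x - a)\<^sup>2 * w k x) \<partial>?M)"
      proof (rule integral_mono)
        show "integrable ?M (\<lambda>x. \<bar>F (nsq n x) * w k x - F a * w k x\<bar>)"
          using int w(2) by simp
        show "integrable ?M (\<lambda>x. \<epsilon> / 2 * w k x + \<kappa> * ((nsq n x - a)\<^sup>2 * w k x))"
          using w(2) var(1) by simp
        fix x
        have "\<bar>F (nsq n x) * w k x - F a * w k x\<bar> = \<bar>F (nsq n x) - F a\<bar> * w k x"
          using w(1)[of k x] by (simp add: abs_mult flip: left_diff_distrib)
        also have "\<dots> \<le> (\<epsilon> / 2 + \<kappa> * (nsq n x - a)\<^sup>2) * w k x"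
          using w(1) by (intro mult_right_mono est) auto
        finally show "\<bar>F (nsq n x) * w k x - F a * w k x\<bar> \<le> \<epsilon> / 2 * w k x + \<kappa> * ((nsq n x - a)\<^sup>2 * w k x)"
          by (simp add: algebra_simps)
      qed
      also have "\<dots> = \<epsilon> / 2 + \<kappa> * s k"
        using w(2,3) var(1) by (simp add: s_def)
      finally show ?thesis .
    qed
    have "(\<lambda>k. \<epsilon> / 2 + \<kappa> * s k) \<longlonglongrightarrow> \<epsilon> / 2 + \<kappa> * 0"
      using var(2) unfolding s_def by (intro tendsto_intros)
    moreover have "\<epsilon> / 2 + \<kappa> * 0 < \<epsilon>" using \<epsilon> by simp
    ultimately have "\<forall>\<^sub>F k in sequentially. \<epsilon> / 2 + \<kappa> * s k < \<epsilon>" by (rule order_tendstoD)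
    then obtain K where "\<And>k. K \<le> k \<Longrightarrow> \<epsilon> / 2 + \<kappa> * s k < \<epsilon>"
      by (auto simp: eventually_sequentially)
    then show "\<exists>K. \<forall>k\<ge>K. norm ((\<integral>x. F (nsq n x) * w k x \<partial>?M) - F a) < \<epsilon>"
      using dist by (intro exI[of _ K]) (auto intro: order_le_less_trans)
  qed
qed

section \<open>Weights concentrating at the origin and on the unit sphere\<close>

definition gauss_weight :: "nat \<Rightarrow> real \<Rightarrow> (nat \<Rightarrow> real) \<Rightarrow> real" where
  "gauss_weight n \<mu> x = exp (- \<mu> * nsq n x) / gauss_const n \<mu>"

text \<open>The average of the translates of the Gaussian weight by unit vectors.\<close>

definition shell_weight :: "nat \<Rightarrow> real \<Rightarrow> (nat \<Rightarrow> real) \<Rightarrow> real" where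
  "shell_weight n \<mu> x = exp (- \<mu>) * (exp (- \<mu> * nsq n x) * Omega_sq n (- (4 * \<mu>\<^sup>2) * nsq n x)) / gauss_const n \<mu>"

lemma kummer_poly_1: "0 < n \<Longrightarrow> kummer_poly n 1 t = 1 + 2 * t / real n"
  by (simp add: kummer_poly_def)

lemma kummer_poly_2:
  assumes "0 < n"
  shows "kummer_poly n 2 t = 1 + 4 * t / real n + t\<^sup>2 / pochhammer (real n / 2) 2"
proof -
  have "{..2::nat} = {0, 1, 2}" by auto
  then show ?thesis using assms by (simp add: kummer_poly_def)
qed

lemma gauss_weight_moment:
  assumes "0 < n" "0 < \<mu>"
  shows "integrable (Rn_lebesgue n) (\<lambda>x. nsq n x ^ i * gauss_weight n \<mu> x)"
    "(\<integral>x. nsq n x ^ i * gauss_weight n \<mu> x \<partial>Rn_lebesgue n) = pochhammer (real n / 2) i / \<mu> ^ i"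
  using gaussian_moment[OF assms(2), of n i] gauss_const_pos[OF assms(2), of n]
  by (simp_all add: gauss_weight_def)

lemma shell_weight_moment:
  assumes "0 < n" "0 < \<mu>"
  shows "integrable (Rn_lebesgue n) (\<lambda>x. nsq n x ^ i * shell_weight n \<mu> x)"
    "(\<integral>x. nsq n x ^ i * shell_weight n \<mu> x \<partial>Rn_lebesgue n) = pochhammer (real n / 2) i / \<mu> ^ i * kummer_poly n i \<mu>"
proof -
  have eq: "nsq n x ^ i * shell_weight n \<mu> x
      = (exp (- \<mu>) / gauss_const n \<mu>) * (nsq n x ^ i * exp (- \<mu> * nsq n x) * Omega_sq n (- (4 * \<mu> * \<mu>) * nsq n x))" for x
    by (simp add: shell_weight_def power2_eq_square mult_ac)
  show "integrable (Rn_lebesgue n) (\<lambda>x. nsq n x ^ i * shell_weight n \<mu> x)"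
    unfolding eq by (intro integrable_mult_right bessel_moment(1) assms)
  show "(\<integral>x. nsq n x ^ i * shell_weight n \<mu> x \<partial>Rn_lebesgue n) = pochhammer (real n / 2) i / \<mu> ^ i * kummer_poly n i \<mu>"
    unfolding eq integral_mult_right_zero bessel_moment(2)[OF assms]
    using gauss_const_pos[OF assms(2), of n] by (simp add: exp_minus field_simps)
qed

lemma Omega_sq_nonneg_at_nonpos:
  assumes n: "0 < n" and q: "0 \<le> q"
  shows "0 \<le> Omega_sq n (- q)"
  unfolding Omega_sq_def
proof (rule suminf_nonneg)
  show "summable (\<lambda>j. Omega_coeff n j * (- q) ^ j)"
    using entire_Omega_coeff[OF n] by (simp add: entire_def)
  fix j
  have "(- 1 / 4) ^ j * (- q) ^ j = (q / 4) ^ j" unfolding power_mult_distrib[symmetric] by simp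
  then have "Omega_coeff n j * (- q) ^ j = (q / 4) ^ j / (fact j * pochhammer (real n / 2) j)"
    by (simp add: Omega_coeff_def)
  then show "0 \<le> Omega_coeff n j * (- q) ^ j" using q by (simp add: pochhammer_half_nonneg)
qed

lemma weight_nonneg:
  assumes "0 < n" "0 < \<mu>"
  shows "0 \<le> gauss_weight n \<mu> x" "0 \<le> shell_weight n \<mu> x"
proof -
  show "0 \<le> gauss_weight n \<mu> x" using gauss_const_pos[OF assms(2), of n] by (simp add: gauss_weight_def)
  have "0 \<le> Omega_sq n (- (4 * \<mu>\<^sup>2 * nsq n x))"
    by (rule Omega_sq_nonneg_at_nonpos[OF assms(1)]) simp
  then show "0 \<le> shell_weight n \<mu> x"
    using gauss_const_pos[OF assms(2), of n] by (simp add: shell_weight_def)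
qed

text \<open>The moments of orders 0, 1 and 2 decide. Under both weights the mean square deviation of
  |x|^2 from its target is computed exactly and tends to 0 as \<mu> grows.\<close>

lemma weight_concentration:
  fixes F :: "real \<Rightarrow> real"
  assumes n: "0 < n" and F: "continuous_on UNIV F" "\<And>q. 0 \<le> q \<Longrightarrow> \<bar>F q\<bar> \<le> B"
  shows "integrable (Rn_lebesgue n) (\<lambda>x. F (nsq n x) * gauss_weight n (real (Suc k)) x)"
    and "(\<lambda>k. \<integral>x. F (nsq n x) * gauss_weight n (real (Suc k)) x \<partial>Rn_lebesgue n) \<longlonglongrightarrow> F 0"
    and "integrable (Rn_lebesgue n) (\<lambda>x. F (nsq n x) * shell_weight n (real (Suc k)) x)"
    and "(\<lambda>k. \<integral>x. F (nsq n x) * shell_weight n (real (Suc k)) x \<partial>Rn_lebesgue n) \<longlonglongrightarrow> F 1"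
proof -
  let ?M = "Rn_lebesgue n"
  define p where "p = pochhammer (real n / 2) 2"
  have p: "0 < p" unfolding p_def by (rule pochhammer_half_pos[OF n])
  have \<mu>: "0 < real (Suc k)" for k by simp
  have G: "integrable ?M (\<lambda>x. nsq n x ^ i * gauss_weight n (real (Suc k)) x)"
    "(\<integral>x. nsq n x ^ i * gauss_weight n (real (Suc k)) x \<partial>?M) = pochhammer (real n / 2) i / real (Suc k) ^ i" for i k
    by (rule gauss_weight_moment[OF n \<mu>])+
  have S: "integrable ?M (\<lambda>x. nsq n x ^ i * shell_weight n (real (Suc k)) x)"
    "(\<integral>x. nsq n x ^ i * shell_weight n (real (Suc k)) x \<partial>?M)
      = pochhammer (real n / 2) i / real (Suc k) ^ i * kummer_poly n i (real (Suc k))" for i k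
    by (rule shell_weight_moment[OF n \<mu>])+
  have inv: "(\<lambda>k. 1 / real (Suc k)) \<longlonglongrightarrow> 0"
    using LIMSEQ_inverse_real_of_nat by (simp only: inverse_eq_divide)
  have G2: "(\<lambda>x. (nsq n x - 0)\<^sup>2 * gauss_weight n (real (Suc k)) x) = (\<lambda>x. nsq n x ^ 2 * gauss_weight n (real (Suc k)) x)" for k
    by simp
  have S2: "(\<lambda>x. (nsq n x - 1)\<^sup>2 * shell_weight n (real (Suc k)) x)
      = (\<lambda>x. nsq n x ^ 2 * shell_weight n (real (Suc k)) x - 2 * (nsq n x ^ 1 * shell_weight n (real (Suc k)) x)
          + nsq n x ^ 0 * shell_weight n (real (Suc k)) x)" for k
    by (simp add: fun_eq_iff power2_eq_square algebra_simps)
  have Gvar: "(\<integral>x. (nsq n x - 0)\<^sup>2 * gauss_weight n (real (Suc k)) x \<partial>?M) = p * (1 / real (Suc k))\<^sup>2" for k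
    unfolding G2 G(2) p_def by (simp add: power_divide del: of_nat_Suc)
  \<comment> \<open>The constant term 1 of the second moment, twice the 1 in the first and the total
    mass cancel; half the leading 1 / \<mu> terms do not, hence the slower rate than for the
    Gaussian.\<close>
  have Svar: "(\<integral>x. (nsq n x - 1)\<^sup>2 * shell_weight n (real (Suc k)) x \<partial>?M)
      = p * (1 / real (Suc k))\<^sup>2 + 2 * (1 / real (Suc k))" for k
  proof -
    define t where "t = real (Suc k)"
    have t: "t > 0" by (simp add: t_def)
    have p_eq: "p = real n / 2 * (real n / 2 + 1)" by (simp add: p_def numeral_2_eq_2 pochhammer_Suc)
    have "(\<integral>x. (nsq n x - 1)\<^sup>2 * shell_weight n t x \<partial>?M)
      = p / t ^ 2 * (1 + 4 * t / real n + t\<^sup>2 / p) - 2 * (real n / 2 / t * (1 + 2 * t / real n)) + 1"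
    proof -
      note i = S(1)[of _ k]
      have i1: "integrable ?M (\<lambda>x. 2 * (nsq n x ^ 1 * shell_weight n (real (Suc k)) x))"
        by (intro integrable_mult_right i)
      show ?thesis
        unfolding S2 t_def Bochner_Integration.integral_add[OF Bochner_Integration.integrable_diff[OF i i1] i]
          Bochner_Integration.integral_diff[OF i i1] integral_mult_right_zero S(2)
          kummer_poly_1[OF n] kummer_poly_2[OF n] p_def[symmetric]
        by (simp del: of_nat_Suc)
    qed
    also have "\<dots> = p * (1 / t)\<^sup>2 + 2 * (1 / t)"
    proof -
      have "p / t ^ 2 * (t\<^sup>2 / p) = 1" using p t by simp
      moreover have "p / t ^ 2 * (4 * t / real n) = (real n + 2) / t"
        unfolding p_eq using t n by (simp add: field_simps power2_eq_square)
      moreover have "2 * (real n / 2 / t * (1 + 2 * t / real n)) = real n / t + 2"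
        using t n by (simp add: field_simps)
      ultimately have "p / t ^ 2 * (1 + 4 * t / real n + t\<^sup>2 / p) - 2 * (real n / 2 / t * (1 + 2 * t / real n)) + 1
        = p / t ^ 2 + (real n + 2) / t + 1 - (real n / t + 2) + 1"
        by (simp only: distrib_left mult_1_right)
      also have "\<dots> = p * (1 / t)\<^sup>2 + 2 * (1 / t)"
        by (simp add: power_divide add_divide_distrib)
      finally show ?thesis .
    qed
    finally show ?thesis by (simp add: t_def)
  qed
  have Glim: "(\<lambda>k. \<integral>x. (nsq n x - 0)\<^sup>2 * gauss_weight n (real (Suc k)) x \<partial>?M) \<longlonglongrightarrow> 0"
  proof -
    have "(\<lambda>k. p * (1 / real (Suc k))\<^sup>2) \<longlonglongrightarrow> p * 0\<^sup>2" by (intro tendsto_intros inv)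
    then show ?thesis unfolding Gvar by simp
  qed
  have Slim: "(\<lambda>k. \<integral>x. (nsq n x - 1)\<^sup>2 * shell_weight n (real (Suc k)) x \<partial>?M) \<longlonglongrightarrow> 0"
  proof -
    have "(\<lambda>k. p * (1 / real (Suc k))\<^sup>2 + 2 * (1 / real (Suc k))) \<longlonglongrightarrow> p * 0\<^sup>2 + 2 * 0"
      by (intro tendsto_intros inv)
    then show ?thesis unfolding Svar by simp
  qed
  have Gint: "integrable ?M (\<lambda>x. (nsq n x - 0)\<^sup>2 * gauss_weight n (real (Suc k)) x)" for k
    unfolding G2 by (rule G(1))
  have Sint: "integrable ?M (\<lambda>x. (nsq n x - 1)\<^sup>2 * shell_weight n (real (Suc k)) x)" for k
    unfolding S2 by (intro Bochner_Integration.integrable_add Bochner_Integration.integrable_diff integrable_mult_right S(1))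
  have G0: "integrable ?M (gauss_weight n (real (Suc k)))" "(\<integral>x. gauss_weight n (real (Suc k)) x \<partial>?M) = 1" for k
    using G[of 0 k] by (simp_all del: of_nat_Suc)
  have S0: "integrable ?M (shell_weight n (real (Suc k)))" "(\<integral>x. shell_weight n (real (Suc k)) x \<partial>?M) = 1" for k
    using S[of 0 k] by (simp_all del: of_nat_Suc)
  note Gc = concentration[OF weight_nonneg(1)[OF n \<mu>] G0 Gint Glim F order_refl]
  note Sc = concentration[OF weight_nonneg(2)[OF n \<mu>] S0 Sint Slim F zero_le_one]
  show "integrable ?M (\<lambda>x. F (nsq n x) * gauss_weight n (real (Suc k)) x)" by (rule Gc(1))
  show "(\<lambda>k. \<integral>x. F (nsq n x) * gauss_weight n (real (Suc k)) x \<partial>?M) \<longlonglongrightarrow> F 0" by (rule Gc(2))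
  show "integrable ?M (\<lambda>x. F (nsq n x) * shell_weight n (real (Suc k)) x)" by (rule Sc(1))
  show "(\<lambda>k. \<integral>x. F (nsq n x) * shell_weight n (real (Suc k)) x \<partial>?M) \<longlonglongrightarrow> F 1" by (rule Sc(2))
qed

text \<open>By Weber's integral the difference is a superposition of the kernels
  \<open>Omega_sq n (nsq n \<xi> * sqdist n x y)\<close>, with the weights \<open>Omega_sq n (nsq n \<xi>) - m\<close> times a Gaussian.\<close>

lemma psd_kernel_weight_difference:
  assumes n: "0 < n" and \<mu>: "0 < \<mu>" and m: "\<And>q. 0 \<le> q \<Longrightarrow> m \<le> Omega_sq n q"
  shows "psd_kernel (Rn n) (\<lambda>x y. shell_weight n \<mu> (vdiff n x y) - m * gauss_weight n \<mu> (vdiff n x y))"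
proof -
  let ?M = "Rn_lebesgue n"
  \<comment> \<open>The dual width: a Gaussian in \<xi> with this parameter transforms into a
    multiple of exp(- \<mu> |z|^2), and its product with \<Omega>(|\<xi>|) into a multiple of the
    shell weight.\<close>
  define s where "s = 1 / (4 * \<mu>)"
  have s: "0 < s" using \<mu> by (simp add: s_def)
  define K where "K \<xi> x y = (Omega_sq n (nsq n \<xi>) - m) * exp (- s * nsq n \<xi>) * Omega_sq n (nsq n \<xi> * sqdist n x y)"
    for \<xi> x y
  have W: "integrable ?M (\<lambda>\<xi>. Omega_sq n (q * nsq n \<xi>) * Omega_sq n (nsq n \<xi>) * exp (- s * nsq n \<xi>))"
    "(\<integral>\<xi>. Omega_sq n (q * nsq n \<xi>) * Omega_sq n (nsq n \<xi>) * exp (- s * nsq n \<xi>) \<partial>?M)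
      = gauss_const n s * (exp (- \<mu>) * (exp (- \<mu> * q) * Omega_sq n (- (4 * \<mu>\<^sup>2) * q)))" if "0 \<le> q" for q
    using weber_integral[OF n \<mu> that] by (simp_all only: s_def)
  have B: "integrable ?M (\<lambda>\<xi>. exp (- s * nsq n \<xi>) * Omega_sq n (q * nsq n \<xi>))"
    "(\<integral>\<xi>. exp (- s * nsq n \<xi>) * Omega_sq n (q * nsq n \<xi>) \<partial>?M) = gauss_const n s * exp (- \<mu> * q)" for q
  proof -
    have "- (4 * s * (- \<mu> * q)) = q" using \<mu> by (simp add: s_def)
    then show "integrable ?M (\<lambda>\<xi>. exp (- s * nsq n \<xi>) * Omega_sq n (q * nsq n \<xi>))"
      "(\<integral>\<xi>. exp (- s * nsq n \<xi>) * Omega_sq n (q * nsq n \<xi>) \<partial>?M) = gauss_const n s * exp (- \<mu> * q)"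
      using bessel_moment[OF n s, of 0 "- \<mu> * q"] by (simp_all only: power_0 mult_1_left mult_1_right pochhammer_0 div_by_1 kummer_poly_0)
  qed
  have K_eq: "K \<xi> x y = Omega_sq n (sqdist n x y * nsq n \<xi>) * Omega_sq n (nsq n \<xi>) * exp (- s * nsq n \<xi>)
      - m * (exp (- s * nsq n \<xi>) * Omega_sq n (sqdist n x y * nsq n \<xi>))" for \<xi> x y
    unfolding K_def by (simp add: mult.commute[of "sqdist n x y"]) (simp add: algebra_simps)
  have sq: "0 \<le> sqdist n x y" for x y by (simp add: sqdist_eq_nsq_vdiff)
  have "psd_kernel (Rn n) (\<lambda>x y. \<integral>\<xi>. K \<xi> x y \<partial>?M)"
  proof (rule psd_kernel_integral)
    show "psd_kernel (Rn n) (K \<xi>)" for \<xi>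
      unfolding K_def using m[of "nsq n \<xi>"]
      by (intro psd_kernel_cmult psd_kernel_pullback[OF psd_kernel_Omega_sq_scaled[OF n nsq_nonneg], of "\<lambda>x. x", simplified])
        auto
    show "integrable ?M (\<lambda>\<xi>. K \<xi> x y)" for x y
      unfolding K_eq by (intro Bochner_Integration.integrable_diff integrable_mult_right W(1) B(1) sq)
  qed
  moreover have "(\<integral>\<xi>. K \<xi> x y \<partial>?M) = gauss_const n s * (exp (- \<mu>) * (exp (- \<mu> * sqdist n x y) * Omega_sq n (- (4 * \<mu>\<^sup>2) * sqdist n x y)))
      - m * (gauss_const n s * exp (- \<mu> * sqdist n x y))" for x y
    unfolding K_eq using W[OF sq] B
    by (subst Bochner_Integration.integral_diff) (auto simp only: integral_mult_right_zero intro!: integrable_mult_right)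
  ultimately have psd: "psd_kernel (Rn n) (\<lambda>x y. gauss_const n s * (exp (- \<mu>) * (exp (- \<mu> * sqdist n x y) * Omega_sq n (- (4 * \<mu>\<^sup>2) * sqdist n x y)))
      - m * (gauss_const n s * exp (- \<mu> * sqdist n x y)))" by simp
  have c: "0 < gauss_const n s" "0 < gauss_const n \<mu>" using s \<mu> by (simp_all add: gauss_const_pos)
  have "psd_kernel (Rn n) (\<lambda>x y. (1 / (gauss_const n s * gauss_const n \<mu>)) * (gauss_const n s * (exp (- \<mu>) * (exp (- \<mu> * sqdist n x y) * Omega_sq n (- (4 * \<mu>\<^sup>2) * sqdist n x y)))
      - m * (gauss_const n s * exp (- \<mu> * sqdist n x y))))"
    by (rule psd_kernel_cmult[OF psd]) (use c in simp)
  then show ?thesis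
    by (rule psd_kernel_cong) (use c in \<open>simp add: shell_weight_def gauss_weight_def sqdist_eq_nsq_vdiff field_simps\<close>)
qed

text \<open>A function of the squared norm, to match \<open>nsq\<close>. Since \<open>sqrt\<close>
  is odd, the profile is continuous on the whole line, as \<open>concentration\<close>
  requires.\<close>

definition radial_profile :: "nat \<Rightarrow> ((nat \<Rightarrow> real) \<Rightarrow> real) \<Rightarrow> real \<Rightarrow> real" where
  "radial_profile n f q = f (\<lambda>i\<in>{..<n}. if i = 0 then sqrt q else 0)"

lemma L2_set_eq_nsq: "L2_set x {..<n} = sqrt (nsq n x)"
  by (simp add: L2_set_def nsq_def)

lemma radial_profile:
  assumes n: "0 < n" and f: "positive_type_Rn n f" "radial n f"
  shows "continuous_on UNIV (radial_profile n f)"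
    and "\<And>x. x \<in> Rn n \<Longrightarrow> f x = radial_profile n f (nsq n x)"
    and "\<And>x. \<bar>f (vdiff n x y)\<bar> \<le> f (\<lambda>i\<in>{..<n}. 0)"
    and "\<And>q. 0 \<le> q \<Longrightarrow> \<bar>radial_profile n f q\<bar> \<le> radial_profile n f 0"
    and "radial_profile n f 0 = f (\<lambda>i\<in>{..<n}. 0)"
    and "psd_kernel (Rn n) (\<lambda>x y. f (vdiff n x y))"
proof -
  define e where "e q = (\<lambda>i\<in>{..<n}. if i = 0 then sqrt q else 0)" for q
  have e_Rn: "e q \<in> Rn n" for q by (simp add: e_def Rn_def)
  have e_nsq: "nsq n (e q) = q" if "0 \<le> q" for q
    using n that unfolding nsq_def e_def
    by (subst sum.remove[of _ 0]) (auto intro!: sum.neutral)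
  have "continuous_map euclideanreal (Rn_top n) e"
    unfolding Rn_top_def e_def
    by (auto simp: continuous_map_componentwise intro!: continuous_intros)
  moreover have "continuous_map (Rn_top n) euclideanreal f" using f(1) by (simp add: positive_type_Rn_def)
  ultimately have "continuous_map euclideanreal euclideanreal (f \<circ> e)" by (rule continuous_map_compose)
  then show "continuous_on UNIV (radial_profile n f)"
    by (simp add: radial_profile_def[abs_def] e_def[abs_def] o_def)
  show *: "f x = radial_profile n f (nsq n x)" if "x \<in> Rn n" for x
  proof -
    have "L2_set x {..<n} = L2_set (e (nsq n x)) {..<n}"
      by (simp only: L2_set_eq_nsq e_nsq[OF nsq_nonneg])
    then have "f x = f (e (nsq n x))" using f(2) that e_Rn unfolding radial_def by blast
    then show ?thesis by (simp only: radial_profile_def e_def)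
  qed
  show psd: "psd_kernel (Rn n) (\<lambda>x y. f (vdiff n x y))"
    using f(1) unfolding positive_type_Rn_def psd_kernel_def by blast
  have diag: "f (vdiff n x x) = f (\<lambda>i\<in>{..<n}. 0)" for x by (simp add: vdiff_def)
  \<comment> \<open>Positive type speaks about points of \<open>Rn n\<close>; restricting both
    arguments first extends the bound to arbitrary functions.\<close>
  have vdiff_restrict: "vdiff n x y = vdiff n (vaff n x 0 x) (vaff n y 0 y)" for x y
    by (auto simp: vdiff_def vaff_def)
  show bound: "\<bar>f (vdiff n x y)\<bar> \<le> f (\<lambda>i\<in>{..<n}. 0)" for x y
    unfolding vdiff_restrict[of x y]
    by (rule psd_kernel_bound[OF psd]) (auto simp: diag)
  show "radial_profile n f 0 = f (\<lambda>i\<in>{..<n}. 0)"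
    by (simp add: radial_profile_def cong: if_cong)
  then show "\<bar>radial_profile n f q\<bar> \<le> radial_profile n f 0" if "0 \<le> q" for q
    using bound[of "e q" "\<lambda>_. 0"] *[OF e_Rn] e_nsq[OF that] that
    by (simp add: vdiff_def e_def cong: restrict_cong)
qed

text \<open>Here \<mu> runs through the positive integers, corresponding to the Gaussian parameter 1
  / (4 \<mu>) on the frequency side. In the limit the shell weight evaluates the profile at 1 and
  the Gaussian weight evaluates it at 0.\<close>

lemma positive_type_lower_bound:
  assumes n: "0 < n" and f: "positive_type_Rn n f" "radial n f"
    and m: "\<And>q. 0 \<le> q \<Longrightarrow> m \<le> Omega_sq n q" and x: "x \<in> usphere n"
  shows "m * f (\<lambda>i\<in>{..<n}. 0) \<le> f x"
proof -
  let ?M = "Rn_lebesgue n"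
  note rp = radial_profile[OF n f]
  define F where "F = radial_profile n f"
  have F: "continuous_on UNIV F" "\<And>q. 0 \<le> q \<Longrightarrow> \<bar>F q\<bar> \<le> F 0" using rp(1,4) by (auto simp: F_def)
  note wc = weight_concentration[OF n F]
  define D where "D k = (\<integral>z. F (nsq n z) * shell_weight n (real (Suc k)) z \<partial>?M)
      - m * (\<integral>z. F (nsq n z) * gauss_weight n (real (Suc k)) z \<partial>?M)" for k
  have "0 \<le> D k" for k
  proof -
    define \<mu> where "\<mu> = real (Suc k)"
    have \<mu>: "0 < \<mu>" by (simp add: \<mu>_def)
    define H where "H z = F (nsq n z) * shell_weight n \<mu> z - m * (F (nsq n z) * gauss_weight n \<mu> z)" for z
    have int: "integrable ?M H"
      unfolding H_def \<mu>_def by (intro Bochner_Integration.integrable_diff integrable_mult_right wc)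
    have "psd_kernel (Rn n) (\<lambda>x y. f (vdiff n x y) * (shell_weight n \<mu> (vdiff n x y) - m * gauss_weight n \<mu> (vdiff n x y)))"
      by (intro psd_kernel_mult rp(6) psd_kernel_weight_difference n \<mu> m)
    then have "psd_kernel (Rn n) (\<lambda>x y. H (vdiff n x y))"
      by (rule psd_kernel_cong) (simp add: rp(2)[OF vdiff_in_Rn] H_def F_def algebra_simps)
    then have "0 \<le> (\<integral>z. H z \<partial>?M)"
      using int by (intro integral_psd_nonneg) auto
    also have "(\<integral>z. H z \<partial>?M) = D k"
      unfolding H_def D_def \<mu>_def using wc(1,3)
      by (subst Bochner_Integration.integral_diff) (auto simp only: integral_mult_right_zero intro!: integrable_mult_right)
    finally show ?thesis .
  qed
  moreover have "D \<longlonglongrightarrow> F 1 - m * F 0"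
    unfolding D_def by (intro tendsto_intros wc)
  ultimately have "0 \<le> F 1 - m * F 0" by (intro LIMSEQ_le_const) auto
  moreover have "f x = F 1"
    using x rp(2)[of x] by (auto simp: usphere_def L2_set_eq_nsq F_def)
  ultimately show ?thesis using rp(5) by (simp add: F_def)
qed

section \<open>The mean value\<close>

lemma quadratic_nonneg_discriminant:
  fixes a b q :: real
  assumes "\<And>t. 0 \<le> a * t\<^sup>2 + 2 * t * b + q" "0 \<le> a"
  shows "b\<^sup>2 \<le> a * q"
proof (cases "a = 0")
  case True
  then have "2 * b = 0" using assms(1) by (intro linear_nonneg_imp_zero[of _ q]) (simp add: mult_ac)
  then show ?thesis using True by simp
next
  case False
  then have "0 < a" using assms(2) by simp
  then show ?thesis using assms(1)[of "- b / a"] by (simp add: power2_eq_square field_simps)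
qed

lemma psd_kernel_cauchy_schwarz:
  assumes psd: "psd_kernel X K" and U: "finite U" "U \<subseteq> X" and x: "x \<in> X"
  shows "(\<Sum>y\<in>U. K x y * c y)\<^sup>2 \<le> K x x * (\<Sum>y\<in>U. \<Sum>z\<in>U. K y z * c y * c z)"
proof (rule quadratic_nonneg_discriminant)
  \<comment> \<open>\<open>None\<close> stands for the extra copy of \<open>x\<close> with the free
    weight \<open>t\<close>, so that \<open>x\<close> may also belong to \<open>U\<close>.\<close>
  define p where "p = case_option x (\<lambda>u. u)"
  fix t
  define e where "e = case_option t c"
  have "0 \<le> (\<Sum>i\<in>insert None (Some ` U). \<Sum>j\<in>insert None (Some ` U). K (p i) (p j) * e i * e j)"
    by (rule psd_kernel_family[OF psd]) (use U x in \<open>auto simp: p_def\<close>)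
  also have "\<dots> = K (p None) (p None) * (e None)\<^sup>2 + 2 * e None * (\<Sum>j\<in>Some ` U. K (p None) (p j) * e j)
      + (\<Sum>i\<in>Some ` U. \<Sum>j\<in>Some ` U. K (p i) (p j) * e i * e j)"
    by (rule quad_form_insert) (use U x psd_kernel_sym[OF psd] in \<open>auto simp: p_def\<close>)
  also have "\<dots> = K x x * t\<^sup>2 + 2 * t * (\<Sum>y\<in>U. K x y * c y) + (\<Sum>y\<in>U. \<Sum>z\<in>U. K y z * c y * c z)"
    by (simp add: sum.reindex p_def e_def)
  finally show "0 \<le> K x x * t\<^sup>2 + 2 * t * (\<Sum>y\<in>U. K x y * c y) + (\<Sum>y\<in>U. \<Sum>z\<in>U. K y z * c y * c z)" .
next
  show "0 \<le> K x x" using psd_kernel_quad[OF psd, of "{x}" "\<lambda>_. 1"] x by simp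
qed

lemma vaff_in_cube:
  assumes "z \<in> cube n S" "y \<in> cube n T"
  shows "vaff n y 1 z \<in> cube n (S + T)"
proof -
  have "y i + z i \<in> {- (S + T)..S + T}" if "i < n" for i
  proof -
    have "z i \<in> {-S..S}" "y i \<in> {-T..T}"
      using that PiE_mem[OF assms(1)[unfolded cube_def]] PiE_mem[OF assms(2)[unfolded cube_def]] by blast+
    then show ?thesis by simp
  qed
  then show ?thesis by (auto simp: cube_def vaff_def)
qed

definition cube_average :: "nat \<Rightarrow> ((nat \<Rightarrow> real) \<Rightarrow> real) \<Rightarrow> real \<Rightarrow> real" where
  "cube_average n f T = (\<integral>x. indicator (cube n T) x * f x \<partial>Rn_lebesgue n) / (2 * T) ^ n"

lemma mean_value_eqI:
  assumes "(cube_average n f \<longlongrightarrow> L) at_top"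
  shows "mean_value n f = L"
  unfolding mean_value_def
proof (rule tendsto_Lim)
  have "\<forall>\<^sub>F T in at_top. cube_average n f T
      = 1 / measure (Rn_lebesgue n) (cube n T) * (LINT x:cube n T|Rn_lebesgue n. f x)"
    using eventually_ge_at_top[of 0]
    by eventually_elim (simp add: cube_average_def measure_cube set_lebesgue_integral_def)
  then show "((\<lambda>T. 1 / measure (Rn_lebesgue n) (cube n T) * (LINT x:cube n T|Rn_lebesgue n. f x)) \<longlongrightarrow> L) at_top"
    by (rule Lim_transform_eventually[OF assms])
qed simp

lemma integrable_indicator_cube_mult:
  fixes f :: "(nat \<Rightarrow> real) \<Rightarrow> real"
  assumes [measurable]: "f \<in> borel_measurable (Rn_lebesgue n)" and B: "\<And>x. x \<in> Rn n \<Longrightarrow> \<bar>f x\<bar> \<le> B"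
  shows "integrable (Rn_lebesgue n) (\<lambda>x. indicator (cube n T) x * f x)"
proof (rule Bochner_Integration.integrable_bound)
  show "integrable (Rn_lebesgue n) (\<lambda>x. B * indicator (cube n T) x)"
    using integrable_indicator_cube by simp
  show "AE x in Rn_lebesgue n. norm (indicator (cube n T) x * f x) \<le> norm (B * indicator (cube n T) x)"
  proof (rule AE_I2)
    fix x assume "x \<in> space (Rn_lebesgue n)"
    then have "\<bar>f x\<bar> \<le> \<bar>B\<bar>" using B[of x] by simp
    then show "norm (indicator (cube n T) x * f x) \<le> norm (B * indicator (cube n T) x)"
      by (simp add: indicator_def)
  qed
qed measurable

text \<open>The cube and its translate both contain the cube shrunk by \<open>R\<close>, so their
  difference lies in two thin shells, where the integrand is bounded by \<open>B\<close>.\<close>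

lemma cube_average_translate:
  assumes [measurable]: "f \<in> borel_measurable (Rn_lebesgue n)" and B: "\<And>x. x \<in> Rn n \<Longrightarrow> \<bar>f x\<bar> \<le> B"
    and y: "y \<in> cube n R" and R: "0 \<le> R" "R \<le> T" "0 < T"
  shows "\<bar>cube_average n f T - cube_average n (\<lambda>x. f (vdiff n x y)) T\<bar>
    \<le> 2 * B * (1 - (2 * (T - R)) ^ n / (2 * T) ^ n)"
proof -
  let ?M = "Rn_lebesgue n"
  have B0: "0 \<le> B" using B[OF vdiff_in_Rn[of n y y]] by simp
  define g where "g x = indicator (cube n T) x * f (vdiff n x y)" for x
  have g: "g \<in> borel_measurable ?M" unfolding g_def by measurable
  have undo: "vdiff n (vaff n y 1 z) y = z" if "z \<in> Rn n" for z
    using that by (auto simp: vdiff_def vaff_def Rn_def PiE_def extensional_def fun_eq_iff)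
  have i1: "integrable ?M (\<lambda>x. indicator (cube n T) x * f x)" by (rule integrable_indicator_cube_mult[OF assms(1) B])
  have i2: "integrable ?M (\<lambda>z. indicator (cube n T) (vaff n y 1 z) :: real)"
    using integral_vaff(2)[of 1 "indicator (cube n T)" n y] integrable_indicator_cube by simp
  have e2: "(\<integral>z. indicator (cube n T) (vaff n y 1 z) \<partial>?M) = (2 * T) ^ n"
    using integral_vaff(1)[of 1 "indicator (cube n T)" n y] integral_indicator_cube[of T n] R by simp
  have i3: "integrable ?M (\<lambda>z. indicator (cube n T) (vaff n y 1 z) * f z)"
  proof (rule Bochner_Integration.integrable_bound[OF integrable_mult_right[of B, OF i2]])
    show "AE x in ?M. norm (indicator (cube n T) (vaff n y 1 x) * f x) \<le> norm (B * indicator (cube n T) (vaff n y 1 x))"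
    proof (rule AE_I2)
      fix x assume "x \<in> space ?M"
      then have "\<bar>f x\<bar> \<le> \<bar>B\<bar>" using B[of x] by simp
      then show "norm (indicator (cube n T) (vaff n y 1 x) * f x) \<le> norm (B * indicator (cube n T) (vaff n y 1 x))"
        by (simp add: indicator_def)
    qed
  qed measurable
  have "(\<integral>x. g x \<partial>?M) = (\<integral>z. g (vaff n y 1 z) \<partial>?M)"
    using integral_vaff(1)[OF _ g, of 1 y] by simp
  also have "\<dots> = (\<integral>z. indicator (cube n T) (vaff n y 1 z) * f z \<partial>?M)"
    by (intro Bochner_Integration.integral_cong refl) (simp add: g_def undo)
  finally have g_eq: "(\<integral>x. g x \<partial>?M) = (\<integral>z. indicator (cube n T) (vaff n y 1 z) * f z \<partial>?M)" .
  \<comment> \<open>An integrable majorant: it vanishes on the shrunk cube and is at least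
    \<open>B\<close> wherever exactly one of the two indicators is 1.\<close>
  let ?D = "\<lambda>z. B * (indicator (cube n T) z + indicator (cube n T) (vaff n y 1 z) - 2 * indicator (cube n (T - R)) z)"
  have D_int: "integrable ?M ?D"
    by (intro integrable_mult_right Bochner_Integration.integrable_diff Bochner_Integration.integrable_add i2 integrable_indicator_cube)
  have "\<bar>(\<integral>x. indicator (cube n T) x * f x \<partial>?M) - (\<integral>x. g x \<partial>?M)\<bar>
      = \<bar>\<integral>z. indicator (cube n T) z * f z - indicator (cube n T) (vaff n y 1 z) * f z \<partial>?M\<bar>"
    unfolding g_eq using i1 i3 by simp
  also have "\<dots> \<le> (\<integral>z. \<bar>indicator (cube n T) z * f z - indicator (cube n T) (vaff n y 1 z) * f z\<bar> \<partial>?M)"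
    by (rule integral_abs_bound)
  also have "\<dots> \<le> (\<integral>z. ?D z \<partial>?M)"
  proof (rule integral_mono[OF _ D_int])
    show "integrable ?M (\<lambda>z. \<bar>indicator (cube n T) z * f z - indicator (cube n T) (vaff n y 1 z) * f z\<bar>)"
      using i1 i3 by simp
    fix z assume "z \<in> space ?M"
    then have fz: "\<bar>f z\<bar> \<le> B" using B by simp
    have "z \<in> cube n T \<and> vaff n y 1 z \<in> cube n T" if "z \<in> cube n (T - R)"
      using that vaff_in_cube[OF that y] cube_mono[of "T - R" T n] R by auto
    then show "\<bar>indicator (cube n T) z * f z - indicator (cube n T) (vaff n y 1 z) * f z\<bar> \<le> ?D z"
      using fz B0 by (auto simp: indicator_def)
  qed
  also have "(\<integral>z. ?D z \<partial>?M) = B * ((2 * T) ^ n + (2 * T) ^ n - 2 * (2 * (T - R)) ^ n)"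
  proof -
    have "(\<integral>z. indicator (cube n T) z + indicator (cube n T) (vaff n y 1 z) - 2 * indicator (cube n (T - R)) z \<partial>?M)
        = (2 * T) ^ n + (2 * T) ^ n - 2 * (2 * (T - R)) ^ n"
      using R i2
      by (subst Bochner_Integration.integral_diff,
          intro Bochner_Integration.integrable_add integrable_indicator_cube i2,
          intro integrable_mult_right integrable_indicator_cube,
          subst Bochner_Integration.integral_add[OF integrable_indicator_cube i2])
        (simp only: integral_mult_right_zero integral_indicator_cube e2 diff_ge_0_iff_ge less_imp_le)
    then show ?thesis unfolding integral_mult_right_zero by simp
  qed
  finally have "\<bar>(\<integral>x. indicator (cube n T) x * f x \<partial>?M) - (\<integral>x. g x \<partial>?M)\<bar> / (2 * T) ^ n
      \<le> B * ((2 * T) ^ n + (2 * T) ^ n - 2 * (2 * (T - R)) ^ n) / (2 * T) ^ n"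
    using R by (intro divide_right_mono) auto
  also have "\<dots> = 2 * B * (1 - (2 * (T - R)) ^ n / (2 * T) ^ n)"
  proof -
    have gen: "B * (v + v - 2 * w) / v = 2 * B * (1 - w / v)" if "0 < v" for v w
      using that by (simp add: field_simps)
    show ?thesis by (rule gen) (use R in simp)
  qed
  also have "\<bar>(\<integral>x. indicator (cube n T) x * f x \<partial>?M) - (\<integral>x. g x \<partial>?M)\<bar> / (2 * T) ^ n
      = \<bar>cube_average n f T - cube_average n (\<lambda>x. f (vdiff n x y)) T\<bar>"
    using R by (simp add: cube_average_def g_def abs_divide flip: diff_divide_distrib)
  finally show ?thesis .
qed

text \<open>The mean value is the infimum of the quadratic form over weights of total mass one. Near a
  minimizer the convolution of \<open>f\<close> with the weights is almost constant, by Cauchy--Schwarz for the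
  positive definite kernel obtained by subtracting the infimum.\<close>

lemma mean_value_minimum:
  assumes n: "0 < n" and f: "positive_type_Rn n f" "radial n f"
  obtains L where "mean_value n f = L" "psd_kernel (Rn n) (\<lambda>x y. f (vdiff n x y) - L)"
    "\<And>a. psd_kernel (Rn n) (\<lambda>x y. f (vdiff n x y) - a) \<Longrightarrow> a \<le> L"
proof -
  let ?M = "Rn_lebesgue n"
  note rp = radial_profile[OF n f]
  note psd = rp(6)
  define f0 where "f0 = f (\<lambda>i\<in>{..<n}. 0)"
  define Q where "Q U c = (\<Sum>x\<in>U. \<Sum>y\<in>U. f (vdiff n x y) * c x * c y)" for U :: "(nat \<Rightarrow> real) set" and c
  define S where "S = {Q U c | U c. finite U \<and> U \<subseteq> Rn n \<and> sum c U = 1}"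
  define L where "L = Inf S"
  have Q_shift: "(\<Sum>x\<in>U. \<Sum>y\<in>U. (f (vdiff n x y) - a) * c x * c y) = Q U c - a * (sum c U)\<^sup>2" for U c a
  proof -
    have "(\<Sum>x\<in>U. \<Sum>y\<in>U. (f (vdiff n x y) - a) * c x * c y) = Q U c - (\<Sum>x\<in>U. \<Sum>y\<in>U. a * (c x * c y))"
      unfolding Q_def sum_subtractf[symmetric] by (intro sum.cong refl) (simp add: algebra_simps)
    also have "(\<Sum>x\<in>U. \<Sum>y\<in>U. a * (c x * c y)) = a * (sum c U)\<^sup>2"
      unfolding power2_eq_square sum_product by (simp only: sum_distrib_left)
    finally show ?thesis .
  qed
  have Q0: "0 \<le> Q U c" if "finite U" "U \<subseteq> Rn n" for U c
    unfolding Q_def by (rule psd_kernel_quad[OF psd that])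
  \<comment> \<open>\<open>vdiff n undefined undefined\<close> merely names some point of
    \<open>Rn n\<close>.\<close>
  have ne: "S \<noteq> {}"
  proof -
    have "finite {vdiff n undefined undefined}" "{vdiff n undefined undefined} \<subseteq> Rn n"
      "sum (\<lambda>_. 1 :: real) {vdiff n undefined undefined} = 1"
      by simp_all
    then have "Q {vdiff n undefined undefined} (\<lambda>_. 1) \<in> S" unfolding S_def by blast
    then show ?thesis by blast
  qed
  have bdd: "bdd_below S" by (rule bdd_belowI[of _ 0]) (auto simp: S_def Q0)
  have L0: "0 \<le> L" unfolding L_def by (rule cInf_greatest[OF ne]) (auto simp: S_def Q0)
  have Q_ge: "L * (sum c U)\<^sup>2 \<le> Q U c" if U: "finite U" "U \<subseteq> Rn n" for U c
  proof (cases "sum c U = 0")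
    case True
    then show ?thesis using Q0[OF U] by simp
  next
    case False
    define s where "s = sum c U"
    have s: "s \<noteq> 0" using False by (simp add: s_def)
    have "sum (\<lambda>x. c x / s) U = 1" using s by (simp add: s_def sum_divide_distrib[symmetric])
    then have "Q U (\<lambda>x. c x / s) \<in> S" unfolding S_def using U by blast
    then have "L \<le> Q U (\<lambda>x. c x / s)" unfolding L_def by (rule cInf_lower[OF _ bdd])
    also have "Q U (\<lambda>x. c x / s) = Q U c / s\<^sup>2"
      unfolding Q_def sum_divide_distrib by (intro sum.cong refl) (simp add: power2_eq_square)
    finally show ?thesis using s by (simp add: s_def field_simps)
  qed
  have psdL: "psd_kernel (Rn n) (\<lambda>x y. f (vdiff n x y) - L)"
  proof (rule psd_kernelI)
    show "f (vdiff n x y) - L = f (vdiff n y x) - L" if "x \<in> Rn n" "y \<in> Rn n" for x y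
      using psd_kernel_sym[OF psd that] by simp
    show "0 \<le> (\<Sum>x\<in>U. \<Sum>y\<in>U. (f (vdiff n x y) - L) * c x * c y)" if "finite U" "U \<subseteq> Rn n" for U c
      unfolding Q_shift using Q_ge[OF that, of c] by simp
  qed
  \<comment> \<open>Maximality of \<open>L\<close> determines the mean value of the extremal
    function in the final proof.\<close>
  have max: "a \<le> L" if a: "psd_kernel (Rn n) (\<lambda>x y. f (vdiff n x y) - a)" for a
    unfolding L_def
  proof (rule cInf_greatest[OF ne])
    fix v assume "v \<in> S"
    then obtain U c where v: "v = Q U c" "finite U" "U \<subseteq> Rn n" "sum c U = 1" unfolding S_def by blast
    show "a \<le> v" using psd_kernel_quad[OF a v(2,3), of c] unfolding Q_shift v(1,4) by simp
  qed
  have f0: "f (vdiff n x x) = f0" for x by (simp add: f0_def vdiff_def)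
  have bound: "\<bar>f (vdiff n x y)\<bar> \<le> f0" for x y unfolding f0_def by (rule rp(3))
  have fb: "\<bar>f x\<bar> \<le> f0" if "x \<in> Rn n" for x
    using rp(4)[of "nsq n x"] rp(2)[OF that] rp(5) by (simp add: f0_def)
  have f00: "0 \<le> f0" using bound[of undefined undefined] by simp
  have "(\<lambda>x. radial_profile n f (nsq n x)) \<in> borel_measurable ?M"
    using borel_measurable_continuous_onI[OF rp(1)] by simp
  then have fm [measurable]: "f \<in> borel_measurable ?M"
    by (rule measurable_cong[THEN iffD1, rotated]) (simp add: rp(2))
  have "(cube_average n f \<longlongrightarrow> L) at_top"
  proof (rule tendstoI)
    fix \<epsilon> :: real assume \<epsilon>: "0 < \<epsilon>"
    \<comment> \<open>Chosen so that Cauchy--Schwarz below gives \<epsilon> / 2; adding 1 keeps the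
      denominator positive if \<open>f0 = 0\<close>.\<close>
    define \<eta> where "\<eta> = (\<epsilon> / 2)\<^sup>2 / (f0 + 1)"
    have \<eta>: "0 < \<eta>" "\<eta> * f0 \<le> (\<epsilon> / 2)\<^sup>2"
      using \<epsilon> f00 by (simp_all add: \<eta>_def field_simps)
    have "Inf S < L + \<eta>" using \<eta>(1) by (simp add: L_def)
    then obtain v where "v \<in> S" "v < L + \<eta>" using cInf_lessD[OF ne] by blast
    then obtain U c where U: "finite U" "U \<subseteq> Rn n" "sum c U = 1" "Q U c < L + \<eta>" unfolding S_def by blast
    define h where "h x = (\<Sum>y\<in>U. c y * f (vdiff n x y))" for x
    \<comment> \<open>Cauchy--Schwarz for the kernel minus \<open>L\<close>: its diagonal is
      \<open>f0 - L\<close>, and its form at the near minimizer \<open>c\<close> is below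
      \<eta>.\<close>
    have h: "\<bar>h x - L\<bar> \<le> \<epsilon> / 2" if x: "x \<in> Rn n" for x
    proof -
      have "(\<Sum>y\<in>U. (f (vdiff n x y) - L) * c y) = h x - L"
        using U(3) by (simp add: h_def left_diff_distrib sum_subtractf mult.commute[of "f _"] flip: sum_distrib_left)
      then have "(h x - L)\<^sup>2 \<le> (f0 - L) * (Q U c - L)"
        using psd_kernel_cauchy_schwarz[OF psdL U(1,2) x, of c] unfolding Q_shift U(3) f0 by simp
      also have "\<dots> \<le> f0 * \<eta>"
      proof (rule mult_mono)
        show "0 \<le> Q U c - L" using Q_ge[OF U(1,2), of c] U(3) by simp
      qed (use L0 U(4) f00 in auto)
      also have "\<dots> \<le> (\<epsilon> / 2)\<^sup>2" using \<eta>(2) by (simp add: mult.commute)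
      finally have "\<bar>h x - L\<bar> \<le> \<bar>\<epsilon> / 2\<bar>" unfolding abs_le_square_iff .
      then show ?thesis using \<epsilon> by simp
    qed
    have "\<exists>R\<ge>0. \<forall>y\<in>U. y \<in> cube n R"
      using U(1,2)
    proof (induction U)
      case (insert y V)
      then obtain R where R: "0 \<le> R" "\<forall>y\<in>V. y \<in> cube n R" by auto
      obtain R' where R': "0 \<le> R'" "y \<in> cube n R'" using Rn_in_some_cube[of y n] insert.prems by auto
      show ?case
        using R R' cube_mono[of R "max R R'" n] cube_mono[of R' "max R R'" n]
        by (intro exI[of _ "max R R'"]) auto
    qed auto
    then obtain R where R: "0 \<le> R" "\<And>y. y \<in> U \<Longrightarrow> y \<in> cube n R" by auto
    define C where "C = (\<Sum>y\<in>U. \<bar>c y\<bar>)"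
    have fi: "integrable ?M (\<lambda>x. indicator (cube n T) x * f (vdiff n x y))" for T y
      by (rule integrable_indicator_cube_mult[of _ _ f0]) (use bound in auto)
    have avg: "\<bar>cube_average n f T - L\<bar> \<le> \<epsilon> / 2 + C * (2 * f0 * (1 - (2 * (T - R)) ^ n / (2 * T) ^ n))"
      if T: "R \<le> T" "0 < T" for T
    proof -
      define v where "v = (2 * T) ^ n"
      have v: "0 < v" using T by (simp add: v_def)
      have h_int_eq: "indicator (cube n T) x * h x = (\<Sum>y\<in>U. c y * (indicator (cube n T) x * f (vdiff n x y)))" for x
        unfolding h_def sum_distrib_left by (intro sum.cong refl) simp
      have hi: "integrable ?M (\<lambda>x. indicator (cube n T) x * h x)"
        unfolding h_int_eq by (intro Bochner_Integration.integrable_sum integrable_mult_right fi)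
      have "(\<integral>x. indicator (cube n T) x * h x \<partial>?M) = (\<Sum>y\<in>U. c y * (\<integral>x. indicator (cube n T) x * f (vdiff n x y) \<partial>?M))"
        unfolding h_int_eq using fi by (subst Bochner_Integration.integral_sum) auto
      then have h_avg: "cube_average n h T = (\<Sum>y\<in>U. c y * cube_average n (\<lambda>x. f (vdiff n x y)) T)"
        by (simp add: cube_average_def sum_divide_distrib)
      have ci: "integrable ?M (\<lambda>x. b * indicator (cube n T) x)" for b :: real
        by (intro integrable_mult_right integrable_indicator_cube)
      have cI: "(\<integral>x. b * indicator (cube n T) x \<partial>?M) = b * v" for b :: real
        unfolding integral_mult_right_zero using integral_indicator_cube[of T n] T by (simp add: v_def)
      have hb: "h x \<le> L + \<epsilon> / 2" "L - \<epsilon> / 2 \<le> h x" if "x \<in> Rn n" for x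
        using h[OF that] unfolding abs_le_iff by linarith+
      have "(\<integral>x. indicator (cube n T) x * h x \<partial>?M) \<le> (\<integral>x. (L + \<epsilon> / 2) * indicator (cube n T) x \<partial>?M)"
        by (rule integral_mono[OF hi ci]) (use hb in \<open>auto simp: indicator_def\<close>)
      moreover have "(\<integral>x. (L - \<epsilon> / 2) * indicator (cube n T) x \<partial>?M) \<le> (\<integral>x. indicator (cube n T) x * h x \<partial>?M)"
        by (rule integral_mono[OF ci hi]) (use hb in \<open>auto simp: indicator_def\<close>)
      ultimately have h_near: "\<bar>cube_average n h T - L\<bar> \<le> \<epsilon> / 2"
        unfolding cI cube_average_def v_def[symmetric] abs_le_iff using v by (simp add: field_simps)
      \<comment> \<open>As the weights add up to 1, the difference is a weighted sum of differences
        between the average of \<open>f\<close> and those of its translates, each of which dies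
        out.\<close>
      have "cube_average n f T - cube_average n h T
          = (\<Sum>y\<in>U. c y * (cube_average n f T - cube_average n (\<lambda>x. f (vdiff n x y)) T))"
        using U(3) by (simp add: h_avg right_diff_distrib sum_subtractf flip: sum_distrib_right)
      also have "\<bar>\<dots>\<bar> \<le> (\<Sum>y\<in>U. \<bar>c y\<bar> * (2 * f0 * (1 - (2 * (T - R)) ^ n / (2 * T) ^ n)))"
      proof (rule order_trans[OF sum_abs sum_mono])
        fix y assume "y \<in> U"
        then have "\<bar>cube_average n f T - cube_average n (\<lambda>x. f (vdiff n x y)) T\<bar> \<le> 2 * f0 * (1 - (2 * (T - R)) ^ n / (2 * T) ^ n)"
          using T R by (intro cube_average_translate fm fb) auto
        then show "\<bar>c y * (cube_average n f T - cube_average n (\<lambda>x. f (vdiff n x y)) T)\<bar>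
            \<le> \<bar>c y\<bar> * (2 * f0 * (1 - (2 * (T - R)) ^ n / (2 * T) ^ n))"
          unfolding abs_mult by (rule mult_left_mono) simp
      qed
      also have "\<dots> = C * (2 * f0 * (1 - (2 * (T - R)) ^ n / (2 * T) ^ n))"
        unfolding C_def by (rule sum_distrib_right[symmetric])
      finally show ?thesis using h_near by linarith
    qed
    have "((\<lambda>T. \<epsilon> / 2 + C * (2 * f0 * (1 - (2 * (T - R)) ^ n / (2 * T) ^ n))) \<longlongrightarrow> \<epsilon> / 2 + C * (2 * f0 * 0)) at_top"
      by (intro tendsto_intros cube_shell_tendsto)
    moreover have "\<epsilon> / 2 + C * (2 * f0 * 0) < \<epsilon>" using \<epsilon> by simp
    ultimately have "\<forall>\<^sub>F T in at_top. \<epsilon> / 2 + C * (2 * f0 * (1 - (2 * (T - R)) ^ n / (2 * T) ^ n)) < \<epsilon>"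
      by (rule order_tendstoD)
    then show "\<forall>\<^sub>F T in at_top. dist (cube_average n f T) L < \<epsilon>"
      using eventually_gt_at_top[of 0] eventually_ge_at_top[of R]
      by eventually_elim (use avg in \<open>auto simp: dist_real_def intro: order_le_less_trans\<close>)
  qed
  then have "mean_value n f = L" by (rule mean_value_eqI)
  then show thesis using that psdL max by blast
qed

section \<open>Bounds for the sphere parameter\<close>

lemma Omega_min_facts:
  assumes "2 \<le> n"
  obtains q\<^sub>0 where "0 \<le> q\<^sub>0" "Omega_sq n q\<^sub>0 = Omega_min n" "Omega_min n < 0"
    "\<And>q. 0 \<le> q \<Longrightarrow> Omega_min n \<le> Omega_sq n q"
proof -
  have "0 < n" using assms by simp
  then obtain q where "0 \<le> q" "Omega_sq n q < 0" using Omega_sq_negative_somewhere by blast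
  from Omega_min_attained[OF assms this] show thesis using that by blast
qed

lemma usphere_iff: "x \<in> usphere n \<longleftrightarrow> x \<in> Rn n \<and> nsq n x = 1"
  by (simp add: usphere_def L2_set_eq_nsq)

lemma sqdist_usphere:
  assumes "x \<in> usphere n" "y \<in> usphere n"
  shows "sqdist n x y = 2 - 2 * vdot n x y"
proof -
  have "sqdist n x y = nsq n x + nsq n y - 2 * vdot n x y"
    unfolding sqdist_def nsq_def vdot_def sum_distrib_left sum.distrib[symmetric] sum_subtractf[symmetric]
    by (intro sum.cong refl) (simp add: power2_diff)
  then show ?thesis using assms by (simp add: usphere_iff)
qed

lemma vdot_le_1:
  assumes "x \<in> usphere n" "y \<in> usphere n"
  shows "vdot n x y \<le> 1"
  using sqdist_usphere[OF assms] nsq_nonneg[of n "vdiff n x y"] by (simp add: sqdist_eq_nsq_vdiff)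

text \<open>The construction of the extremal function, restricted to the sphere, where the squared
  distance is 2 - 2 s at inner product s. The scale \<open>r\<close> puts the minimum of \<Omega> at
  inner product \<open>t\<close>, and \<open>a\<close> lifts that minimum to 0, so the function is
  nonnegative throughout.\<close>

lemma sphere_test_function:
  assumes n: "2 \<le> n" and t: "t < 1"
  obtains g where "positive_type_sphere n g" "g 1 = 1" "g t = 0" "\<And>s. s \<le> 1 \<Longrightarrow> 0 \<le> g s"
proof -
  have n0: "0 < n" using n by simp
  obtain q\<^sub>0 where q\<^sub>0: "0 \<le> q\<^sub>0" "Omega_sq n q\<^sub>0 = Omega_min n" "Omega_min n < 0"
    "\<And>q. 0 \<le> q \<Longrightarrow> Omega_min n \<le> Omega_sq n q"
    using Omega_min_facts[OF n] by blast
  define m where "m = Omega_min n"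
  have m: "m < 0" using q\<^sub>0(3) by (simp add: m_def)
  define a where "a = - m / (1 - m)"
  have a: "0 \<le> a" "0 \<le> 1 - a" "a + (1 - a) * m = 0"
    using m by (simp_all add: a_def field_simps)
  define r where "r = q\<^sub>0 / (2 - 2 * t)"
  have r: "0 \<le> r" using q\<^sub>0(1) t by (simp add: r_def)
  define g where "g s = a + (1 - a) * Omega_sq n (r * (2 - 2 * s))" for s
  show thesis
  proof (rule that)
    show "g 1 = 1" by (simp add: g_def Omega_sq_0)
    have "r * (2 - 2 * t) = q\<^sub>0" using t by (simp add: r_def)
    then show "g t = 0" using a(3) q\<^sub>0(2) by (simp add: g_def m_def)
    show "0 \<le> g s" if "s \<le> 1" for s
    proof -
      have "m \<le> Omega_sq n (r * (2 - 2 * s))" unfolding m_def using r that by (intro q\<^sub>0(4)) simp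
      then have "(1 - a) * m \<le> (1 - a) * Omega_sq n (r * (2 - 2 * s))" by (rule mult_left_mono[OF _ a(2)])
      then show ?thesis using a(3) by (simp add: g_def)
    qed
    have "psd_kernel UNIV (\<lambda>x y. a + (1 - a) * Omega_sq n (r * sqdist n x y))"
      by (intro psd_kernel_add psd_kernel_const psd_kernel_cmult psd_kernel_Omega_sq_scaled n0 a r)
    then have "psd_kernel (usphere n) (\<lambda>x y. a + (1 - a) * Omega_sq n (r * sqdist n x y))"
      using psd_kernel_pullback[of UNIV _ "\<lambda>x. x" "usphere n"] by simp
    then have "psd_kernel (usphere n) (\<lambda>x y. g (vdot n x y))"
      by (rule psd_kernel_cong) (simp add: g_def sqdist_usphere)
    moreover have "continuous_on {-1..1} g"
      unfolding g_def by (intro continuous_intros continuous_on_compose2[OF continuous_on_Omega_sq[OF n0, of UNIV]]) auto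
    ultimately show "positive_type_sphere n g"
      unfolding positive_type_sphere_def psd_kernel_def by blast
  qed
qed

section \<open>Mass of the surface measure and the bounds 0 and 1\<close>

lemma space_sphere_measure: "space (sphere_measure n) \<subseteq> usphere n"
  by (simp add: sphere_measure_def space_restrict_space)

text \<open>The mass is the volume of a part of the ball divided by the volume of the ball, so
  monotonicity bounds it by 1 whatever that volume is.\<close>

lemma emeasure_sphere_measure_le_1: "emeasure (sphere_measure n) (space (sphere_measure n)) \<le> 1"
proof -
  let ?M = "Rn_lebesgue n"
  define Bl where "Bl = {x \<in> Rn n. L2_set x {..<n} \<le> 1}"
  define P where "P = (\<lambda>x. \<lambda>i\<in>{..<n}. x i / L2_set x {..<n})"
  have Bl: "Bl \<in> sets ?M"
  proof -
    have "{x \<in> space ?M. sqrt (nsq n x) \<le> 1} \<in> sets ?M" by measurable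
    then show ?thesis by (simp add: Bl_def L2_set_eq_nsq)
  qed
  have sph: "usphere n \<in> sets ?M"
  proof -
    have "{x \<in> space ?M. nsq n x = 1} \<in> sets ?M" by measurable
    moreover have "usphere n = {x \<in> space ?M. nsq n x = 1}" by (auto simp: usphere_iff)
    ultimately show ?thesis by simp
  qed
  have "usphere n \<inter> Rn n = usphere n" by (auto simp: usphere_iff)
  then have sph': "usphere n \<inter> Rn n \<in> sets ?M" using sph by simp
  have P: "P \<in> ?M \<rightarrow>\<^sub>M ?M"
  proof -
    have "(\<lambda>x. \<lambda>i\<in>{..<n}. x i / L2_set x {..<n}) \<in> ?M \<rightarrow>\<^sub>M (\<Pi>\<^sub>M i\<in>{..<n}. lborel)"
    proof (rule measurable_restrict)
      fix i assume "i \<in> {..<n}"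
      then have [measurable]: "(\<lambda>x. x i) \<in> borel_measurable ?M" by (intro measurable_Rn_component) simp
      show "(\<lambda>x. x i / L2_set x {..<n}) \<in> ?M \<rightarrow>\<^sub>M lborel"
        unfolding L2_set_eq_nsq by (simp only: measurable_lborel1 measurable_lborel2) measurable
    qed
    then show ?thesis by (simp add: P_def Rn_lebesgue_def)
  qed
  let ?D = "distr (uniform_measure ?M Bl) ?M P"
  have "emeasure (sphere_measure n) (space (sphere_measure n)) = emeasure ?D (usphere n \<inter> Rn n)"
    unfolding sphere_measure_def Bl_def[symmetric] P_def[symmetric]
    using sph' by (subst emeasure_restrict_space) (auto simp: space_restrict_space)
  also have "\<dots> = emeasure (uniform_measure ?M Bl) (P -` (usphere n \<inter> Rn n) \<inter> Rn n)"
  proof -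
    have "P \<in> uniform_measure ?M Bl \<rightarrow>\<^sub>M ?M" using P by simp
    then show ?thesis using sph' by (subst emeasure_distr) simp_all
  qed
  also have "\<dots> = emeasure ?M (Bl \<inter> (P -` (usphere n \<inter> Rn n) \<inter> Rn n)) / emeasure ?M Bl"
  proof (rule emeasure_uniform_measure[OF Bl])
    from measurable_sets[OF P sph'] show "P -` (usphere n \<inter> Rn n) \<inter> Rn n \<in> sets ?M" by simp
  qed
  also have "\<dots> \<le> 1"
  proof (cases "emeasure ?M Bl = 0")
    case True
    have "emeasure ?M (Bl \<inter> (P -` (usphere n \<inter> Rn n) \<inter> Rn n)) \<le> emeasure ?M Bl"
      by (rule emeasure_mono) (use Bl in auto)
    then show ?thesis using True by simp
  next
    case False
    have "emeasure ?M (Bl \<inter> (P -` (usphere n \<inter> Rn n) \<inter> Rn n)) \<le> emeasure ?M Bl"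
      by (rule emeasure_mono) (use Bl in auto)
    then show ?thesis using False by (intro divide_le_posI_ennreal) (auto simp: zero_less_iff_neq_zero)
  qed
  finally show ?thesis .
qed

text \<open>A function that is not integrable has integral 0, which also satisfies the bound. The
  lemma can therefore be applied to the inner and then to the outer integral of
  \<open>sphere_integral\<close> directly.\<close>

lemma integral_sphere_measure_le_1:
  assumes "\<And>x. x \<in> usphere n \<Longrightarrow> f x \<le> 1"
  shows "(\<integral>x. f x \<partial>sphere_measure n) \<le> (1 :: real)"
proof (cases "integrable (sphere_measure n) f")
  case True
  let ?S = "sphere_measure n"
  have fin: "emeasure ?S (space ?S) \<noteq> \<infinity>"
    using emeasure_sphere_measure_le_1[of n] by (auto simp: top_unique)
  interpret finite_measure ?S by (rule finite_measureI[OF fin])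
  have "(\<integral>x. f x \<partial>?S) \<le> (\<integral>x. 1 \<partial>?S)"
    using True assms space_sphere_measure[of n] by (intro integral_mono) auto
  also have "\<dots> = measure ?S (space ?S)" by simp
  also have "\<dots> \<le> 1"
    using emeasure_sphere_measure_le_1[of n] by (simp add: emeasure_eq_measure)
  finally show ?thesis .
qed (simp add: not_integrable_integral_eq)

lemma sphere_integral_le_1:
  assumes f: "positive_type_sphere n f" "f 1 = 1"
  shows "sphere_integral n f \<le> 1"
proof -
  have psd: "psd_kernel (usphere n) (\<lambda>x y. f (vdot n x y))"
    using f(1) unfolding positive_type_sphere_def psd_kernel_def by blast
  have diag: "f (vdot n x x) = 1" if "x \<in> usphere n" for x
  proof -
    have "vdot n x x = nsq n x" by (simp add: vdot_def nsq_def power2_eq_square)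
    then show ?thesis using that f(2) by (simp add: usphere_iff)
  qed
  have "f (vdot n x y) \<le> 1" if "x \<in> usphere n" "y \<in> usphere n" for x y
    using psd_kernel_bound[OF psd that, of 1] diag by simp
  then show ?thesis
    unfolding sphere_integral_def by (intro integral_sphere_measure_le_1)
qed

lemma Sup_unit_interval:
  fixes A :: "real set"
  assumes "x \<in> A" "0 \<le> x" "\<And>y. y \<in> A \<Longrightarrow> y \<le> 1"
  shows "0 \<le> Sup A \<and> Sup A \<le> 1"
proof
  have "bdd_above A" using assms(3) by (rule bdd_aboveI)
  then show "0 \<le> Sup A" using assms(1,2) cSup_upper order_trans by blast
  show "Sup A \<le> 1" using assms(1,3) by (intro cSup_least) auto
qed

text \<open>One test function serves all levels: it vanishes at \<open>t\<close>, and by induction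
  the recursive bound is nonnegative, because \<open>t / (1 + t)\<close> stays in [0, 1). Its
  nonnegative integral bounds the supremum from below; the bound above is that of the
  integrals.\<close>

lemma theta_sphere_bounds:
  "2 \<le> k \<Longrightarrow> k \<le> n \<Longrightarrow> 0 \<le> t \<Longrightarrow> t < 1 \<Longrightarrow> 0 \<le> theta_sphere n k t \<and> theta_sphere n k t \<le> 1"
proof (induction k arbitrary: n t)
  case 0
  then show ?case by simp
next
  case (Suc k)
  have n: "2 \<le> n" using Suc.prems by simp
  obtain g where g: "positive_type_sphere n g" "g 1 = 1" "g t = 0" "\<And>s. s \<le> 1 \<Longrightarrow> 0 \<le> g s"
    using sphere_test_function[OF n Suc.prems(4)] by blast
  have g0: "0 \<le> sphere_integral n g"
    unfolding sphere_integral_def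
    using g(4) vdot_le_1 space_sphere_measure[of n]
    by (intro Bochner_Integration.integral_nonneg) (meson subsetD)
  show ?case
  proof (cases "k = 1")
    case True
    then have k: "Suc k = Suc (Suc 0)" by simp
    show ?thesis unfolding k theta_sphere.simps
      by (rule Sup_unit_interval[OF _ g0]) (use g sphere_integral_le_1 in auto)
  next
    case False
    then have "2 \<le> k" using Suc.prems(1) by simp
    then obtain j where "k = 2 + j" using le_Suc_ex by blast
    then have k: "k = Suc (Suc j)" by simp
    have "0 \<le> theta_sphere (n - 1) (Suc (Suc j)) (t / (1 + t))"
    proof -
      have "0 \<le> theta_sphere (n - 1) k (t / (1 + t)) \<and> theta_sphere (n - 1) k (t / (1 + t)) \<le> 1"
        by (rule Suc.IH) (use Suc.prems k in \<open>auto simp: field_simps\<close>)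
      then show ?thesis by (simp add: k)
    qed
    then have mem: "sphere_integral n g \<in> {sphere_integral n f |f. positive_type_sphere n f \<and> f 1 = 1 \<and>
        f t \<le> theta_sphere (n - 1) (Suc (Suc j)) (t / (1 + t))}"
      using g by auto
    show ?thesis unfolding k theta_sphere.simps
      by (rule Sup_unit_interval[OF mem g0]) (use sphere_integral_le_1 in auto)
  qed
qed

lemma continuous_map_nsq: "continuous_map (Rn_top n) euclideanreal (nsq n)"
  unfolding nsq_def[abs_def] Rn_top_def
  by (intro continuous_map_sum continuous_map_real_pow continuous_map_product_projection) auto

lemma usphere_nonempty: "0 < n \<Longrightarrow> \<exists>x. x \<in> usphere n"
proof (intro exI)
  assume n: "0 < n"
  define e where "e = (\<lambda>i\<in>{..<n}. if i = 0 then 1 else 0 :: real)"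
  have "nsq n e = 1"
    using n unfolding nsq_def e_def by (subst sum.remove[of _ 0]) (auto intro!: sum.neutral)
  moreover have "e \<in> Rn n" by (simp add: e_def Rn_def)
  ultimately show "e \<in> usphere n" by (simp add: usphere_iff)
qed

section \<open>Upper bound and extremal function\<close>

theorem theorem3p2:
  fixes n k :: nat
  assumes "2 \<le> n" and "3 \<le> k" and "k \<le> n + 1"
  shows "theta_Rn n k =
    (theta_sphere n (k - 1) (1 / 2) - Omega_min n) / (1 - Omega_min n)"
proof -
  have n0: "0 < n" using assms(1) by simp
  obtain q\<^sub>0 where q\<^sub>0: "0 \<le> q\<^sub>0" "Omega_sq n q\<^sub>0 = Omega_min n" "Omega_min n < 0"
    "\<And>q. 0 \<le> q \<Longrightarrow> Omega_min n \<le> Omega_sq n q"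
    using Omega_min_facts[OF assms(1)] by blast
  define m where "m = Omega_min n"
  define \<theta> where "\<theta> = theta_sphere n (k - 1) (1 / 2)"
  have m: "m < 0" using q\<^sub>0(3) by (simp add: m_def)
  have \<theta>: "0 \<le> \<theta>" "\<theta> \<le> 1" using theta_sphere_bounds[of "k - 1" n "1 / 2"] assms by (auto simp: \<theta>_def)
  \<comment> \<open>The solution of \<open>a + (1 - a) * m = \<theta>\<close>: the constant part for
    which the extremal function takes exactly the permitted value at distance one.\<close>
  define a where "a = (\<theta> - m) / (1 - m)"
  have a: "0 \<le> a" "0 \<le> 1 - a" "a + (1 - a) * m = \<theta>"
  proof -
    show "0 \<le> a" "0 \<le> 1 - a" using m \<theta> by (simp_all add: a_def)
    have "a * (1 - m) = \<theta> - m" using m by (simp add: a_def)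
    then show "a + (1 - a) * m = \<theta>" by (simp add: algebra_simps)
  qed
  define feasible where "feasible f \<longleftrightarrow> positive_type_Rn n f \<and> radial n f \<and> f (\<lambda>i\<in>{..<n}. 0) = 1 \<and>
      (\<forall>x\<in>usphere n. f x \<le> \<theta>)" for f
  have upper: "mean_value n f \<le> a" if "feasible f" for f
  proof -
    have f: "positive_type_Rn n f" "radial n f" "f (\<lambda>i\<in>{..<n}. 0) = 1" "\<And>x. x \<in> usphere n \<Longrightarrow> f x \<le> \<theta>"
      using that by (auto simp: feasible_def)
    obtain L where L: "mean_value n f = L" "psd_kernel (Rn n) (\<lambda>x y. f (vdiff n x y) - L)"
      using mean_value_minimum[OF n0 f(1,2)] by blast
    define g where "g x = f x - L" for x
    have "continuous_map (Rn_top n) euclideanreal g"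
      unfolding g_def using f(1) by (intro continuous_map_diff) (auto simp: positive_type_Rn_def)
    then have g: "positive_type_Rn n g"
      using L(2) unfolding positive_type_Rn_def psd_kernel_def g_def by blast
    have gr: "radial n g" using f(2) unfolding radial_def g_def by metis
    obtain x where x: "x \<in> usphere n" using usphere_nonempty[OF n0] by blast
    have "m * (1 - L) \<le> f x - L"
      using positive_type_lower_bound[OF n0 g gr q\<^sub>0(4) x] f(3) by (simp add: g_def m_def)
    then have "L * (1 - m) \<le> \<theta> - m" using f(4)[OF x] by (simp add: algebra_simps)
    then show ?thesis using m L(1) by (simp add: a_def pos_le_divide_eq)
  qed
  define f where "f x = a + (1 - a) * Omega_sq n (q\<^sub>0 * nsq n x)" for x
  have psd_Omega: "psd_kernel (Rn n) (\<lambda>x y. (1 - a) * Omega_sq n (q\<^sub>0 * nsq n (vdiff n x y)))"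
    using psd_kernel_pullback[OF psd_kernel_cmult[OF psd_kernel_Omega_sq_scaled[OF n0 q\<^sub>0(1)] a(2)], of "\<lambda>x. x" "Rn n"]
    by (simp add: sqdist_eq_nsq_vdiff)
  have "continuous_map (Rn_top n) euclideanreal (\<lambda>x. Omega_sq n (q\<^sub>0 * nsq n x))"
  proof -
    have "continuous_map euclideanreal euclideanreal (\<lambda>q. Omega_sq n (q\<^sub>0 * q))"
      by (auto intro!: continuous_on_compose2[OF continuous_on_Omega_sq[OF n0, of UNIV]] continuous_intros)
    from continuous_map_compose[OF continuous_map_nsq this] show ?thesis by (simp add: o_def)
  qed
  then have "continuous_map (Rn_top n) euclideanreal f"
    unfolding f_def by (intro continuous_map_add continuous_map_real_mult) auto
  moreover have "psd_kernel (Rn n) (\<lambda>x y. f (vdiff n x y))"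
    unfolding f_def by (intro psd_kernel_add psd_kernel_const a psd_Omega)
  ultimately have f_pt: "positive_type_Rn n f"
    unfolding positive_type_Rn_def psd_kernel_def by blast
  have f_rad: "radial n f" by (simp add: radial_def f_def L2_set_eq_nsq)
  have "nsq n (\<lambda>i\<in>{..<n}. 0) = 0" by (simp add: nsq_def)
  then have f_0: "f (\<lambda>i\<in>{..<n}. 0) = 1" by (simp add: f_def Omega_sq_0)
  have f_1: "f x = \<theta>" if "x \<in> usphere n" for x
    using that a(3) q\<^sub>0(2) by (simp add: f_def usphere_iff m_def)
  have feas: "feasible f" using f_pt f_rad f_0 f_1 by (simp add: feasible_def)
  obtain L where L: "mean_value n f = L"
    "\<And>b. psd_kernel (Rn n) (\<lambda>x y. f (vdiff n x y) - b) \<Longrightarrow> b \<le> L"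
    using mean_value_minimum[OF n0 f_pt f_rad] by blast
  \<comment> \<open>The extremal function minus \<open>a\<close> is a nonnegative multiple of
    \<Omega>, hence of positive type, so its mean value is at least \<open>a\<close>. The upper
    bound, applied to this function, gives equality.\<close>
  have "a \<le> L" by (rule L(2)) (use psd_Omega in \<open>simp add: f_def\<close>)
  with upper[OF feas] L(1) have "mean_value n f = a" by simp
  then have "Sup {mean_value n f | f. feasible f} = a"
    using feas upper by (intro cSup_eq_maximum) blast+
  then show ?thesis by (simp add: theta_Rn_def feasible_def \<theta>_def a_def m_def)
qed

end
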